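(* Let $N$ be the expanded directed plabic network of a cylindric 2-loop plabic graph with edge weights $(x,y,z)$ as in the context, and let $T_e(x,y,z)=(x',y',z')$. Then: (1) the network with weights $(x',y',z')$ has the same boundary measurements as the network with weights $(x,y,z)$; (2) $T_e$ is an involution, i.e. $T_e(x',y',z')=(x,y,z)$; (3) $(x,y,z)$ and $(x',y',z')$ are the only choices of weights on this fixed cylindric 2-loop plabic graph (of the form described, with the same edges set to 1) that give these boundary measurements; (4) $T_e$ satisfies the braid relation: for a cylindric 3-loop plabic network with strings labeled $1,2,3$ from left to right and no interior vertices, writing $T_e^{(i,i+1)}$ for $T_e$ applied to strings $i$ and $i+1$ and the edges between them, one has $T_e^{(1,2)}\circ T_e^{(2,3)}\circ T_e^{(1,2)}=T_e^{(2,3)}\circ T_e^{(1,2)}\circ T_e^{(2,3)}$.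
   Context: Networks on a cylinder. A cylinder is drawn as a rectangle whose left and right sides are the two boundary components and whose top and bottom are identified. A planar directed network on the cylinder is a directed graph embedded in it with boundary vertices $b_1,\dots,b_n$ (labeled from top to bottom on the left boundary, then bottom to top on the right boundary), each a source or sink, and a positive real weight $x_e$ on each edge; the weight $x_P$ of a path is the product of its edge weights. Fix a cut $\gamma$, an oriented curve from one boundary component to the other avoiding vertices, drawn as the top/bottom of the rectangle. For a path $P$, $int(P)$ is the number of crossings of $\gamma$ from the right minus the number from the left. $C_P$ is the closed curve obtained by following $P$ and then returning along the boundary (going down along the boundary; if the endpoints are on different components, going down to the base point of the cut, along the cut or its reverse, and down along the boundary to the start). $wind(C_P)$ is the signed number of full counterclockwise turns of the tangent of $C_P$ after gluing the rectangle into an annulus so that going up the rectangle corresponds to going clockwise. The boundary measurement for a source $b_i$ and sink $b_j$ is the rational function in $\zeta$ obtained by summing the formal series $M_{ij}=\sum_{P:b_i\to b_j}(-1)^{wind(C_P)-1}\zeta^{int(P)}x_P$. Cylindric 2-loop plabic graphs. A cylindric 2-loop plabic graph is a plabic graph on a cylinder arising (black vertices in counterclockwise faces, white vertices in clockwise faces, joined when faces share a corner) from a Postnikov diagram (alternating strand diagram) in which exactly two strands are loops around the cylinder with the same orientation. These loops give two strings (left and right) of alternating black and white vertices around the cylinder; we consider such a graph with no vertices other than those on the two strings. Black vertices of the left string have extra edges only to the left boundary, white vertices of the left string only to the right string, black vertices of the right string only to the left string, white vertices of the right string only to the right boundary. Canonical orientation: string edges oriented upward, all other edges oriented left to right. Edges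 from a white vertex to a black vertex carry variable weights, all other edges weight 1. The expanded directed plabic network is obtained by splitting every vertex having several edges to the other string into that many vertices with vertices of the opposite color inserted between them, new edges getting weight 1 (these edges are said to be "set to 1"); all interior faces are then hexagons with two white vertices on the left string and two black vertices on the right string. Labels. Going up the left string, the white-to-black edges of a fundamental domain are $x_1,\dots,x_n$; going up the right string the white-to-black edges are $y_1,\dots,y_n$; the edge between the strings from the lower (white) endpoint of $x_{i+1}$ to the upper (black) endpoint of $y_i$ is $z_i$. Indices are modulo $n$. Some of these weights may be set to 1 by the expansion. Define $$\lambda_i(x,y,z)=\sum_{j=i}^{i+n-1}\Big(\prod_{k=i+1}^{j}x_k\Big)z_j\Big(\prod_{k=j+1}^{i+n-1}y_k\Big),$$ which is the sum of weights of the paths on the universal cover from the lower endpoint of $x_{i+1}$ to the upper endpoint of the next copy of $y_{i-1}$ one period higher. Let $A_i=\{i-j: j\ge1,\ x_{i-1}=\dots=x_{i-j}=1\text{ (set to 1)}\}$, $\alpha_i=|A_i|$, and $B_i=\{i+j: j\ge 1,\ y_{i+1}=\dots=y_{i+j}=1\text{ (set to 1)}\}$, $\beta_i=|B_i|$. Writing $\lambda_i$ for $\lambda_i(x,y,z)$, the edge weighted plabic R-matrix $T_e:(x,y,z)\mapsto(x',y',z')$ is $$x_i'=\begin{cases}1 & x_i\text{ set to }1,\\ \dfrac{\left(\prod_{k=0}^{\alpha_i}y_{i-k-1}\right)\lambda_{i-\alpha_i-1}}{\lambda_i}&\text{otherwise,}\end{cases}\qquad y_i'=\begin{cases}1 &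 y_i\text{ set to }1,\\ \dfrac{\left(\prod_{k=0}^{\beta_i}x_{i+k+1}\right)\lambda_{i+\beta_i+1}}{\lambda_i}&\text{otherwise,}\end{cases}$$ $$z_i'=\frac{z_i\left(\prod_{k=1}^{\alpha_i}y_{i-k-1}\right)\lambda_{i-\alpha_i-1}\left(\prod_{k=1}^{\beta_i}x_{i+k+1}\right)\lambda_{i+\beta_i+1}}{\lambda_{i-1}\lambda_{i+1}}.$$
   Formalization: In z_i' the left-string factor (the product of the y's, λ_{i-α_i-1} and 1/λ_{i-1}) is taken at index i+1 instead of i, as the printed formula breaks (1) when some x is set to 1; each string vertex is taken to have at least one edge leaving its string. *)

theory Defs
  imports
    "HOL-Analysis.Analysis"
    "HOL-Computational_Algebra.Computational_Algebra"
begin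

section \<open>Directed networks on a cylinder and their boundary measurements\<close>

text \<open>
  The cylinder is the rectangle with real part in \<open>[0,1]\<close> and imaginary part in \<open>[0,1]\<close>, bottom
  and top identified; its left and right sides are the boundary components. The cut is the
  bottom/top side, oriented from left to right, with base points at the two corners. No vertex lies
  on it. Edges are drawn as straight segments on the universal cover (the strip with real part in
  \<open>[0,1]\<close>), and \<open>crossings e\<close> is the number of times \<open>e\<close> crosses the cut from its right side (i.e.
  from below) minus the number of times it crosses it from its left side: a lift of \<open>e\<close> that starts
  at \<open>loc (src e)\<close> ends at \<open>loc (tgt e) + crossings e * \<i>\<close>. The sources and sinks are the boundary
  vertices; they are referred to directly instead of by a number.
\<close>

record ('v, 'e) cyl_network =
  arcs :: "'e set"
  src :: "'e \<Rightarrow> 'v"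
  tgt :: "'e \<Rightarrow> 'v"
  loc :: "'v \<Rightarrow> complex"
  crossings :: "'e \<Rightarrow> int"
  wgt :: "'e \<Rightarrow> real"
  sources :: "'v set"
  sinks :: "'v set"

definition is_path :: "('v, 'e) cyl_network \<Rightarrow> 'v \<Rightarrow> 'e list \<Rightarrow> 'v \<Rightarrow> bool" where
  "is_path N u P v \<longleftrightarrow>
     P \<noteq> [] \<and> set P \<subseteq> arcs N \<and> src N (hd P) = u \<and> tgt N (last P) = v \<and>
     successively (\<lambda>e f. tgt N e = src N f) P"

definition path_weight :: "('v, 'e) cyl_network \<Rightarrow> 'e list \<Rightarrow> real" where
  "path_weight N P = (\<Prod>e\<leftarrow>P. wgt N e)"

definition path_int :: "('v, 'e) cyl_network \<Rightarrow> 'e list \<Rightarrow> int" where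
  "path_int N P = (\<Sum>e\<leftarrow>P. crossings N e)"

definition arc_step :: "('v, 'e) cyl_network \<Rightarrow> 'e \<Rightarrow> complex" where
  "arc_step N e = loc N (tgt N e) + of_int (crossings N e) * \<i> - loc N (src N e)"

text \<open>
  The steps by which \<open>C_P\<close> returns from the end \<open>v\<close> of \<open>P\<close> to its start \<open>u\<close>. On the same component:
  down along the boundary. On different components: down to the base point of the cut, along the
  cut or its reverse to the other component, and down to \<open>u\<close>.
\<close>

definition return_steps :: "('v, 'e) cyl_network \<Rightarrow> 'v \<Rightarrow> 'v \<Rightarrow> complex list" where
  "return_steps N v u =
     (let p = loc N v; q = loc N u in
      if Re p = Re q
      then [- \<i> * of_real (if Im q < Im p then Im p - Im q else Im p - Im q + 1)]
      else [- \<i> * of_real (Im p), of_real (Re q - Re p), - \<i> * of_real (1 - Im q)])"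

definition closed_steps :: "('v, 'e) cyl_network \<Rightarrow> 'e list \<Rightarrow> complex list" where
  "closed_steps N P =
     map (arc_step N) P @ return_steps N (tgt N (last P)) (src N (hd P))"

text \<open>
  The map \<open>z \<mapsto> exp (- 2 * pi * z)\<close> glues the rectangle into an annulus, preserving orientation, so
  that going up corresponds to going clockwise. Being conformal, it preserves the exterior angle
  \<open>Arg (d' / d)\<close> between consecutive steps \<open>d\<close>, \<open>d'\<close> of a polygon; along the image of a straight step
  \<open>d\<close> the argument of the tangent changes by \<open>- 2 * pi * Im d\<close>. Hence the image of a closed polygon
  with steps \<open>ds\<close> has the following number of full counterclockwise turns of the tangent, which is
  an integer.
\<close>

definition tangent_turns :: "complex list \<Rightarrow> real" where
  "tangent_turns ds =
     ((\<Sum>k<length ds. Arg (ds ! (Suc k mod length ds) / ds ! k))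
        - (\<Sum>d\<leftarrow>ds. 2 * pi * Im d)) / (2 * pi)"

definition wind :: "('v, 'e) cyl_network \<Rightarrow> 'e list \<Rightarrow> int" where
  "wind N P = (THE w. real_of_int w = tangent_turns (closed_steps N P))"

definition measurement_series :: "('v, 'e) cyl_network \<Rightarrow> 'v \<Rightarrow> 'v \<Rightarrow> real fls" where
  "measurement_series N u v =
     Abs_fls (\<lambda>m. \<Sum>\<^sub>\<infinity> P \<in> {P. is_path N u P v \<and> path_int N P = m}.
                   (- 1) powi (wind N P - 1) * path_weight N P)"

text \<open>The rational function in \<open>\<zeta>\<close> whose Laurent expansion at 0 is the formal series above.\<close>

definition boundary_measurement ::
  "('v, 'e) cyl_network \<Rightarrow> 'v \<Rightarrow> 'v \<Rightarrow> real poly fract" where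
  "boundary_measurement N u v =
     (THE r. \<exists>p q. q \<noteq> 0 \<and> r = Fract p q \<and>
        fps_to_fls (fps_of_poly q) * measurement_series N u v = fps_to_fls (fps_of_poly p))"

definition same_boundary_measurements ::
  "('v, 'e) cyl_network \<Rightarrow> ('v, 'e) cyl_network \<Rightarrow> bool" where
  "same_boundary_measurements N N' \<longleftrightarrow>
     sources N = sources N' \<and> sinks N = sinks N' \<and>
     (\<forall>u\<in>sources N. \<forall>v\<in>sinks N. boundary_measurement N u v = boundary_measurement N' u v)"


section \<open>Cylindric loop plabic graphs whose vertices all lie on the strings\<close>

text \<open>
  Everything is described on the universal cover of the cylinder. String \<open>s\<close> (\<open>1 \<le> s \<le> strings G\<close>,
  from left to right) has, going up, the vertices \<open>\<dots>\<close>, white \<open>k\<close>, black \<open>k\<close>, white \<open>k + 1\<close>, black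
  \<open>k + 1\<close>, \<open>\<dots>\<close> (\<open>k\<close> an integer), with \<open>string_len G s\<close> of each colour per period. The edges between
  column \<open>s\<close> and column \<open>s + 1\<close> (column \<open>0\<close> is the left boundary, column \<open>strings G + 1\<close> the right
  boundary) are numbered from bottom to top by the integers, \<open>edge_count G s\<close> of them per period;
  edge \<open>i\<close> joins white vertex \<open>lend G s i\<close> of string \<open>s\<close> to black vertex \<open>rend G s i\<close> of string
  \<open>s + 1\<close>, where for \<open>s = 0\<close> (\<open>s = strings G\<close>) the left (right) end is a boundary vertex, which
  has no other edge.
\<close>

record loop_graph =
  strings :: nat
  string_len :: "nat \<Rightarrow> nat"
  edge_count :: "nat \<Rightarrow> nat"
  lend :: "nat \<Rightarrow> int \<Rightarrow> int"
  rend :: "nat \<Rightarrow> int \<Rightarrow> int"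

text \<open>Monotonicity is planarity; surjectivity says that every vertex has an edge leaving its string.\<close>

definition well_formed :: "loop_graph \<Rightarrow> bool" where
  "well_formed G \<longleftrightarrow>
     (\<forall>s\<in>{1..strings G}. 0 < string_len G s) \<and>
     (\<forall>s\<le>strings G. 0 < edge_count G s) \<and>
     (\<forall>i. lend G 0 i = i) \<and> (\<forall>i. rend G (strings G) i = i) \<and>
     (\<forall>s\<in>{1..strings G}. mono (lend G s) \<and> surj (lend G s) \<and>
        (\<forall>i. lend G s (i + int (edge_count G s)) = lend G s i + int (string_len G s))) \<and>
     (\<forall>s<strings G. mono (rend G s) \<and> surj (rend G s) \<and>
        (\<forall>i. rend G s (i + int (edge_count G s)) = rend G s i + int (string_len G (Suc s))))"

text \<open>
  Oriented edges. On string \<open>s\<close>, position \<open>2 * k\<close> is white vertex \<open>k\<close> and position \<open>2 * k + 1\<close> is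
  black vertex \<open>k\<close>; \<open>Up s j\<close> and \<open>Down s j\<close> are the two orientations of the edge between positions
  \<open>j\<close> and \<open>j + 1\<close>. \<open>East s i\<close> and \<open>West s i\<close> are the orientations of edge \<open>i\<close> between columns \<open>s\<close> and
  \<open>s + 1\<close>.
\<close>

datatype dart = Up nat int | Down nat int | East nat int | West nat int

definition darts :: "loop_graph \<Rightarrow> dart set" where
  "darts G = {Up s j |s j. s \<in> {1..strings G}} \<union> {Down s j |s j. s \<in> {1..strings G}} \<union>
             {East s i |s i. s \<le> strings G} \<union> {West s i |s i. s \<le> strings G}"

primrec reverse :: "dart \<Rightarrow> dart" where
  "reverse (Up s j) = Down s j"
| "reverse (Down s j) = Up s j"
| "reverse (East s i) = West s i"
| "reverse (West s i) = East s i"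

primrec translate :: "loop_graph \<Rightarrow> int \<Rightarrow> dart \<Rightarrow> dart" where
  "translate G t (Up s j) = Up s (j + 2 * int (string_len G s) * t)"
| "translate G t (Down s j) = Down s (j + 2 * int (string_len G s) * t)"
| "translate G t (East s i) = East s (i + int (edge_count G s) * t)"
| "translate G t (West s i) = West s (i + int (edge_count G s) * t)"

text \<open>
  The strands of the Postnikov diagram. A strand crosses an edge of the plabic graph at its
  midpoint, and a strand follows the boundary of a face counterclockwise around a black vertex and
  clockwise around a white one. Recording a strand by the edges that it crosses, each oriented along
  the strand, it turns maximally right at black vertices and maximally left at white vertices. It
  ends (\<open>None\<close>) at the boundary.
\<close>

primrec strand_step :: "loop_graph \<Rightarrow> dart \<Rightarrow> dart option" where
  "strand_step G (Up s j) = Some (Up s (j + 1))"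
| "strand_step G (Down s j) = Some
     (if odd j then West (s - 1) (GREATEST i. rend G (s - 1) i = j div 2)
      else East s (GREATEST i. lend G s i = j div 2))"
| "strand_step G (East s i) =
     (if s = strings G then None
      else Some (if rend G s (i - 1) = rend G s i then West s (i - 1)
                 else Down (s + 1) (2 * rend G s i)))"
| "strand_step G (West s i) =
     (if s = 0 then None
      else Some (if lend G s (i - 1) = lend G s i then East s (i - 1)
                 else Down s (2 * lend G s i - 1)))"

definition strand :: "loop_graph \<Rightarrow> nat \<Rightarrow> dart \<Rightarrow> dart option" where
  "strand G m d = ((\<lambda>r. Option.bind r (strand_step G)) ^^ m) (Some d)"

text \<open>
  The conditions on a Postnikov diagram (on the universal cover): no strand crosses itself, and no
  two strands cross twice in the same order along both of them. The strands that are loops are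
  exactly the upward ones along the strings, so there are \<open>k\<close> of them, equally oriented.
\<close>

definition k_loop_plabic :: "nat \<Rightarrow> loop_graph \<Rightarrow> bool" where
  "k_loop_plabic k G \<longleftrightarrow>
     strings G = k \<and> well_formed G \<and>
     (\<forall>d\<in>darts G. \<forall>m. strand G m d \<noteq> Some (reverse d)) \<and>
     (\<forall>d\<in>darts G. \<not> (\<exists>e m m'. 0 < m \<and> 0 < m' \<and>
        strand G m d = Some e \<and> strand G m' (reverse d) = Some (reverse e))) \<and>
     (\<forall>d\<in>darts G. (\<exists>m t. 0 < m \<and> strand G m d = Some (translate G t d)) \<longleftrightarrow>
        (\<exists>s j. d = Up s j))"


section \<open>The expanded directed network of a 2-loop graph\<close>

text \<open>
  In the expansion of strings \<open>s\<close> and \<open>s + 1\<close> every end of an edge \<open>z\<^sub>i\<close> between them gets its own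
  vertex. Going up the left string, \<open>z\<^sub>i\<^sub>-\<^sub>1\<close> leaves from the lower endpoint of \<open>x\<^sub>i\<close> and \<open>z\<^sub>i\<close> from the
  lower endpoint of \<open>x\<^sub>i\<^sub>+\<^sub>1\<close>, so \<open>x\<^sub>i\<close> is an edge created by the expansion iff \<open>z\<^sub>i\<^sub>-\<^sub>1\<close> and \<open>z\<^sub>i\<close> had the
  same white endpoint. Similarly \<open>z\<^sub>i\<^sub>-\<^sub>1\<close> and \<open>z\<^sub>i\<close> arrive at the upper endpoints of \<open>y\<^sub>i\<^sub>-\<^sub>1\<close> and \<open>y\<^sub>i\<close>.
\<close>

definition x_set :: "loop_graph \<Rightarrow> nat \<Rightarrow> int \<Rightarrow> bool" where
  "x_set G s i \<longleftrightarrow> lend G s (i - 1) = lend G s i"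

definition y_set :: "loop_graph \<Rightarrow> nat \<Rightarrow> int \<Rightarrow> bool" where
  "y_set G s i \<longleftrightarrow> rend G s (i - 1) = rend G s i"

text \<open>
  The indices of the expanded edges \<open>x\<^sub>i\<close>, \<open>y\<^sub>i\<close> that come from the original white-to-black edge
  between white \<open>k\<close> and black \<open>k\<close>.
\<close>

definition x_index :: "loop_graph \<Rightarrow> nat \<Rightarrow> int \<Rightarrow> int" where
  "x_index G s k = (THE i. lend G s (i - 1) = k \<and> lend G s i \<noteq> k)"

definition y_index :: "loop_graph \<Rightarrow> nat \<Rightarrow> int \<Rightarrow> int" where
  "y_index G s k = (THE i. rend G s (i - 1) \<noteq> k \<and> rend G s i = k)"

text \<open>
  Vertices and edges of the universal cover of the expanded network: \<open>LW i\<close>, \<open>LB i\<close> are the lower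
  and upper endpoint of \<open>X i\<close>, and \<open>RW i\<close>, \<open>RB i\<close> those of \<open>Y i\<close>. \<open>LUp\<close> and \<open>RUp\<close> are the
  black-to-white edges of the strings.
\<close>

datatype vertex = LBd int | LW int | LB int | RW int | RB int | RBd int

datatype edge = In int | X int | LUp int | Z int | Y int | RUp int | Out int

primrec start :: "loop_graph \<Rightarrow> edge \<Rightarrow> vertex" where
  "start G (In t) = LBd t"
| "start G (X i) = LW i"
| "start G (LUp i) = LB i"
| "start G (Z i) = LW (i + 1)"
| "start G (Y i) = RW i"
| "start G (RUp i) = RB i"
| "start G (Out t) = RW (y_index G 1 (lend G 2 t))"

primrec finish :: "loop_graph \<Rightarrow> edge \<Rightarrow> vertex" where
  "finish G (In t) = LB (x_index G 1 (rend G 0 t))"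
| "finish G (X i) = LB i"
| "finish G (LUp i) = LW (i + 1)"
| "finish G (Z i) = RB i"
| "finish G (Y i) = RB i"
| "finish G (RUp i) = RW (i + 1)"
| "finish G (Out t) = RBd t"

primrec shift :: "loop_graph \<Rightarrow> int \<Rightarrow> vertex \<Rightarrow> vertex" where
  "shift G t (LBd i) = LBd (i + int (edge_count G 0) * t)"
| "shift G t (LW i) = LW (i + int (edge_count G 1) * t)"
| "shift G t (LB i) = LB (i + int (edge_count G 1) * t)"
| "shift G t (RW i) = RW (i + int (edge_count G 1) * t)"
| "shift G t (RB i) = RB (i + int (edge_count G 1) * t)"
| "shift G t (RBd i) = RBd (i + int (edge_count G 2) * t)"

primrec representative :: "loop_graph \<Rightarrow> vertex \<Rightarrow> vertex" where
  "representative G (LBd i) = LBd (i mod int (edge_count G 0))"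
| "representative G (LW i) = LW (i mod int (edge_count G 1))"
| "representative G (LB i) = LB (i mod int (edge_count G 1))"
| "representative G (RW i) = RW (i mod int (edge_count G 1))"
| "representative G (RB i) = RB (i mod int (edge_count G 1))"
| "representative G (RBd i) = RBd (i mod int (edge_count G 2))"

primrec column :: "vertex \<Rightarrow> real" where
  "column (LBd i) = 0"
| "column (LW i) = 1 / 3"
| "column (LB i) = 1 / 3"
| "column (RW i) = 2 / 3"
| "column (RB i) = 2 / 3"
| "column (RBd i) = 1"

text \<open>
  The network is drawn with vertical strings; the heights of the vertices on the universal cover
  are arbitrary subject to the order along each column, to periodicity and to avoiding the cut
  (the integer heights). In particular the cut can be anywhere relative to the labels.
\<close>

definition is_drawing :: "loop_graph \<Rightarrow> (vertex \<Rightarrow> real) \<Rightarrow> bool" where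
  "is_drawing G h \<longleftrightarrow>
     (\<forall>i. h (LBd i) < h (LBd (i + 1)) \<and> h (RBd i) < h (RBd (i + 1)) \<and>
          h (LW i) < h (LB i) \<and> h (LB i) < h (LW (i + 1)) \<and>
          h (RW i) < h (RB i) \<and> h (RB i) < h (RW (i + 1))) \<and>
     (\<forall>v. h (shift G 1 v) = h v + 1) \<and>
     (\<forall>v. h v \<notin> \<int>)"

type_synonym weights = "(int \<Rightarrow> real) \<times> (int \<Rightarrow> real) \<times> (int \<Rightarrow> real)"

text \<open>Weights are indexed modulo \<open>n\<close>, i.e. are \<open>n\<close>-periodic functions of an integer index.\<close>

definition is_weighting :: "loop_graph \<Rightarrow> weights \<Rightarrow> bool" where
  "is_weighting G w \<longleftrightarrow>
     (case w of (x, y, z) \<Rightarrow>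
       (\<forall>i. x (i + int (edge_count G 1)) = x i \<and> y (i + int (edge_count G 1)) = y i \<and>
            z (i + int (edge_count G 1)) = z i) \<and>
       (\<forall>i. 0 < x i \<and> 0 < y i \<and> 0 < z i) \<and>
       (\<forall>i. x_set G 1 i \<longrightarrow> x i = 1) \<and> (\<forall>i. y_set G 1 i \<longrightarrow> y i = 1))"

primrec edge_weight :: "weights \<Rightarrow> edge \<Rightarrow> real" where
  "edge_weight w (In t) = 1"
| "edge_weight w (X i) = fst w i"
| "edge_weight w (LUp i) = 1"
| "edge_weight w (Z i) = snd (snd w) i"
| "edge_weight w (Y i) = fst (snd w) i"
| "edge_weight w (RUp i) = 1"
| "edge_weight w (Out t) = 1"

definition expanded_network ::
  "loop_graph \<Rightarrow> (vertex \<Rightarrow> real) \<Rightarrow> weights \<Rightarrow> (vertex, edge) cyl_network" where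
  "expanded_network G h w =
     \<lparr> arcs = In ` {0..<int (edge_count G 0)} \<union> Out ` {0..<int (edge_count G 2)} \<union>
              (\<Union>i\<in>{0..<int (edge_count G 1)}. {X i, LUp i, Z i, Y i, RUp i}),
       src = (\<lambda>e. representative G (start G e)),
       tgt = (\<lambda>e. representative G (finish G e)),
       loc = (\<lambda>v. Complex (column v) (frac (h v))),
       crossings = (\<lambda>e. \<lfloor>h (finish G e)\<rfloor> - \<lfloor>h (start G e)\<rfloor>),
       wgt = edge_weight w,
       sources = LBd ` {0..<int (edge_count G 0)},
       sinks = RBd ` {0..<int (edge_count G 2)} \<rparr>"


section \<open>The edge weighted plabic R-matrix\<close>

definition lam ::
  "nat \<Rightarrow> (int \<Rightarrow> real) \<Rightarrow> (int \<Rightarrow> real) \<Rightarrow> (int \<Rightarrow> real) \<Rightarrow> int \<Rightarrow> real" where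
  "lam n x y z i =
     (\<Sum>j\<in>{i..i + int n - 1}. (\<Prod>k\<in>{i + 1..j}. x k) * z j * (\<Prod>k\<in>{j + 1..i + int n - 1}. y k))"

definition alpha :: "(int \<Rightarrow> bool) \<Rightarrow> int \<Rightarrow> nat" where
  "alpha xset i = card {i - j |j. 1 \<le> j \<and> (\<forall>k\<in>{1..j}. xset (i - k))}"

definition beta :: "(int \<Rightarrow> bool) \<Rightarrow> int \<Rightarrow> nat" where
  "beta yset i = card {i + j |j. 1 \<le> j \<and> (\<forall>k\<in>{1..j}. yset (i + k))}"

text \<open>
  \<open>T_e\<close> is the transformation \<open>x\<^sub>i \<mapsto> y\<^sub>i\<^sub>-\<^sub>1 \<lambda>\<^sub>i\<^sub>-\<^sub>1 / \<lambda>\<^sub>i\<close>, \<open>y\<^sub>i \<mapsto> x\<^sub>i\<^sub>+\<^sub>1 \<lambda>\<^sub>i\<^sub>+\<^sub>1 / \<lambda>\<^sub>i\<close>, \<open>z\<^sub>i \<mapsto> z\<^sub>i\<close> followed by the gauge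
  transformations that restore the edges set to 1. Removing the weights of the set edges
  immediately below the lower endpoint of \<open>x\<^sub>i\<^sub>+\<^sub>1\<close>, i.e. \<open>x\<^sub>i, x\<^sub>i\<^sub>-\<^sub>1, \<dots>\<close>, multiplies \<open>z\<^sub>i\<close> (which leaves
  that endpoint) by their product. Therefore the left-string factor of \<open>z\<^sub>i'\<close>,
  \<open>(\<Prod>k = 1..\<alpha>\<^sub>j. y\<^sub>j\<^sub>-\<^sub>k\<^sub>-\<^sub>1) \<lambda>\<^sub>j\<^sub>-\<^sub>\<alpha>\<^sub>-\<^sub>1 / \<lambda>\<^sub>j\<^sub>-\<^sub>1\<close>, is taken at \<open>j = i + 1\<close>. (Taken at \<open>j = i\<close>, as the formula is
  sometimes printed, it belongs to the labelling in which \<open>z\<^sub>i\<close> leaves the lower endpoint of \<open>x\<^sub>i\<close>;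
  this is incompatible with \<open>\<lambda>\<^sub>i\<close> and does not preserve the boundary measurements.)
\<close>

definition T_e ::
  "nat \<Rightarrow> (int \<Rightarrow> bool) \<Rightarrow> (int \<Rightarrow> bool) \<Rightarrow> weights \<Rightarrow> weights" where
  "T_e n xset yset w =
     (case w of (x, y, z) \<Rightarrow>
       let L = lam n x y z; a = alpha xset; b = beta yset in
       (\<lambda>i. if xset i then 1
            else (\<Prod>k=0..a i. y (i - int k - 1)) * L (i - int (a i) - 1) / L i,
        \<lambda>i. if yset i then 1
            else (\<Prod>k=0..b i. x (i + int k + 1)) * L (i + int (b i) + 1) / L i,
        \<lambda>i. let j = i + 1 in
            z i * (\<Prod>k=1..a j. y (j - int k - 1)) * L (j - int (a j) - 1)
                * (\<Prod>k=1..b i. x (i + int k + 1)) * L (i + int (b i) + 1)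
              / (L (j - 1) * L (i + 1))))"

definition T_graph :: "loop_graph \<Rightarrow> weights \<Rightarrow> weights" where
  "T_graph G = T_e (edge_count G 1) (x_set G 1) (y_set G 1)"


section \<open>Acting on two adjacent strings of a graph with several strings\<close>

text \<open>
  Weights of the (unexpanded) graph: \<open>fst w s k\<close> is the weight of the edge from white \<open>k\<close> to black
  \<open>k\<close> on string \<open>s\<close>, and \<open>snd w s i\<close> that of edge \<open>i\<close> between strings \<open>s\<close> and \<open>s + 1\<close>.
\<close>

type_synonym string_weights = "(nat \<Rightarrow> int \<Rightarrow> real) \<times> (nat \<Rightarrow> int \<Rightarrow> real)"

definition is_string_weighting :: "loop_graph \<Rightarrow> string_weights \<Rightarrow> bool" where
  "is_string_weighting G w \<longleftrightarrow>
     (\<forall>s\<in>{1..strings G}. \<forall>k. 0 < fst w s k \<and> fst w s (k + int (string_len G s)) = fst w s k) \<and>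
     (\<forall>s\<in>{1..<strings G}. \<forall>i. 0 < snd w s i \<and> snd w s (i + int (edge_count G s)) = snd w s i)"

definition expand_weights :: "loop_graph \<Rightarrow> nat \<Rightarrow> string_weights \<Rightarrow> weights" where
  "expand_weights G s w =
     (\<lambda>i. if x_set G s i then 1 else fst w s (lend G s (i - 1)),
      \<lambda>i. if y_set G s i then 1 else fst w (s + 1) (rend G s i),
      snd w s)"

definition T_strings :: "loop_graph \<Rightarrow> nat \<Rightarrow> string_weights \<Rightarrow> string_weights" where
  "T_strings G s w =
     (case T_e (edge_count G s) (x_set G s) (y_set G s) (expand_weights G s w) of (x', y', z') \<Rightarrow>
       ((fst w)(s := (\<lambda>k. x' (x_index G s k)), s + 1 := (\<lambda>k. y' (y_index G s k))),
        (snd w)(s := z')))"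

end

theory Submission
  imports Defs
begin

text \<open>
  Write \<open>x\<^sub>i = X\<^sub>i / X\<^sub>i\<^sub>-\<^sub>1\<close>, \<open>y\<^sub>i = Y\<^sub>i / Y\<^sub>i\<^sub>-\<^sub>1\<close> and \<open>z\<^sub>i = (S\<^sub>i\<^sub>+\<^sub>1 - S\<^sub>i) Y\<^sub>i / X\<^sub>i\<close>. The sum of the weights of the
  paths on the universal cover from the left string at height \<open>a\<close> to the right string at height \<open>b\<close>
  is then \<open>(S\<^sub>b - S\<^sub>a) Y\<^sub>b\<^sub>-\<^sub>1 / X\<^sub>a\<close>. If the products \<open>P\<close>, \<open>Q\<close> of the \<open>x\<^sub>i\<close> and of the \<open>y\<^sub>i\<close> over a period
  differ, \<open>S\<close> can be chosen with \<open>S\<^sub>i\<^sub>+\<^sub>n = (P / Q) S\<^sub>i\<close>, and up to gauge \<open>T_e\<close> is the substitution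
  \<open>X \<mapsto> X / S\<close>, \<open>Y \<mapsto> Y S\<close>, \<open>S \<mapsto> - 1 / S\<close>, which exchanges \<open>P\<close> and \<open>Q\<close>; if \<open>P = Q\<close>, it is the identity.
  This gives invariance and involutivity. Conversely the path sums satisfy a linear recurrence with
  characteristic roots \<open>P\<close>, \<open>Q\<close>, hence determine \<open>{P, Q}\<close>, and once the order of \<open>P\<close>, \<open>Q\<close> is fixed they
  determine the weights.

  All paths from a source to a sink with \<open>int = m\<close> have \<open>wind = 1 - m\<close>, since the tangent of a path
  stays in a half plane. So the boundary measurements are generating functions of the path sums, up
  to the sign \<open>(-1)\<^sup>m\<close>.

  For three strings with functions \<open>S\<^sub>1\<close>, \<open>S\<^sub>2\<close> let \<open>A\<close> and \<open>B\<close> be the discrete integrals of \<open>S\<^sub>1 dS\<^sub>2\<close> and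
  of \<open>S\<^sub>2 dS\<^sub>1\<close>. Summation by parts gives \<open>A + B = S\<^sub>1 S\<^sub>2\<close>, by which both sides of the braid relation
  send \<open>(S\<^sub>1, S\<^sub>2)\<close> to \<open>(- S\<^sub>1 / B, - S\<^sub>2 / A)\<close>.
\<close>

section \<open>Sums, products and primitives on the integers\<close>

text \<open>The weight sum of the paths on the universal cover from \<open>LB a\<close> to
  \<open>RW b\<close>; \<open>j\<close> is the index of the edge by which a path changes strings.
  \<open>lam\<close> is the case \<open>b = a + n\<close>.\<close>

definition kernel :: "(int \<Rightarrow> real) \<Rightarrow> (int \<Rightarrow> real) \<Rightarrow> (int \<Rightarrow> real) \<Rightarrow> int \<Rightarrow> int \<Rightarrow> real" where
  "kernel x y z a b = (\<Sum>j\<in>{a..b - 1}. (\<Prod>k\<in>{a + 1..j}. x k) * z j * (\<Prod>k\<in>{j + 1..b - 1}. y k))"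

lemma lam_eq_kernel: "lam n x y z i = kernel x y z i (i + int n)"
  by (simp add: lam_def kernel_def)

lemma kernel_empty: "b \<le> a \<Longrightarrow> kernel x y z a b = 0"
  by (simp add: kernel_def)

lemma sum_telescope_int:
  fixes S :: "int \<Rightarrow> real"
  assumes "a \<le> b"
  shows "(\<Sum>j\<in>{a..b - 1}. S (j + 1) - S j) = S b - S a"
  using assms
proof (induction b rule: int_ge_induct)
  case (step b)
  have "{a..b + 1 - 1} = insert b {a..b - 1}" using step by auto
  then show ?case using step by simp
qed simp

lemma prod_telescope_int:
  fixes X :: "int \<Rightarrow> real"
  assumes "a \<le> b" "\<And>k. X k \<noteq> 0"
  shows "(\<Prod>k\<in>{a + 1..b}. X k / X (k - 1)) = X b / X a"
  using assms(1)
proof (induction b rule: int_ge_induct)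
  case (step b)
  have "{a + 1..b + 1} = insert (b + 1) {a + 1..b}" using step by auto
  then show ?case using step assms(2) by simp
qed (simp add: assms(2))

lemma additive_primitive:
  fixes f :: "int \<Rightarrow> real"
  shows "\<exists>S. \<forall>i. S (i + 1) - S i = f i"
proof
  define S where "S i = (\<Sum>j\<in>{0..<i}. f j) - (\<Sum>j\<in>{i..<0}. f j)" for i
  show "\<forall>i. S (i + 1) - S i = f i"
  proof
    fix i :: int
    show "S (i + 1) - S i = f i"
    proof (cases "0 \<le> i")
      case True
      then have "{0..<i + 1} = insert i {0..<i}" by auto
      with True show ?thesis by (simp add: S_def)
    next
      case False
      then have "{i..<0} = insert i {i + 1..<0}" by auto
      with False show ?thesis by (simp add: S_def)
    qed
  qed
qed

lemma int_const_if_step: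
  fixes f :: "int \<Rightarrow> real"
  assumes "\<And>i. f (i + 1) = f i"
  shows "f i = f j"
proof -
  have *: "f b = f a" if "a \<le> b" for a b
    using that by (induction b rule: int_ge_induct) (simp_all add: assms)
  show ?thesis using *[of i j] *[of j i] by linarith
qed

text \<open>Exponentiate an additive primitive of \<open>ln f\<close>. As \<open>f\<close> has
  period \<open>l\<close>, the quotient \<open>X (i + l) / X i\<close> does not depend on
  \<open>i\<close>; its value is \<open>P\<close>.\<close>

lemma multiplicative_primitive:
  fixes f :: "int \<Rightarrow> real"
  assumes pos: "\<And>i. 0 < f i" and per: "\<And>i. f (i + l) = f i"
  obtains X P where "\<And>i. 0 < X i" "\<And>i. f i = X i / X (i - 1)" "0 < P" "\<And>i. X (i + l) = P * X i"
proof -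
  obtain S where S: "\<And>i. S (i + 1) - S i = ln (f i)"
    using additive_primitive[of "\<lambda>i. ln (f i)"] by blast
  define X where "X i = exp (S (i + 1))" for i
  have f: "f i = X i / X (i - 1)" for i
    using S[of i] pos[of i] by (simp add: X_def exp_diff[symmetric])
  have X: "0 < X i" for i by (simp add: X_def)
  have ratio: "X (i + 1 + l) / X (i + l) = X (i + 1) / X i" for i
    using f[of "i + 1 + l"] f[of "i + 1"] per[of "i + 1"] by (simp add: algebra_simps)
  have "X (i + 1 + l) / X (i + 1) = X (i + l) / X i" for i
    using ratio[of i] X[of i] X[of "i + l"] X[of "i + 1"] by (simp add: frac_eq_eq mult.commute)
  then have "X (i + l) / X i = X (0 + l) / X 0" for i
    by (rule int_const_if_step[where f = "\<lambda>i. X (i + l) / X i"])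
  then have "X (i + l) = X (0 + l) / X 0 * X i" for i
    using X[of i] by (metis less_irrefl nonzero_divide_eq_eq)
  then show ?thesis
    using that[of X "X (0 + l) / X 0"] f X by simp
qed

text \<open>Primitives have to be nowhere zero to be inverted. A constant sign passes to
  quasi-periodic primitives from the integrand; positivity does not, since their sign depends on
  whether the ratio exceeds 1.\<close>

definition const_sign :: "(int \<Rightarrow> real) \<Rightarrow> bool" where
  "const_sign f \<longleftrightarrow> (\<forall>i. 0 < f i) \<or> (\<forall>i. f i < 0)"

lemma const_sign_nonzero: "const_sign f \<Longrightarrow> f i \<noteq> 0"
  by (metis const_sign_def less_irrefl)

lemma const_sign_mult: "const_sign f \<Longrightarrow> const_sign g \<Longrightarrow> const_sign (\<lambda>i. f i * g (u i))"
  unfolding const_sign_def by (auto intro: mult_pos_pos mult_neg_neg mult_pos_neg mult_neg_pos)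

text \<open>\<open>F (i + n) = r * F i\<close> forces \<open>(r - 1) * F i\<close> to be the
  increment of \<open>F\<close> over a period, that is the sum of \<open>f\<close> over it. For
  \<open>r \<noteq> 1\<close> this determines \<open>F\<close>.\<close>

lemma quasi_periodic_primitive:
  fixes f :: "int \<Rightarrow> real"
  assumes "0 < n" "const_sign f" "\<And>i. f (i + int n) = r * f i" "r \<noteq> 1"
  obtains F where "\<And>i. F (i + 1) - F i = f i" "\<And>i. F (i + int n) = r * F i" "const_sign F"
proof -
  define F where "F i = (\<Sum>j\<in>{i..<i + int n}. f j) / (r - 1)" for i
  have F: "(r - 1) * F i = (\<Sum>j\<in>{i..<i + int n}. f j)" for i using assms(4) by (simp add: F_def)
  have 1: "F (i + 1) - F i = f i" for i
  proof -
    have "{i..<i + int n} = insert i {i + 1..<i + int n}"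
      "{i + 1..<i + 1 + int n} = insert (i + int n) {i + 1..<i + int n}"
      using assms(1) by auto
    then have "(r - 1) * (F (i + 1) - F i) = f (i + int n) - f i"
      unfolding right_diff_distrib F by simp
    then have "(r - 1) * (F (i + 1) - F i - f i) = 0"
      unfolding assms(3) by (simp add: algebra_simps)
    then show ?thesis using assms(4) by simp
  qed
  have "(\<Sum>j\<in>{i + int n..<i + int n + int n}. f j) = (\<Sum>j\<in>{i..<i + int n}. f (j + int n))" for i
    by (rule sum.reindex_bij_witness[of _ "\<lambda>j. j + int n" "\<lambda>j. j - int n"]) auto
  then have 2: "F (i + int n) = r * F i" for i
    by (simp add: F_def assms(3) sum_distrib_left)
  have ne: "{i..<i + int n} \<noteq> {}" for i using assms(1) by simp
  have "(\<forall>i. 0 < (r - 1) * F i) \<or> (\<forall>i. (r - 1) * F i < 0)"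
    using assms(2) unfolding const_sign_def
  proof
    assume "\<forall>i. 0 < f i" then show ?thesis using ne by (simp add: sum_pos F)
  next
    assume "\<forall>i. f i < 0"
    then have "0 < (\<Sum>j\<in>{i..<i + int n}. - f j)" for i using ne by (intro sum_pos) auto
    then show ?thesis by (simp add: sum_negf F)
  qed
  then have "const_sign F"
    by (cases "0 < r - 1") (auto simp: const_sign_def zero_less_mult_iff mult_less_0_iff)
  with 1 2 show ?thesis by (rule that)
qed

section \<open>The R-matrix in multiplicative coordinates\<close>

text \<open>Only the increments of \<open>S\<close> are required to be quasi-periodic, which is
  possible for \<open>P = Q\<close> as well. Nonvanishing in place of positivity admits the images
  under the swap, where signs occur.\<close>

locale coordinates =
  fixes n :: nat and x y z X Y S :: "int \<Rightarrow> real" and P Q :: real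
  assumes n_pos: "0 < n"
    and X_nz: "\<And>i. X i \<noteq> 0" and Y_nz: "\<And>i. Y i \<noteq> 0" and P_nz: "P \<noteq> 0" and Q_nz: "Q \<noteq> 0"
    and x_eq: "\<And>i. x i = X i / X (i - 1)"
    and y_eq: "\<And>i. y i = Y i / Y (i - 1)"
    and z_eq: "\<And>i. z i = (S (i + 1) - S i) * Y i / X i"
    and X_shift: "\<And>i. X (i + int n) = P * X i"
    and Y_shift: "\<And>i. Y (i + int n) = Q * Y i"
    and dS_shift: "\<And>i. S (i + int n + 1) - S (i + int n) = P / Q * (S (i + 1) - S i)"
begin

lemma prod_x: "a \<le> b \<Longrightarrow> (\<Prod>k\<in>{a + 1..b}. x k) = X b / X a"
  unfolding x_eq by (rule prod_telescope_int[OF _ X_nz])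

lemma prod_y: "a \<le> b \<Longrightarrow> (\<Prod>k\<in>{a + 1..b}. y k) = Y b / Y a"
  unfolding y_eq by (rule prod_telescope_int[OF _ Y_nz])

text \<open>By telescoping products, the paths that cross at \<open>j\<close> contribute
  \<open>Y (b - 1) / X a * (S (j + 1) - S j)\<close>, and the sum over \<open>j\<close> telescopes
  again.\<close>

lemma kernel_eq:
  assumes "a \<le> b"
  shows "kernel x y z a b = Y (b - 1) / X a * (S b - S a)"
proof -
  have "kernel x y z a b = (\<Sum>j\<in>{a..b - 1}. Y (b - 1) / X a * (S (j + 1) - S j))"
    unfolding kernel_def
  proof (rule sum.cong)
    fix j assume "j \<in> {a..b - 1}"
    then have "(\<Prod>k\<in>{a + 1..j}. x k) = X j / X a" "(\<Prod>k\<in>{j + 1..b - 1}. y k) = Y (b - 1) / Y j"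
      using prod_x[of a j] prod_y[of j "b - 1"] by auto
    then show "(\<Prod>k\<in>{a + 1..j}. x k) * z j * (\<Prod>k\<in>{j + 1..b - 1}. y k) =
        Y (b - 1) / X a * (S (j + 1) - S j)"
      using X_nz[of j] Y_nz[of j] by (simp add: z_eq)
  qed simp
  also have "\<dots> = Y (b - 1) / X a * (S b - S a)"
    unfolding sum_distrib_left[symmetric] sum_telescope_int[OF assms] ..
  finally show ?thesis .
qed

text \<open>Up to factors of \<open>X\<close>, \<open>Y\<close> and \<open>Q\<close>, this is the
  \<open>lam\<close> of the R-matrix.\<close>

definition D :: "int \<Rightarrow> real" where "D i = S (i + int n) - S i"

lemma D_shift: "D (i + int n) = P / Q * D i"
  and S_shift_diff: "S (a + int n) - S (b + int n) = P / Q * (S a - S b)"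
proof -
  have *: "S (i + int n) - P / Q * S i = S (j + int n) - P / Q * S j" for i j
    by (rule int_const_if_step[where f = "\<lambda>i. S (i + int n) - P / Q * S i"])
       (use dS_shift in \<open>simp add: algebra_simps\<close>)
  show "S (a + int n) - S (b + int n) = P / Q * (S a - S b)"
    using *[of a b] by (simp add: algebra_simps)
  show "D (i + int n) = P / Q * D i"
    using *[of "i + int n" i] by (simp add: D_def algebra_simps)
qed

lemma lam_eq: "lam n x y z i = Q * Y (i - 1) / X i * D i"
  using Y_shift[of "i - 1"]
  by (simp add: lam_eq_kernel kernel_eq D_def algebra_simps)

text \<open>These combinations of path sums isolate \<open>D\<close> at the end and at the start.
  They serve to recover the weights once \<open>P\<close> and \<open>Q\<close> are known.\<close>

lemma kernel_shift:
  assumes "a \<le> b"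
  shows "kernel x y z a (b + int n) - Q * kernel x y z a b = Q * Y (b - 1) / X a * D b"
    and "kernel x y z a (b + int n) - P * kernel x y z a b = Q * Y (b - 1) / X a * D a"
proof -
  have Y: "Y (b + int n - 1) = Q * Y (b - 1)" using Y_shift[of "b - 1"] by (simp add: algebra_simps)
  show "kernel x y z a (b + int n) - Q * kernel x y z a b = Q * Y (b - 1) / X a * D b"
    using assms by (simp add: kernel_eq Y D_def algebra_simps diff_divide_distrib)
  have PQ: "P * (S b - S a) = Q * (S (b + int n) - S (a + int n))"
    using S_shift_diff[of b a] Q_nz by (simp add: field_simps)
  have "kernel x y z a (b + int n) - P * kernel x y z a b =
      Y (b - 1) / X a * (Q * (S (b + int n) - S a) - P * (S b - S a))"
    using assms by (simp add: kernel_eq Y right_diff_distrib diff_divide_distrib mult_ac)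
  also have "\<dots> = Y (b - 1) / X a * (Q * (S (a + int n) - S a))"
    unfolding PQ by (simp add: right_diff_distrib)
  finally show "kernel x y z a (b + int n) - P * kernel x y z a b = Q * Y (b - 1) / X a * D a"
    by (simp add: D_def)
qed

end

text \<open>Marked indices are those of edges set to 1; \<open>p\<close> looks down to the nearest
  unmarked index, \<open>q\<close> looks up. They are parameters because a graph supplies them
  explicitly through \<open>x_index\<close> and \<open>y_index\<close>.\<close>

locale marking =
  fixes n :: nat and xset yset :: "int \<Rightarrow> bool" and p q :: "int \<Rightarrow> int"
  assumes n_pos: "0 < n"
    and xset_shift: "\<And>i. xset (i + int n) = xset i" and yset_shift: "\<And>i. yset (i + int n) = yset i"
    and p: "\<And>i. \<not> xset (p i)" "\<And>i. p i \<le> i" "\<And>i k. p i < k \<Longrightarrow> k \<le> i \<Longrightarrow> xset k"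
    and q: "\<And>i. \<not> yset (q i)" "\<And>i. i \<le> q i" "\<And>i k. i \<le> k \<Longrightarrow> k < q i \<Longrightarrow> yset k"
begin

lemma p_unique: "\<not> xset j \<Longrightarrow> j \<le> i \<Longrightarrow> (\<And>k. j < k \<Longrightarrow> k \<le> i \<Longrightarrow> xset k) \<Longrightarrow> p i = j"
  using p(1)[of i] p(2)[of i] p(3)[of i j] by (cases "p i" j rule: linorder_cases) blast+

lemma q_unique: "\<not> yset j \<Longrightarrow> i \<le> j \<Longrightarrow> (\<And>k. i \<le> k \<Longrightarrow> k < j \<Longrightarrow> yset k) \<Longrightarrow> q i = j"
  using q(1)[of i] q(2)[of i] q(3)[of i j] by (cases "q i" j rule: linorder_cases) blast+

lemma p_shift: "p (i + int n) = p i + int n"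
proof (rule p_unique)
  show "xset k" if "p i + int n < k" "k \<le> i + int n" for k
    using p(3)[of i "k - int n"] xset_shift[of "k - int n"] that by simp
qed (use p in \<open>auto simp: xset_shift\<close>)

lemma q_shift: "q (i + int n) = q i + int n"
proof (rule q_unique)
  show "yset k" if "i + int n \<le> k" "k < q i + int n" for k
    using q(3)[of i "k - int n"] yset_shift[of "k - int n"] that by simp
qed (use q in \<open>auto simp: yset_shift\<close>)

lemma p_free: "\<not> xset i \<Longrightarrow> p i = i" and p_marked: "xset i \<Longrightarrow> p (i - 1) = p i"
proof -
  show "\<not> xset i \<Longrightarrow> p i = i" by (rule p_unique) auto
  assume i: "xset i"
  then have "p i \<noteq> i" using p(1)[of i] by auto
  then show "p (i - 1) = p i" using p[of i] by (intro p_unique) auto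
qed

lemma q_free: "\<not> yset i \<Longrightarrow> q i = i" and q_marked: "yset i \<Longrightarrow> q (i + 1) = q i"
proof -
  show "\<not> yset i \<Longrightarrow> q i = i" by (rule q_unique) auto
  assume i: "yset i"
  then have "q i \<noteq> i" using q(1)[of i] by auto
  then show "q (i + 1) = q i" using q[of i] by (intro q_unique) auto
qed

text \<open>The set counted by \<open>alpha\<close> is the run of marked indices ending at
  \<open>i - 1\<close>, and \<open>p (i - 1)\<close> lies just below it.\<close>

lemma alpha_eq: "int (alpha xset i) = i - 1 - p (i - 1)"
proof -
  have "{i - j |j. 1 \<le> j \<and> (\<forall>k\<in>{1..j}. xset (i - k))} = {p (i - 1) + 1..i - 1}"
  proof (intro set_eqI iffI)
    fix m assume "m \<in> {i - j |j. 1 \<le> j \<and> (\<forall>k\<in>{1..j}. xset (i - k))}"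
    then obtain j where j: "m = i - j" "1 \<le> j" "\<And>k. k \<in> {1..j} \<Longrightarrow> xset (i - k)" by blast
    have "\<not> i - p (i - 1) \<le> j"
    proof
      assume "i - p (i - 1) \<le> j"
      then have "xset (p (i - 1))" using p(2)[of "i - 1"] j(3)[of "i - p (i - 1)"] by simp
      with p(1) show False by blast
    qed
    then show "m \<in> {p (i - 1) + 1..i - 1}" using j by simp
  next
    fix m assume m: "m \<in> {p (i - 1) + 1..i - 1}"
    show "m \<in> {i - j |j. 1 \<le> j \<and> (\<forall>k\<in>{1..j}. xset (i - k))}"
      using m p(3)[of "i - 1"] by (intro CollectI exI[of _ "i - m"]) auto
  qed
  then show ?thesis using p(2)[of "i - 1"] by (simp add: alpha_def)
qed

lemma beta_eq: "int (beta yset i) = q (i + 1) - 1 - i"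
proof -
  have "{i + j |j. 1 \<le> j \<and> (\<forall>k\<in>{1..j}. yset (i + k))} = {i + 1..q (i + 1) - 1}"
  proof (intro set_eqI iffI)
    fix m assume "m \<in> {i + j |j. 1 \<le> j \<and> (\<forall>k\<in>{1..j}. yset (i + k))}"
    then obtain j where j: "m = i + j" "1 \<le> j" "\<And>k. k \<in> {1..j} \<Longrightarrow> yset (i + k)" by blast
    have "\<not> q (i + 1) - i \<le> j"
    proof
      assume "q (i + 1) - i \<le> j"
      then have "yset (q (i + 1))" using q(2)[of "i + 1"] j(3)[of "q (i + 1) - i"] by simp
      with q(1) show False by blast
    qed
    then show "m \<in> {i + 1..q (i + 1) - 1}" using j by simp
  next
    fix m assume m: "m \<in> {i + 1..q (i + 1) - 1}"
    show "m \<in> {i + j |j. 1 \<le> j \<and> (\<forall>k\<in>{1..j}. yset (i + k))}"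
      using m q(3)[of "i + 1"] by (intro CollectI exI[of _ "m - i"]) auto
  qed
  then show ?thesis using q(2)[of "i + 1"] by (simp add: beta_def)
qed

end

locale marked_coordinates = coordinates + marking +
  assumes x_marked: "\<And>i. xset i \<Longrightarrow> x i = 1" and y_marked: "\<And>i. yset i \<Longrightarrow> y i = 1"
    and D_nz: "\<And>i. D i \<noteq> 0"
begin

lemma X_p: "X (p i) = X i"
proof -
  have *: "X b = X (p i)" if "p i \<le> b" "b \<le> i" for b
    using that
  proof (induction b rule: int_ge_induct)
    case (step b)
    then have "x (b + 1) = 1" using p(3)[of i "b + 1"] by (intro x_marked) auto
    then show ?case using step x_eq[of "b + 1"] X_nz by (simp add: field_simps)
  qed simp
  show ?thesis using *[of i] p(2)[of i] by simp
qed

text \<open>The edges \<open>y k\<close> with \<open>i < k < q (i + 1)\<close> are marked, so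
  \<open>Y\<close> is constant up to the last of them; it may change at \<open>q (i + 1)\<close>
  itself.\<close>

lemma Y_q: "Y (q (i + 1) - 1) = Y i"
proof -
  have *: "Y b = Y i" if "i \<le> b" "b < q (i + 1)" for b
    using that
  proof (induction b rule: int_ge_induct)
    case (step b)
    then have "y (b + 1) = 1" using q(3)[of "i + 1" "b + 1"] by (intro y_marked) auto
    then show ?case using step y_eq[of "b + 1"] Y_nz by (simp add: field_simps)
  qed simp
  show ?thesis using *[of "q (i + 1) - 1"] q(2)[of "i + 1"] by simp
qed

text \<open>The products of \<open>x\<close> and \<open>y\<close> in \<open>T_e\<close> cancel
  against the factors of \<open>X\<close> and \<open>Y\<close> in \<open>lam\<close>, because
  \<open>X\<close> and \<open>Y\<close> are constant along marked runs. Only ratios of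
  \<open>D\<close> remain.\<close>

lemma T_e_eq:
  "T_e n xset yset (x, y, z) =
    (\<lambda>i. x i * D (p (i - 1)) / D (p i), \<lambda>i. y i * D (q (i + 1)) / D (q i),
     \<lambda>i. z i * D (p i) * D (q (i + 1)) / (D i * D (i + 1)))"
proof -
  let ?L = "lam n x y z"
  note nz = X_nz Y_nz D_nz Q_nz
  have py: "(\<Prod>k=0..m. y (j - int k)) = Y j / Y (j - int m - 1)" for j :: int and m :: nat
    by (induction m) (use Y_nz in \<open>simp_all add: y_eq field_simps\<close>)
  have px: "(\<Prod>k=0..m. x (j + int k)) = X (j + int m) / X (j - 1)" for j :: int and m :: nat
    by (induction m) (use X_nz in \<open>simp_all add: x_eq field_simps\<close>)
  have py1: "(\<Prod>k=1..m. y (j - int k)) = Y (j - 1) / Y (j - int m - 1)" for j :: int and m :: nat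
    by (induction m) (use Y_nz in \<open>simp_all add: y_eq field_simps\<close>)
  have px1: "(\<Prod>k=1..m. x (j + int k)) = X (j + int m) / X j" for j :: int and m :: nat
    by (induction m) (use X_nz in \<open>simp_all add: x_eq field_simps\<close>)
  have 1: "(\<Prod>k=0..alpha xset i. y (i - int k - 1)) * ?L (i - int (alpha xset i) - 1) / ?L i =
      x i * D (p (i - 1)) / D (p i)" if "\<not> xset i" for i
  proof -
    have e: "i - int (alpha xset i) - 1 = p (i - 1)" using alpha_eq[of i] by simp
    have "(\<Prod>k=0..alpha xset i. y (i - int k - 1)) = Y (i - 1) / Y (p (i - 1) - 1)"
      using py[of "i - 1" "alpha xset i"] unfolding e[symmetric] by (simp add: algebra_simps)
    then show ?thesis
      using p_free[OF that] nz X_p[of "i - 1"] unfolding e lam_eq x_eq by simp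
  qed
  have 2: "(\<Prod>k=0..beta yset i. x (i + int k + 1)) * ?L (i + int (beta yset i) + 1) / ?L i =
      y i * D (q (i + 1)) / D (q i)" if "\<not> yset i" for i
  proof -
    have e: "i + int (beta yset i) + 1 = q (i + 1)" using beta_eq[of i] by simp
    have "(\<Prod>k=0..beta yset i. x (i + int k + 1)) = X (q (i + 1)) / X i"
      using px[of "i + 1" "beta yset i"] unfolding e[symmetric] by (simp add: algebra_simps)
    then show ?thesis
      using q_free[OF that] nz Y_q[of i] unfolding e lam_eq y_eq by simp
  qed
  have 3: "z i * (\<Prod>k=1..alpha xset (i + 1). y (i + 1 - int k - 1)) * ?L (i + 1 - int (alpha xset (i + 1)) - 1)
                * (\<Prod>k=1..beta yset i. x (i + int k + 1)) * ?L (i + int (beta yset i) + 1)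
              / (?L (i + 1 - 1) * ?L (i + 1)) = z i * D (p i) * D (q (i + 1)) / (D i * D (i + 1))" for i
  proof -
    have e: "i + int (beta yset i) + 1 = q (i + 1)" using beta_eq[of i] by simp
    \<comment> \<open>For \<open>z i\<close> the left run is the one ending at \<open>i\<close>,
      hence \<open>alpha\<close> at \<open>i + 1\<close> and \<open>p i\<close> instead of
      \<open>p (i - 1)\<close>.\<close>
    have f: "i + 1 - int (alpha xset (i + 1)) - 1 = p i" using alpha_eq[of "i + 1"] by simp
    have "(\<Prod>k=1..beta yset i. x (i + int k + 1)) = X (q (i + 1)) / X (i + 1)"
      using px1[of "i + 1" "beta yset i"] unfolding e[symmetric] by (simp add: algebra_simps)
    moreover have "(\<Prod>k=1..alpha xset (i + 1). y (i + 1 - int k - 1)) = Y (i - 1) / Y (p i - 1)"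
      using py1[of i "alpha xset (i + 1)"] unfolding f[symmetric] by (simp add: algebra_simps)
    ultimately show ?thesis
      using nz X_p[of i] Y_q[of i] unfolding e f lam_eq by simp
  qed
  \<comment> \<open>The case distinction disappears: at a marked \<open>i\<close>,
    \<open>p (i - 1) = p i\<close>, so the ratio of \<open>D\<close> is 1 already.\<close>
  have *: "(if xset i then 1 else x i * D (p (i - 1)) / D (p i)) = x i * D (p (i - 1)) / D (p i)" for i
    using x_marked[of i] p_marked[of i] D_nz[of "p i"] by simp
  have **: "(if yset i then 1 else y i * D (q (i + 1)) / D (q i)) = y i * D (q (i + 1)) / D (q i)" for i
    using y_marked[of i] q_marked[of i] D_nz[of "q i"] by simp
  have "T_e n xset yset (x, y, z) =
    (\<lambda>i. if xset i then 1 else x i * D (p (i - 1)) / D (p i),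
     \<lambda>i. if yset i then 1 else y i * D (q (i + 1)) / D (q i),
     \<lambda>i. z i * D (p i) * D (q (i + 1)) / (D i * D (i + 1)))"
    unfolding T_e_def Let_def prod.case 3 by (simp only: 1 2 not_False_eq_True cong: if_cong)
  then show ?thesis unfolding * ** .
qed

end

context coordinates
begin

text \<open>Hence \<open>P\<close> and \<open>Q\<close> depend on the weights alone, which allows
  different coordinates of the same weights to be compared.\<close>

lemma P_eq: "P = (\<Prod>k\<in>{1..int n}. x k)" and Q_eq: "Q = (\<Prod>k\<in>{1..int n}. y k)"
  using prod_x[of 0 "int n"] prod_y[of 0 "int n"] X_shift[of 0] Y_shift[of 0] X_nz[of 0] Y_nz[of 0]
  by simp_all

text \<open>\<open>kernel x y z a (b + n) - P * kernel x y z a b\<close> depends on \<open>b\<close>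
  only through \<open>Y (b - 1)\<close>, so it is multiplied by \<open>Q\<close> when
  \<open>b\<close> moves up a period. Thus \<open>P\<close> and \<open>Q\<close> are the
  characteristic roots.\<close>

lemma kernel_recurrence:
  assumes "a \<le> b"
  shows "kernel x y z a (b + int n + int n) = (P + Q) * kernel x y z a (b + int n) - P * Q * kernel x y z a b"
proof -
  have "Y (b + int n - 1) = Q * Y (b - 1)" using Y_shift[of "b - 1"] by (simp add: algebra_simps)
  then have "kernel x y z a (b + int n + int n) - P * kernel x y z a (b + int n) =
      Q * (kernel x y z a (b + int n) - P * kernel x y z a b)"
    using kernel_shift(2)[of a b] kernel_shift(2)[of a "b + int n"] assms by simp
  then show ?thesis by (simp add: algebra_simps)
qed

lemma kernel_translate: "kernel x y z (a + int n * m) (b + int n * m) = kernel x y z a b"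
proof -
  have *: "kernel x y z (a + int n) (b + int n) = kernel x y z a b" for a b
  proof (cases "a \<le> b")
    case True
    have "Y (b + int n - 1) = Q * Y (b - 1)" using Y_shift[of "b - 1"] by (simp add: algebra_simps)
    then have "kernel x y z (a + int n) (b + int n) = Q * Y (b - 1) / (P * X a) * (P / Q * (S b - S a))"
      using True by (simp only: kernel_eq add_le_cancel_right X_shift S_shift_diff)
    then show ?thesis using True P_nz Q_nz by (simp add: kernel_eq)
  qed (simp add: kernel_def)
  have "kernel x y z (a + int n * m) (b + int n * m) = kernel x y z (a + int n * 0) (b + int n * 0)"
  proof (rule int_const_if_step[where f = "\<lambda>m. kernel x y z (a + int n * m) (b + int n * m)"])
    show "kernel x y z (a + int n * (m + 1)) (b + int n * (m + 1)) =
        kernel x y z (a + int n * m) (b + int n * m)" for m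
      using *[of "a + int n * m" "b + int n * m"] by (simp add: algebra_simps)
  qed
  then show ?thesis by simp
qed

end

context marked_coordinates
begin

text \<open>For \<open>P = Q\<close> the increments of \<open>S\<close> are periodic, so
  \<open>D\<close> is constant and all its ratios are 1.\<close>

lemma T_e_trivial:
  assumes "P = Q"
  shows "T_e n xset yset (x, y, z) = (x, y, z)"
proof -
  have "D (i + 1) = D i" for i
    using dS_shift[of i] P_nz assms by (simp add: D_def algebra_simps)
  then obtain c where D: "\<And>i. D i = c" using int_const_if_step by metis
  then have "c \<noteq> 0" using D_nz by metis
  then show ?thesis unfolding T_e_eq D by simp
qed

end

section \<open>Quasi-periodic \<open>S\<close> and the exchange of \<open>P\<close> and
  \<open>Q\<close>\<close>

locale swapping_coordinates = marked_coordinates +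
  assumes S_shift: "\<And>i. S (i + int n) = P / Q * S i"
begin

lemma D_S: "D i = (P / Q - 1) * S i"
  by (simp add: D_def S_shift algebra_simps)

lemma S_nz: "S i \<noteq> 0"
  using D_nz[of i] by (simp add: D_S)

text \<open>Here \<open>D\<close> is a nonzero constant multiple of \<open>S\<close>, and the
  formulas of \<open>T_e_eq\<close> are homogeneous of degree 0 in \<open>D\<close>.\<close>

lemma T_e_S:
  "T_e n xset yset (x, y, z) =
    (\<lambda>i. x i * S (p (i - 1)) / S (p i), \<lambda>i. y i * S (q (i + 1)) / S (q i),
     \<lambda>i. z i * S (p i) * S (q (i + 1)) / (S i * S (i + 1)))"
proof -
  obtain c where D: "\<And>i. D i = c * S i" using D_S by blast
  then have "c \<noteq> 0" using D_nz by (metis mult_zero_left)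
  then show ?thesis unfolding T_e_eq D by (simp add: ac_simps)
qed

text \<open>Over a period the new primitives acquire the factors \<open>P / (P / Q) = Q\<close> and
  \<open>Q * (P / Q) = P\<close>. Composing \<open>S\<close> with \<open>p\<close> and with the
  shifted \<open>q\<close> is the gauge that keeps marked edges at 1.\<close>

lemma swapped:
  "swapping_coordinates n
     (\<lambda>i. x i * S (p (i - 1)) / S (p i)) (\<lambda>i. y i * S (q (i + 1)) / S (q i))
     (\<lambda>i. z i * S (p i) * S (q (i + 1)) / (S i * S (i + 1)))
     (\<lambda>i. X i / S (p i)) (\<lambda>i. Y i * S (q (i + 1))) (\<lambda>i. - 1 / S i) Q P xset yset p q"
proof -
  have sh: "i + int n + 1 = i + 1 + int n" for i by simp
  have S': "- 1 / S (i + int n) = Q / P * (- 1 / S i)" for i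
    using S_shift[of i] P_nz Q_nz by simp
  have c: "coordinates n
     (\<lambda>i. x i * S (p (i - 1)) / S (p i)) (\<lambda>i. y i * S (q (i + 1)) / S (q i))
     (\<lambda>i. z i * S (p i) * S (q (i + 1)) / (S i * S (i + 1)))
     (\<lambda>i. X i / S (p i)) (\<lambda>i. Y i * S (q (i + 1))) (\<lambda>i. - 1 / S i) Q P"
  proof
    show "z i * S (p i) * S (q (i + 1)) / (S i * S (i + 1)) =
        (- 1 / S (i + 1) - - 1 / S i) * (Y i * S (q (i + 1))) / (X i / S (p i))" for i
      using S_nz[of i] S_nz[of "i + 1"] S_nz[of "p i"] X_nz[of i]
      by (simp add: z_eq field_simps)
    show "X (i + int n) / S (p (i + int n)) = Q * (X i / S (p i))" for i
      using P_nz by (simp add: X_shift p_shift S_shift)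
    show "Y (i + int n) * S (q (i + int n + 1)) = P * (Y i * S (q (i + 1)))" for i
      unfolding sh using Q_nz by (simp add: Y_shift q_shift S_shift)
    show "- 1 / S (i + int n + 1) - - 1 / S (i + int n) = Q / P * (- 1 / S (i + 1) - - 1 / S i)" for i
      unfolding sh S' by (simp add: algebra_simps)
  qed (use X_nz Y_nz S_nz P_nz Q_nz n_pos in \<open>simp_all add: x_eq y_eq\<close>)
  show ?thesis
  proof (intro swapping_coordinates.intro marked_coordinates.intro
      swapping_coordinates_axioms.intro marked_coordinates_axioms.intro c marking_axioms S')
    show "coordinates.D n (\<lambda>i. - 1 / S i) i \<noteq> 0" for i
    proof -
      have "1 - Q / P \<noteq> 0" using D_nz[of i] P_nz Q_nz by (auto simp: D_S field_simps)
      moreover have "coordinates.D n (\<lambda>i. - 1 / S i) i = (1 - Q / P) * (1 / S i)"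
        unfolding coordinates.D_def[OF c] S' by (simp add: algebra_simps)
      ultimately show ?thesis using S_nz[of i] by simp
    qed
  qed (use S_nz in \<open>simp_all add: x_marked p_marked y_marked q_marked\<close>)
qed

lemma T_e_S_involution: "T_e n xset yset (T_e n xset yset (x, y, z)) = (x, y, z)"
  unfolding T_e_S swapping_coordinates.T_e_S[OF swapped] using S_nz by simp

text \<open>At unmarked ends \<open>p a = a\<close> and \<open>q b = b\<close>, so the new gauge
  factors contribute \<open>S a * S b\<close>, which cancels the denominator of
  \<open>1 / S a - 1 / S b\<close>.\<close>

lemma kernel_T_e_S:
  assumes "T_e n xset yset (x, y, z) = (x', y', z')" "\<not> xset a" "\<not> yset b" "a \<le> b"
  shows "kernel x' y' z' a b = kernel x y z a b"
proof -
  interpret T: swapping_coordinates n x' y' z' "\<lambda>i. X i / S (p i)" "\<lambda>i. Y i * S (q (i + 1))"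
    "\<lambda>i. - 1 / S i" Q P xset yset p q
    using swapped assms(1) unfolding T_e_S by auto
  show ?thesis
    using S_nz[of a] S_nz[of b] X_nz[of a] assms(2-4) p_free[of a] q_free[of b]
    by (simp add: T.kernel_eq kernel_eq field_simps)
qed

end

locale positive_coordinates = marked_coordinates +
  assumes X_pos: "\<And>i. 0 < X i" and Y_pos: "\<And>i. 0 < Y i" and P_pos: "0 < P" and Q_pos: "0 < Q"
    and D_pos: "\<And>i. 0 < D i"
begin

text \<open>\<open>D / (P / Q - 1)\<close> has the same increments as \<open>S\<close> and is
  quasi-periodic because \<open>D\<close> is; it is \<open>S\<close> with the additive constant
  normalized.\<close>

lemma swapping:
  assumes "P \<noteq> Q"
  shows "swapping_coordinates n x y z X Y (\<lambda>i. D i / (P / Q - 1)) P Q xset yset p q"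
proof -
  have nz: "P / Q - 1 \<noteq> 0" using assms Q_nz by simp
  have dS: "D (i + 1) / (P / Q - 1) - D i / (P / Q - 1) = S (i + 1) - S i" for i
  proof -
    have "D (i + 1) - D i = (P / Q - 1) * (S (i + 1) - S i)"
      using dS_shift[of i] by (simp add: D_def algebra_simps)
    then show ?thesis using nz by (simp add: diff_divide_distrib[symmetric])
  qed
  have c: "coordinates n x y z X Y (\<lambda>i. D i / (P / Q - 1)) P Q"
    using X_nz Y_nz P_nz Q_nz n_pos
    by unfold_locales (auto simp: dS x_eq y_eq z_eq X_shift Y_shift dS_shift)
  have "coordinates.D n (\<lambda>i. D i / (P / Q - 1)) i = D i" for i
  proof -
    have "D (i + int n) - D i = (P / Q - 1) * D i" by (simp add: D_shift left_diff_distrib)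
    then show ?thesis
      using nz by (simp add: coordinates.D_def[OF c] diff_divide_distrib[symmetric])
  qed
  then show ?thesis
    by (intro swapping_coordinates.intro marked_coordinates.intro swapping_coordinates_axioms.intro
        marked_coordinates_axioms.intro c marking_axioms)
       (simp_all add: D_nz x_marked y_marked D_shift)
qed

end

section \<open>Involutivity and invariance of path sums for arbitrary weights\<close>

context marking
begin

definition weighting :: "weights \<Rightarrow> bool" where
  "weighting w \<longleftrightarrow>
     (case w of (x, y, z) \<Rightarrow>
       (\<forall>i. x (i + int n) = x i \<and> y (i + int n) = y i \<and> z (i + int n) = z i) \<and>
       (\<forall>i. 0 < x i \<and> 0 < y i \<and> 0 < z i) \<and>
       (\<forall>i. xset i \<longrightarrow> x i = 1) \<and> (\<forall>i. yset i \<longrightarrow> y i = 1))"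

text \<open>Only unmarked ends are compared: the vertices inserted by the expansion carry no
  boundary edges, so these are the path sums that the boundary measurements see.\<close>

definition same_kernel :: "weights \<Rightarrow> weights \<Rightarrow> bool" where
  "same_kernel w w' \<longleftrightarrow> (\<forall>a b. \<not> xset a \<longrightarrow> \<not> yset b \<longrightarrow>
     kernel (fst w) (fst (snd w)) (snd (snd w)) a b = kernel (fst w') (fst (snd w')) (snd (snd w')) a b)"

lemma positive_coordinates_exist:
  assumes "weighting (x, y, z)"
  obtains X Y S P Q where "positive_coordinates n x y z X Y S P Q xset yset p q"
proof -
  note w = assms[unfolded weighting_def prod.case]
  obtain X P where X: "\<And>i. 0 < X i" "\<And>i. x i = X i / X (i - 1)" "0 < P" "\<And>i. X (i + int n) = P * X i"
    using multiplicative_primitive[of x "int n"] w by metis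
  obtain Y Q where Y: "\<And>i. 0 < Y i" "\<And>i. y i = Y i / Y (i - 1)" "0 < Q" "\<And>i. Y (i + int n) = Q * Y i"
    using multiplicative_primitive[of y "int n"] w by metis
  \<comment> \<open>Positive increments make \<open>S\<close> strictly increasing, hence
    \<open>D\<close> positive.\<close>
  obtain S where S: "\<And>i. S (i + 1) - S i = X i * z i / Y i"
    using additive_primitive[of "\<lambda>i. X i * z i / Y i"] by blast
  have nz: "X i \<noteq> 0" "Y i \<noteq> 0" for i using X(1)[of i] Y(1)[of i] by auto
  have mono: "S i < S (i + 1)" for i
    using S[of i] X(1)[of i] Y(1)[of i] w by (smt (verit) divide_pos_pos mult_pos_pos)
  have less: "S i < S j" if "i < j" for i j
    using that
  proof (induction j rule: int_gr_induct)
    case (step j) then show ?case using mono[of j] by simp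
  qed (rule mono)
  have c: "coordinates n x y z X Y S P Q"
  proof
    show "S (i + int n + 1) - S (i + int n) = P / Q * (S (i + 1) - S i)" for i
      unfolding S X(4) Y(4) using w by simp
  qed (use X Y S nz n_pos in simp_all)
  have D: "0 < coordinates.D n S i" for i
    unfolding coordinates.D_def[OF c] using less[of i "i + int n"] n_pos by simp
  have Dnz: "coordinates.D n S i \<noteq> 0" for i using D[of i] by simp
  have "positive_coordinates n x y z X Y S P Q xset yset p q"
    by (intro positive_coordinates.intro positive_coordinates_axioms.intro marked_coordinates.intro
        marked_coordinates_axioms.intro c marking_axioms D Dnz X(1,3) Y(1,3))
       (use w in blast)+
  then show ?thesis by (rule that)
qed

lemma T_e_involution:
  assumes "weighting w"
  shows "T_e n xset yset (T_e n xset yset w) = w"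
proof -
  obtain x y z where w: "w = (x, y, z)" by (rule prod_cases3)
  obtain X Y S P Q where "positive_coordinates n x y z X Y S P Q xset yset p q"
    using positive_coordinates_exist assms[unfolded w] .
  then interpret positive_coordinates n x y z X Y S P Q xset yset p q .
  show ?thesis
    by (cases "P = Q") (simp_all add: w T_e_trivial swapping_coordinates.T_e_S_involution[OF swapping])
qed

lemma kernel_T_e:
  assumes "weighting (x, y, z)" "T_e n xset yset (x, y, z) = (x', y', z')" "\<not> xset a" "\<not> yset b"
  shows "kernel x' y' z' a b = kernel x y z a b"
proof (cases "a \<le> b")
  case True
  obtain X Y S P Q where "positive_coordinates n x y z X Y S P Q xset yset p q"
    using positive_coordinates_exist assms(1) .
  then interpret positive_coordinates n x y z X Y S P Q xset yset p q .
  show ?thesis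
    using T_e_trivial swapping_coordinates.kernel_T_e_S[OF swapping assms(2-4) True] assms(2)
    by (cases "P = Q") auto
qed (simp add: kernel_def)

lemma weighting_T_e:
  assumes "weighting w"
  shows "weighting (T_e n xset yset w)"
proof -
  obtain x y z where w: "w = (x, y, z)" by (rule prod_cases3)
  obtain X Y S P Q where "positive_coordinates n x y z X Y S P Q xset yset p q"
    using positive_coordinates_exist assms[unfolded w] .
  then interpret positive_coordinates n x y z X Y S P Q xset yset p q .
  have sh: "i + int n + 1 = i + 1 + int n" "i + int n - 1 = i - 1 + int n" for i by simp_all
  note per = assms[unfolded w weighting_def prod.case]
  show ?thesis
    unfolding w T_e_eq weighting_def prod.case sh p_shift q_shift D_shift
    using per D_pos P_nz Q_nz D_nz
    by (auto simp: p_marked q_marked intro!: mult_pos_pos divide_pos_pos)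
qed

end

section \<open>Recovering the weights from the path sums\<close>

lemma two_term_recurrence_unique:
  fixes m0 m1 m2 m3 :: real
  assumes "m2 = s * m1 - t * m0" "m3 = s * m2 - t * m1" "m2 = s' * m1 - t' * m0" "m3 = s' * m2 - t' * m1"
    and "m1 * m1 \<noteq> m0 * m2"
  shows "s = s' \<and> t = t'"
proof -
  have "(s - s') * m1 = (t - t') * m0" "(s - s') * m2 = (t - t') * m1"
    using assms(1-4) by algebra+
  then have "(s - s') * (m1 * m1 - m0 * m2) = 0" "(t - t') * (m1 * m1 - m0 * m2) = 0"
    by algebra+
  then show ?thesis using assms(5) by simp
qed

lemma equal_sum_product:
  fixes a b c d :: real
  assumes "a + b = c + d" "a * b = c * d"
  shows "a = c \<and> b = d \<or> a = d \<and> b = c"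
proof -
  have "(a - c) * (a - d) = 0" using assms by algebra
  then show ?thesis using assms(1) by auto
qed

text \<open>An index marked on both sides would make two consecutive edges between the strings
  parallel, and path sums could not separate their weights.\<close>

locale simple_marking = marking +
  assumes simple: "\<And>i. \<not> (xset i \<and> yset i)"
begin

lemma next_unmarked:
  obtains i' where "i < i'" "\<not> xset i'" "\<And>k. i < k \<Longrightarrow> k < i' \<Longrightarrow> xset k"
proof -
  \<comment> \<open>Moving the unmarked \<open>p i\<close> up by \<open>l\<close> periods takes it
    beyond \<open>i\<close>, as a period has length at least 1.\<close>
  define l where "l = nat (i + 1 - p i)"
  have l: "int l = i + 1 - p i" using p(2)[of i] by (simp add: l_def)
  have "xset (p i + int n * int m) = xset (p i)" for m
  proof (induction m)
    case (Suc m)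
    have "p i + int n * int (Suc m) = p i + int n * int m + int n" by (simp add: algebra_simps)
    then show ?case using Suc by (simp only: xset_shift)
  qed simp
  then have "\<not> xset (p i + int n * int l)" using p(1) by blast
  moreover have "1 * int l \<le> int n * int l" by (rule mult_right_mono) (use n_pos in auto)
  ultimately have ex: "\<exists>m::nat. \<not> xset (i + 1 + int m)"
    using l by (intro exI[of _ "nat (p i + int n * int l - i - 1)"]) (simp only: mult_1_left, simp)
  define m where "m = (LEAST m. \<not> xset (i + 1 + int m))"
  show ?thesis
  proof (rule that[of "i + 1 + int m"])
    show "\<not> xset (i + 1 + int m)" unfolding m_def by (rule LeastI_ex[OF ex])
    show "xset k" if "i < k" "k < i + 1 + int m" for k
      using not_less_Least[of "nat (k - i - 1)" "\<lambda>m. \<not> xset (i + 1 + int m)"] that by (simp add: m_def)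
  qed simp
qed

lemma previous_unmarked:
  obtains i' where "i' \<le> i" "\<not> yset i'" "\<And>k. i' < k \<Longrightarrow> k \<le> i \<Longrightarrow> yset k"
proof -
  \<comment> \<open>Reflection \<open>i \<mapsto> - i\<close> exchanges the roles of the two
    markings.\<close>
  interpret r: simple_marking n "\<lambda>i. yset (- i)" "\<lambda>i. xset (- i)" "\<lambda>i. - q (- i)" "\<lambda>i. - p (- i)"
  proof
    show "yset (- (i + int n)) = yset (- i)" "xset (- (i + int n)) = xset (- i)" for i
      using xset_shift[of "- (i + int n)"] yset_shift[of "- (i + int n)"] by simp_all
    show "- q (- i) \<le> i" "i \<le> - p (- i)" for i using p(2)[of "- i"] q(2)[of "- i"] by auto
    show "yset (- k)" if "- q (- i) < k" "k \<le> i" for i k using q(3)[of "- i" "- k"] that by simp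
    show "xset (- k)" if "i \<le> k" "k < - p (- i)" for i k using p(3)[of "- i" "- k"] that by simp
  qed (use n_pos p q simple in auto)
  obtain j where j: "- i - 1 < j" "\<not> yset (- j)" "\<And>k. - i - 1 < k \<Longrightarrow> k < j \<Longrightarrow> yset (- k)"
    using r.next_unmarked[of "- i - 1"] by auto
  have "yset k" if "- j < k" "k \<le> i" for k using j(3)[of "- k"] that by simp
  then show ?thesis using that[of "- j"] j by simp
qed

text \<open>With \<open>P\<close> and \<open>Q\<close> known, \<open>kernel_shift\<close> yields
  quantities that factor into a part at \<open>a\<close> and a part at \<open>b\<close>. Quotients
  at fixed \<open>b\<close> give \<open>x\<close>, quotients at fixed \<open>a\<close> give
  \<open>y\<close>, and a second difference of path sums gives \<open>z\<close>.\<close>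

lemma unique_with_periods:
  fixes X Y X' Y' :: "int \<Rightarrow> real"
  assumes "positive_coordinates n x y z X Y S P Q xset yset p q"
    and "positive_coordinates n x' y' z' X' Y' S' P Q xset yset p q"
    and "same_kernel (x, y, z) (x', y', z')"
  shows "(x', y', z') = (x, y, z)"
proof -
  interpret c: positive_coordinates n x y z X Y S P Q xset yset p q by fact
  interpret d: positive_coordinates n x' y' z' X' Y' S' P Q xset yset p q by fact
  have K: "kernel x y z a b = kernel x' y' z' a b" if "\<not> xset a" "\<not> yset b" for a b
    using assms(3) that by (simp add: same_kernel_def)
  have far: "\<exists>b\<ge>i. \<not> yset b" for i using q by blast
  have far': "\<exists>a\<le>i. \<not> xset a" for i using p by blast
  have N1: "Y (b - 1) / X a * c.D b = Y' (b - 1) / X' a * d.D b"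
    and N2: "Y (b - 1) / X a * c.D a = Y' (b - 1) / X' a * d.D a"
    if "\<not> xset a" "\<not> yset b" "a \<le> b" for a b
  proof -
    have "Q * (Y (b - 1) / X a * c.D b) = Q * (Y' (b - 1) / X' a * d.D b)"
      "Q * (Y (b - 1) / X a * c.D a) = Q * (Y' (b - 1) / X' a * d.D a)"
      using c.kernel_shift[OF that(3)] d.kernel_shift[OF that(3)] K[OF that(1,2)]
        K[of a "b + int n"] that yset_shift[of b] by (simp_all add: mult.assoc)
    then show "Y (b - 1) / X a * c.D b = Y' (b - 1) / X' a * d.D b"
      "Y (b - 1) / X a * c.D a = Y' (b - 1) / X' a * d.D a"
      unfolding mult_left_cancel[OF c.Q_nz] .
  qed
  have x: "x i = x' i" for i
  proof (cases "xset i")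
    case False
    \<comment> \<open>\<open>i - 1\<close> may be marked; \<open>p (i - 1)\<close> is unmarked and
      has the same \<open>X\<close>.\<close>
    define a where "a = p (i - 1)"
    have a: "a \<le> i" "\<not> xset a" "X a = X (i - 1)" "X' a = X' (i - 1)"
      using p[of "i - 1"] by (simp_all add: a_def c.X_p d.X_p)
    obtain b where b: "i \<le> b" "\<not> yset b" using far by blast
    let ?u = "Y (b - 1) * c.D b" and ?v = "Y' (b - 1) * d.D b"
    have "?u / X i = ?v / X' i" "?u / X (i - 1) = ?v / X' (i - 1)"
      using N1[OF False b(2,1)] N1[OF a(2) b(2)] a b by simp_all
    moreover have "?u \<noteq> 0" "?v \<noteq> 0" using c.Y_nz d.Y_nz c.D_nz d.D_nz by simp_all
    ultimately have "X i * ?v = X' i * ?u" "X (i - 1) * ?v = X' (i - 1) * ?u"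
      using c.X_nz d.X_nz by (simp_all add: frac_eq_eq mult.commute)
    then have "(X i * ?v) / (X (i - 1) * ?v) = (X' i * ?u) / (X' (i - 1) * ?u)" by simp
    then show ?thesis using \<open>?u \<noteq> 0\<close> \<open>?v \<noteq> 0\<close> by (simp add: c.x_eq d.x_eq)
  qed (simp add: c.x_marked d.x_marked)
  have y: "y i = y' i" for i
  proof (cases "yset i")
    case False
    define b where "b = q (i + 1)"
    have b: "i \<le> b" "\<not> yset b" "Y (b - 1) = Y i" "Y' (b - 1) = Y' i"
      using q[of "i + 1"] by (simp_all add: b_def c.Y_q d.Y_q)
    obtain a where a: "a \<le> i" "\<not> xset a" using far' by blast
    let ?u = "c.D a / X a" and ?v = "d.D a / X' a"
    have "Y i * ?u = Y' i * ?v" "Y (i - 1) * ?u = Y' (i - 1) * ?v"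
      using N2[OF a(2) False a(1)] N2[OF a(2) b(2)] a b by simp_all
    moreover have "?u \<noteq> 0" "?v \<noteq> 0" using c.X_nz d.X_nz c.D_nz d.D_nz by simp_all
    ultimately have "(Y i * ?u) / (Y (i - 1) * ?u) = (Y' i * ?v) / (Y' (i - 1) * ?v)" by simp
    then show ?thesis using \<open>?u \<noteq> 0\<close> \<open>?v \<noteq> 0\<close> by (simp only: c.y_eq d.y_eq) simp
  qed (simp add: c.y_marked d.y_marked)
  have z: "z j = z' j" for j
  proof -
    define a where "a = p j"
    define b' where "b' = q (j + 1)"
    obtain a' where a': "j < a'" "\<not> xset a'" "\<And>k. j < k \<Longrightarrow> k < a' \<Longrightarrow> xset k"
      using next_unmarked[of j] by metis
    obtain b where b: "b \<le> j" "\<not> yset b" "\<And>k. b < k \<Longrightarrow> k \<le> j \<Longrightarrow> yset k"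
      using previous_unmarked[of j] by metis
    have "a \<le> j" "\<not> xset a" "\<And>k. a < k \<Longrightarrow> k \<le> j \<Longrightarrow> xset k"
      "j < b'" "\<not> yset b'" "\<And>k. j < k \<Longrightarrow> k < b' \<Longrightarrow> yset k"
      using p[of j] q[of "j + 1"] by (auto simp: a_def b'_def)
    note ab = this a' b
    \<comment> \<open>If both \<open>a < j\<close> and \<open>b < j\<close>, then \<open>j\<close>
      would be marked on both sides. Likewise \<open>a'\<close> and \<open>b'\<close> cannot both
      exceed \<open>j + 1\<close>.\<close>
    have "a = j \<or> b = j" using ab(1,10) ab(3)[of j] ab(12)[of j] simple[of j] by linarith
    then have mm: "max a b = j" using ab(1,10) by auto
    have "a' = j + 1 \<or> b' = j + 1"
      using ab(4,7) ab(6)[of "j + 1"] ab(9)[of "j + 1"] simple[of "j + 1"] by linarith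
    then have mm': "min a' b' = j + 1" using ab(4,7) by auto
    \<comment> \<open>Inclusion and exclusion: the four path sums between the neighbouring unmarked
      indices combine to the increment of \<open>S\<close> from \<open>max a b = j\<close> to
      \<open>min a' b' = j + 1\<close>, which gives \<open>z j\<close>.\<close>
    have key: "z j = kernel x y z a b' - x a' * kernel x y z a' b'
        - y b * (kernel x y z a b - x a' * kernel x y z a' b)"
      if "positive_coordinates n x y z X Y S P Q xset yset p q" for x y z X Y S P Q
    proof -
      interpret positive_coordinates n x y z X Y S P Q xset yset p q by fact
      have "xset k" if "a < k" "k < a'" for k
        using ab(3)[of k] ab(9)[of k] that by linarith
      moreover have "yset k" if "b < k" "k < b'" for k
        using ab(6)[of k] ab(12)[of k] that by linarith
      ultimately have "p (a' - 1) = a" "q (b + 1) = b'"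
        using ab by (auto intro!: p_unique q_unique)
      then have "X (a' - 1) = X j" "X a = X j" "Y b = Y j" "Y (b' - 1) = Y j"
        using X_p[of "a' - 1"] X_p[of j] Y_q[of b] Y_q[of j] by (auto simp: a_def b'_def)
      note XY = this x_eq[of a'] y_eq[of b] X_nz Y_nz
      \<comment> \<open>The maximum extends the formula to \<open>d < c\<close>, where the sum is
        empty.\<close>
      have k: "kernel x y z c d = Y (d - 1) / X c * (S (max c d) - S c)" for c d
        using kernel_eq[of c d] by (cases "c \<le> d") (auto simp: kernel_def max_def)
      have "kernel x y z a b' = Y j / X j * (S b' - S a)"
        "x a' * kernel x y z a' b' = Y j / X j * (S (max a' b') - S a')"
        "y b * kernel x y z a b = Y j / X j * (S (max a b) - S a)"
        "kernel x y z a' b = 0"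
        using XY ab by (simp_all add: k)
      then have "kernel x y z a b' - x a' * kernel x y z a' b'
        - y b * (kernel x y z a b - x a' * kernel x y z a' b) =
        Y j / X j * (S b' - S a) - Y j / X j * (S (max a' b') - S a') - Y j / X j * (S (max a b) - S a)"
        by (simp add: right_diff_distrib)
      also have "\<dots> = Y j / X j * (S a' + S b' - S (max a' b') - S (max a b))"
        unfolding right_diff_distrib distrib_left by linarith
      also have "S a' + S b' - S (max a' b') = S (min a' b')" by (simp add: max_def min_def)
      finally show ?thesis unfolding mm mm' by (simp add: z_eq[of j] mult.commute)
    qed
    have "x = x'" "y = y'" using x y by auto
    with K ab(2,5,8,11) show ?thesis unfolding key[OF assms(1)] key[OF assms(2)] by simp
  qed
  from x y z show ?thesis by auto
qed

text \<open>The path sums from \<open>a\<close> to \<open>b\<close> and its next three translates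
  satisfy the recurrences of both weightings. Their Hankel determinant is nonzero, so
  \<open>P + Q\<close> and \<open>P * Q\<close> agree.\<close>

lemma periods_determined:
  fixes X Y X' Y' :: "int \<Rightarrow> real"
  assumes "positive_coordinates n x y z X Y S P Q xset yset p q"
    and "positive_coordinates n x' y' z' X' Y' S' P' Q' xset yset p q"
    and "same_kernel (x, y, z) (x', y', z')"
  shows "P = P' \<and> Q = Q' \<or> P = Q' \<and> Q = P'"
proof -
  interpret c: positive_coordinates n x y z X Y S P Q xset yset p q by fact
  interpret d: positive_coordinates n x' y' z' X' Y' S' P' Q' xset yset p q by fact
  define a where "a = p 0"
  define b where "b = q 0"
  have ab: "\<not> xset a" "\<not> yset b" "a \<le> b" using p[of 0] q[of 0] by (auto simp: a_def b_def)
  let ?k = "kernel x y z a"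
  have K: "kernel x y z a c = kernel x' y' z' a c" if "\<not> yset c" for c
    using assms(3) ab that by (simp add: same_kernel_def)
  have b2: "a \<le> b + int n" using ab by simp
  have ys: "\<not> yset (b + int n)" "\<not> yset (b + int n + int n)" "\<not> yset (b + int n + int n + int n)"
    using ab(2) yset_shift[of b] yset_shift[of "b + int n"] yset_shift[of "b + int n + int n"] by blast+
  \<comment> \<open>By the recurrence this product is the Hankel determinant up to sign; both
    factors are positive by \<open>kernel_shift\<close>.\<close>
  have "0 < (?k (b + int n) - Q * ?k b) * (?k (b + int n) - P * ?k b)"
    unfolding c.kernel_shift[OF ab(3)]
    by (intro mult_pos_pos divide_pos_pos c.Q_pos c.X_pos c.Y_pos c.D_pos)
  then have "?k (b + int n) * ?k (b + int n) \<noteq> ?k b * ?k (b + int n + int n)"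
    unfolding c.kernel_recurrence[OF ab(3)] by (simp add: algebra_simps)
  then have "P + Q = P' + Q' \<and> P * Q = P' * Q'"
    using c.kernel_recurrence[OF ab(3)] c.kernel_recurrence[OF b2] d.kernel_recurrence[OF ab(3)] d.kernel_recurrence[OF b2]
      K[OF ab(2)] K[OF ys(1)] K[OF ys(2)] K[OF ys(3)]
    by (intro two_term_recurrence_unique) simp_all
  then show ?thesis using equal_sum_product[of P Q P' Q'] by simp
qed

text \<open>If \<open>P\<close> and \<open>Q\<close> come in the same order, the weightings
  coincide. Otherwise compare \<open>w'\<close> with the image of \<open>w\<close> under
  \<open>T_e\<close>, which has the same path sums and exchanged periods.\<close>

lemma same_kernel_imp:
  assumes "weighting w" "weighting w'" "same_kernel w w'"
  shows "w' = w \<or> w' = T_e n xset yset w"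
proof -
  obtain x y z where w: "w = (x, y, z)" by (rule prod_cases3)
  obtain x' y' z' where w': "w' = (x', y', z')" by (rule prod_cases3)
  obtain X Y S P Q where c: "positive_coordinates n x y z X Y S P Q xset yset p q"
    using positive_coordinates_exist assms(1)[unfolded w] .
  obtain X' Y' S' P' Q' where d: "positive_coordinates n x' y' z' X' Y' S' P' Q' xset yset p q"
    using positive_coordinates_exist assms(2)[unfolded w'] .
  interpret c: positive_coordinates n x y z X Y S P Q xset yset p q by fact
  show ?thesis
  proof (cases "P = P' \<and> Q = Q'")
    case True
    then show ?thesis using unique_with_periods[OF c] d assms(3) w w' by simp
  next
    case False
    then have sw: "P' = Q" "Q' = P" "P \<noteq> Q"
      using periods_determined[OF c d] assms(3) w w' by auto
    interpret s: swapping_coordinates n x y z X Y "\<lambda>i. c.D i / (P / Q - 1)" P Q xset yset p q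
      using c.swapping[OF sw(3)] .
    obtain u v t where T: "T_e n xset yset w = (u, v, t)" by (rule prod_cases3)
    have wT: "weighting (u, v, t)" using weighting_T_e[OF assms(1)] T by simp
    obtain U V R P2 Q2 where e: "positive_coordinates n u v t U V R P2 Q2 xset yset p q"
      using positive_coordinates_exist wT .
    interpret e: positive_coordinates n u v t U V R P2 Q2 xset yset p q by fact
    interpret T: swapping_coordinates n u v t "\<lambda>i. X i / (c.D (p i) / (P / Q - 1))" "\<lambda>i. Y i * (c.D (q (i + 1)) / (P / Q - 1))"
      "\<lambda>i. - 1 / (c.D i / (P / Q - 1))" Q P xset yset p q
      using s.swapped T unfolding w s.T_e_S by auto
    \<comment> \<open>The positive coordinates of the image were chosen independently of the swapped
      ones, which need not be positive; the periods agree as products of the same weights.\<close>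
    have "P2 = Q" "Q2 = P"
      using e.P_eq T.P_eq e.Q_eq T.Q_eq by simp_all
    moreover have "same_kernel (u, v, t) (x', y', z')"
      using kernel_T_e[of x y z u v t] assms(1,3) T w w' by (simp add: same_kernel_def)
    ultimately have "(x', y', z') = (u, v, t)"
      using unique_with_periods[OF e] d sw by simp
    then show ?thesis using T w' by simp
  qed
qed

end

section \<open>Exchange of the period products\<close>

context marking
begin

lemma prod_T_e:
  assumes "weighting (x, y, z)" "T_e n xset yset (x, y, z) = (x', y', z')"
  shows "(\<Prod>k\<in>{1..int n}. x' k) = (\<Prod>k\<in>{1..int n}. y k)"
    and "(\<Prod>k\<in>{1..int n}. y' k) = (\<Prod>k\<in>{1..int n}. x k)"
proof -
  obtain X Y S P Q where "positive_coordinates n x y z X Y S P Q xset yset p q"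
    using positive_coordinates_exist assms(1) .
  then interpret positive_coordinates n x y z X Y S P Q xset yset p q .
  have "(\<Prod>k\<in>{1..int n}. x' k) = Q \<and> (\<Prod>k\<in>{1..int n}. y' k) = P"
  proof (cases "P = Q")
    case True
    then show ?thesis using T_e_trivial assms(2) P_eq Q_eq by simp
  next
    case False
    then interpret s: swapping_coordinates n x y z X Y "\<lambda>i. D i / (P / Q - 1)" P Q xset yset p q
      by (rule swapping)
    interpret T: swapping_coordinates n x' y' z' "\<lambda>i. X i / (D (p i) / (P / Q - 1))"
      "\<lambda>i. Y i * (D (q (i + 1)) / (P / Q - 1))" "\<lambda>i. - 1 / (D i / (P / Q - 1))" Q P xset yset p q
      using s.swapped assms(2) unfolding s.T_e_S by auto
    show ?thesis using T.P_eq T.Q_eq by simp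
  qed
  then show "(\<Prod>k\<in>{1..int n}. x' k) = (\<Prod>k\<in>{1..int n}. y k)"
    "(\<Prod>k\<in>{1..int n}. y' k) = (\<Prod>k\<in>{1..int n}. x k)"
    using P_eq Q_eq by simp_all
qed

lemma T_e_equal_products:
  assumes "weighting (x, y, z)" "(\<Prod>k\<in>{1..int n}. x k) = (\<Prod>k\<in>{1..int n}. y k)"
  shows "T_e n xset yset (x, y, z) = (x, y, z)"
proof -
  obtain X Y S P Q where "positive_coordinates n x y z X Y S P Q xset yset p q"
    using positive_coordinates_exist assms(1) .
  then interpret positive_coordinates n x y z X Y S P Q xset yset p q .
  show ?thesis using T_e_trivial P_eq Q_eq assms(2) by simp
qed

end

section \<open>Adjacent strings of a loop graph\<close>

text \<open>A monotone surjection of the integers never jumps by more than 1, so it passes from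
  \<open>k\<close> to \<open>k + 1\<close> at exactly one index.\<close>

lemma mono_surj_step:
  fixes f :: "int \<Rightarrow> int"
  assumes "mono f" "surj f"
  obtains i where "f (i - 1) = k" "f i = k + 1" "\<And>j. f (j - 1) \<le> k \<Longrightarrow> k < f j \<Longrightarrow> j = i"
proof -
  obtain a b where ab: "f a = k" "f b = k + 1" using assms(2) by (metis surjD)
  have less: "i < j" if "f i < f j" for i j
    using monoD[OF assms(1), of j i] that by linarith
  define m where "m = (LEAST m. k < f (a + int m))"
  have "k < f (a + int (nat (b - a)))" using ab less[of a b] by simp
  then have m: "k < f (a + int m)" unfolding m_def by (rule LeastI)
  define i where "i = a + int m"
  have "f (i - 1) \<le> k"
  proof (cases m)
    case 0
    then show ?thesis using m ab by simp
  next
    case (Suc m')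
    then have "\<not> k < f (a + int m')" using not_less_Least[of m' "\<lambda>m. k < f (a + int m)"] by (simp add: m_def)
    then show ?thesis using Suc by (simp add: i_def)
  qed
  note i = this m[folded i_def]
  have "a \<le> i - 1" "i \<le> b" using less[of a i] less[of "i - 1" b] ab i by auto
  then have "f (i - 1) = k" "f i = k + 1"
    using monoD[OF assms(1), of a "i - 1"] monoD[OF assms(1), of i b] ab i by auto
  moreover have "j = i" if "f (j - 1) \<le> k" "k < f j" for j
    using less[of "i - 1" j] less[of "j - 1" i] that i by linarith
  ultimately show ?thesis using that by blast
qed

locale adjacent_strings =
  fixes G :: loop_graph and s :: nat
  assumes wf: "well_formed G" and s: "1 \<le> s" "s < strings G"
begin

abbreviation "n \<equiv> edge_count G s"

lemma n_pos: "0 < n"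
  and lend: "mono (lend G s)" "surj (lend G s)"
  and lend_shift: "lend G s (i + int n) = lend G s i + int (string_len G s)"
  and rend: "mono (rend G s)" "surj (rend G s)"
  and rend_shift: "rend G s (i + int n) = rend G s i + int (string_len G (Suc s))"
  using wf s by (auto simp: well_formed_def)

lemma x_index: "lend G s (x_index G s k - 1) = k" "lend G s (x_index G s k) = k + 1"
  and x_index_unique: "lend G s (i - 1) \<le> k \<Longrightarrow> k < lend G s i \<Longrightarrow> x_index G s k = i"
proof -
  obtain i where i: "lend G s (i - 1) = k" "lend G s i = k + 1"
    "\<And>j. lend G s (j - 1) \<le> k \<Longrightarrow> k < lend G s j \<Longrightarrow> j = i"
    using mono_surj_step[OF lend, of k] by metis
  have "x_index G s k = i"
    unfolding x_index_def
  proof (rule the_equality)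
    fix j assume j: "lend G s (j - 1) = k \<and> lend G s j \<noteq> k"
    then have "k < lend G s j" using monoD[OF lend(1), of "j - 1" j] by simp
    then show "j = i" using i(3) j by simp
  qed (use i in simp)
  then show "lend G s (x_index G s k - 1) = k" "lend G s (x_index G s k) = k + 1"
    "\<And>i. lend G s (i - 1) \<le> k \<Longrightarrow> k < lend G s i \<Longrightarrow> x_index G s k = i"
    using i by auto
qed

lemma y_index: "rend G s (y_index G s k - 1) = k - 1" "rend G s (y_index G s k) = k"
  and y_index_unique: "rend G s (i - 1) < k \<Longrightarrow> k \<le> rend G s i \<Longrightarrow> y_index G s k = i"
proof -
  obtain i where i: "rend G s (i - 1) = k - 1" "rend G s i = k"
    "\<And>j. rend G s (j - 1) \<le> k - 1 \<Longrightarrow> k - 1 < rend G s j \<Longrightarrow> j = i"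
    using mono_surj_step[OF rend, of "k - 1"] by (metis diff_add_cancel)
  have "y_index G s k = i"
    unfolding y_index_def
  proof (rule the_equality)
    fix j assume j: "rend G s (j - 1) \<noteq> k \<and> rend G s j = k"
    then have "rend G s (j - 1) \<le> k - 1" using monoD[OF rend(1), of "j - 1" j] by simp
    then show "j = i" using i(3) j by simp
  qed (use i in simp)
  then show "rend G s (y_index G s k - 1) = k - 1" "rend G s (y_index G s k) = k"
    "\<And>i. rend G s (i - 1) < k \<Longrightarrow> k \<le> rend G s i \<Longrightarrow> y_index G s k = i"
    using i by auto
qed

lemma x_index_shift: "x_index G s (k + int (string_len G s)) = x_index G s k + int n"
proof (rule x_index_unique)
  have "lend G s (x_index G s k + int n - 1) = k + int (string_len G s)"
    using lend_shift[of "x_index G s k - 1"] x_index[of k] by (simp add: algebra_simps)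
  then show "lend G s (x_index G s k + int n - 1) \<le> k + int (string_len G s)" by simp
qed (use x_index[of k] in \<open>simp add: lend_shift\<close>)

lemma y_index_shift: "y_index G s (k + int (string_len G (Suc s))) = y_index G s k + int n"
proof (rule y_index_unique)
  have "rend G s (y_index G s k + int n - 1) = k - 1 + int (string_len G (Suc s))"
    using rend_shift[of "y_index G s k - 1"] y_index[of k] by (simp add: algebra_simps)
  then show "rend G s (y_index G s k + int n - 1) < k + int (string_len G (Suc s))" by simp
qed (use y_index[of k] in \<open>simp add: rend_shift\<close>)

lemma x_set_iff: "x_set G s i \<longleftrightarrow> lend G s (i - 1) = lend G s i"
  and y_set_iff: "y_set G s i \<longleftrightarrow> rend G s (i - 1) = rend G s i"
  by (simp_all add: x_set_def y_set_def)

lemma x_set_x_index: "\<not> x_set G s (x_index G s k)"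
  and y_set_y_index: "\<not> y_set G s (y_index G s k)"
  using x_index y_index by (simp_all add: x_set_iff y_set_iff)

lemma x_index_lend: "\<not> x_set G s i \<Longrightarrow> x_index G s (lend G s (i - 1)) = i"
  and y_index_rend: "\<not> y_set G s i \<Longrightarrow> y_index G s (rend G s i) = i"
  using monoD[OF lend(1), of "i - 1" i] monoD[OF rend(1), of "i - 1" i]
  by (auto simp: x_set_iff y_set_iff intro!: x_index_unique y_index_unique)

text \<open>Unmarked indices are the jumps of \<open>lend\<close> and \<open>rend\<close>. The last
  jump of \<open>lend\<close> at or before \<open>i\<close> starts from the value
  \<open>lend G s i - 1\<close>; the first jump of \<open>rend\<close> at or after \<open>i\<close>
  reaches \<open>rend G s (i - 1) + 1\<close>.\<close>

sublocale marking n "x_set G s" "y_set G s" "\<lambda>i. x_index G s (lend G s i - 1)"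
  "\<lambda>i. y_index G s (rend G s (i - 1) + 1)"
proof
  show "x_set G s (i + int n) = x_set G s i" "y_set G s (i + int n) = y_set G s i" for i
    using lend_shift[of i] lend_shift[of "i - 1"] rend_shift[of i] rend_shift[of "i - 1"]
    by (auto simp: x_set_iff y_set_iff algebra_simps)
  show "x_index G s (lend G s i - 1) \<le> i" for i
    using x_index(1)[of "lend G s i - 1"] monoD[OF lend(1), of i "x_index G s (lend G s i - 1) - 1"]
    by linarith
  show "i \<le> y_index G s (rend G s (i - 1) + 1)" for i
    using y_index(2)[of "rend G s (i - 1) + 1"] monoD[OF rend(1), of "y_index G s (rend G s (i - 1) + 1)" "i - 1"]
    by linarith
  show "x_set G s k" if "x_index G s (lend G s i - 1) < k" "k \<le> i" for i k
    using x_index(2)[of "lend G s i - 1"] monoD[OF lend(1), of "x_index G s (lend G s i - 1)" "k - 1"]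
      monoD[OF lend(1), of "k - 1" k] monoD[OF lend(1), of k i] that by (simp add: x_set_iff)
  show "y_set G s k" if "i \<le> k" "k < y_index G s (rend G s (i - 1) + 1)" for i k
    using y_index(1)[of "rend G s (i - 1) + 1"] monoD[OF rend(1), of "i - 1" "k - 1"]
      monoD[OF rend(1), of k "y_index G s (rend G s (i - 1) + 1) - 1"] monoD[OF rend(1), of "k - 1" k]
      that by (simp add: y_set_iff)
qed (use n_pos x_set_x_index y_set_y_index in auto)

abbreviation "expand \<equiv> expand_weights G s"
abbreviation "T \<equiv> T_strings G s"

text \<open>\<open>T_e\<close> puts 1 on all marked edges, so contracting its result to the strings
  and expanding again loses nothing.\<close>

lemma T_expand: "T_e n (x_set G s) (y_set G s) (expand w) = expand (T w)"
proof -
  obtain x y z where e: "T_e n (x_set G s) (y_set G s) (expand w) = (x, y, z)" by (rule prod_cases3)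
  have "x i = 1" if "x_set G s i" for i
    using e that by (auto simp: T_e_def Let_def split: prod.splits)
  moreover have "y i = 1" if "y_set G s i" for i
    using e that by (auto simp: T_e_def Let_def split: prod.splits)
  moreover have "T w = ((fst w)(s := (\<lambda>k. x (x_index G s k)), s + 1 := (\<lambda>k. y (y_index G s k))), (snd w)(s := z))"
    by (simp add: T_strings_def e)
  ultimately have "(x, y, z) = expand (T w)"
    by (auto simp: expand_weights_def x_index_lend y_index_rend fun_eq_iff)
  then show ?thesis using e by simp
qed

lemma fst_T: "fst (T w) t = (if t = s then (\<lambda>k. fst (expand (T w)) (x_index G s k))
     else if t = s + 1 then (\<lambda>k. fst (snd (expand (T w))) (y_index G s k)) else fst w t)"
  and snd_T: "snd (T w) t = (if t = s then snd (snd (expand (T w))) else snd w t)"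
  unfolding T_expand[symmetric] by (auto simp: T_strings_def split: prod.splits)

lemma expand_x_index: "fst (expand w) (x_index G s k) = fst w s k"
  and expand_y_index: "fst (snd (expand w)) (y_index G s k) = fst w (s + 1) k"
  using x_set_x_index y_set_y_index by (simp_all add: expand_weights_def x_index y_index)

lemma string_weights_eqI:
  assumes "expand v = expand w" "\<And>t. t \<noteq> s \<Longrightarrow> t \<noteq> s + 1 \<Longrightarrow> fst v t = fst w t"
    and "\<And>t. t \<noteq> s \<Longrightarrow> snd v t = snd w t"
  shows "v = w"
proof (rule prod_eqI; rule ext)
  fix t
  have "fst v s = fst w s" "fst v (s + 1) = fst w (s + 1)"
    using expand_x_index[of v] expand_x_index[of w] expand_y_index[of v] expand_y_index[of w] assms(1)
    by (metis ext)+
  then show "fst v t = fst w t" using assms(2)[of t] by (cases "t = s"; cases "t = s + 1") auto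
  show "snd v t = snd w t" using assms(1,3) by (cases "t = s") (auto simp: expand_weights_def)
qed

lemma T_involution:
  assumes "weighting (expand w)"
  shows "T (T w) = w"
proof (rule string_weights_eqI)
  show "expand (T (T w)) = expand w"
    using T_e_involution[OF assms] by (simp add: T_expand)
qed (simp_all add: fst_T snd_T)

lemma weighting_expand:
  assumes "is_string_weighting G w"
  shows "weighting (expand w)"
proof -
  note w = assms[unfolded is_string_weighting_def, THEN conjunct1, rule_format]
  note z = assms[unfolded is_string_weighting_def, THEN conjunct2, rule_format]
  have l: "lend G s (i + int n - 1) = lend G s (i - 1) + int (string_len G s)" for i
    using lend_shift[of "i - 1"] by (simp add: algebra_simps)
  show ?thesis
    unfolding weighting_def expand_weights_def prod.case
    using s w[of s] w[of "s + 1"] z[of s] by (simp add: xset_shift yset_shift l rend_shift)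
qed

lemma is_string_weighting_T:
  assumes "is_string_weighting G w"
  shows "is_string_weighting G (T w)"
proof -
  note w = assms[unfolded is_string_weighting_def, THEN conjunct1, rule_format]
  note z = assms[unfolded is_string_weighting_def, THEN conjunct2, rule_format]
  have "weighting (expand (T w))"
    using weighting_T_e[OF weighting_expand[OF assms]] by (simp add: T_expand)
  then obtain x y z where e: "expand (T w) = (x, y, z)" "weighting (x, y, z)"
    by (metis prod_cases3)
  show ?thesis
    unfolding is_string_weighting_def fst_T snd_T e(1) fst_conv snd_conv
    using w z e(2)[unfolded weighting_def prod.case] by (auto simp: x_index_shift y_index_shift)
qed

end

section \<open>Loop weights and coordinates of adjacent strings\<close>

definition loop_weight :: "loop_graph \<Rightarrow> nat \<Rightarrow> string_weights \<Rightarrow> real" where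
  "loop_weight G t w = (\<Prod>k\<in>{1..int (string_len G t)}. fst w t k)"

lemma loop_weight_eq:
  fixes X :: "int \<Rightarrow> real"
  assumes "\<And>k. X k \<noteq> 0" "\<And>k. fst w t k = X k / X (k - 1)" "\<And>k. X (k + int (string_len G t)) = P * X k"
  shows "loop_weight G t w = P"
  using prod_telescope_int[of 0 "int (string_len G t)" X] assms(1)[of 0] assms(3)[of 0]
  by (simp add: loop_weight_def assms(1,2))

context adjacent_strings
begin

text \<open>A primitive on the string pulls back along \<open>lend\<close>. The weight between white
  \<open>k\<close> and black \<open>k\<close> enters on passing from white \<open>k\<close> to white
  \<open>k + 1\<close>, whence the shift by 1.\<close>

lemma expand_ratio:
  fixes X :: "int \<Rightarrow> real"
  assumes "\<And>k. X k \<noteq> 0" "\<And>k. fst w s k = X k / X (k - 1)"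
  shows "fst (expand w) i = X (lend G s i - 1) / X (lend G s (i - 1) - 1)"
proof (cases "x_set G s i")
  case True
  then show ?thesis using assms(1) by (simp add: expand_weights_def x_set_iff)
next
  case False
  then have "lend G s i - 1 = lend G s (i - 1)"
    using x_index[of "lend G s (i - 1)"] by (simp add: x_index_lend)
  then show ?thesis using False assms(2) by (simp add: expand_weights_def)
qed

lemma expand_ratio':
  fixes Y :: "int \<Rightarrow> real"
  assumes "\<And>k. Y k \<noteq> 0" "\<And>k. fst w (s + 1) k = Y k / Y (k - 1)"
  shows "fst (snd (expand w)) i = Y (rend G s i) / Y (rend G s (i - 1))"
proof (cases "y_set G s i")
  case True
  then show ?thesis using assms(1) by (simp add: expand_weights_def y_set_iff)
next
  case False
  then have "rend G s i - 1 = rend G s (i - 1)"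
    using y_index[of "rend G s i"] by (simp add: y_index_rend)
  then show ?thesis using False assms(2)[of "rend G s i"] by (simp add: expand_weights_def)
qed

lemma prod_expand:
  assumes "is_string_weighting G w"
  shows "(\<Prod>k\<in>{1..int n}. fst (expand w) k) = loop_weight G s w"
    and "(\<Prod>k\<in>{1..int n}. fst (snd (expand w)) k) = loop_weight G (s + 1) w"
proof -
  note w = assms[unfolded is_string_weighting_def, THEN conjunct1, rule_format]
  have pos: "0 < fst w s k" "fst w s (k + int (string_len G s)) = fst w s k"
    and pos': "0 < fst w (s + 1) k" "fst w (s + 1) (k + int (string_len G (s + 1))) = fst w (s + 1) k" for k
    using w[of s] w[of "s + 1"] s by simp_all
  obtain X P where X: "\<And>i. 0 < X i" "\<And>i. fst w s i = X i / X (i - 1)" "0 < P"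
    "\<And>i. X (i + int (string_len G s)) = P * X i"
    using multiplicative_primitive[of "fst w s", OF pos] by metis
  obtain Y Q where Y: "\<And>i. 0 < Y i" "\<And>i. fst w (s + 1) i = Y i / Y (i - 1)" "0 < Q"
    "\<And>i. Y (i + int (string_len G (s + 1))) = Q * Y i"
    using multiplicative_primitive[of "fst w (s + 1)", OF pos'] by metis
  have nz: "X i \<noteq> 0" "Y i \<noteq> 0" for i using X(1)[of i] Y(1)[of i] by auto
  have "X (lend G s (int n) - 1) = P * X (lend G s 0 - 1)"
    using lend_shift[of 0] X(4)[of "lend G s 0 - 1"] by (simp add: algebra_simps)
  then show "(\<Prod>k\<in>{1..int n}. fst (expand w) k) = loop_weight G s w"
    using prod_telescope_int[of 0 "int n" "\<lambda>i. X (lend G s i - 1)"] nz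
    by (simp add: loop_weight_eq[OF nz(1) X(2,4)] expand_ratio[OF nz(1) X(2)])
  have "Y (rend G s (int n)) = Q * Y (rend G s 0)"
    using rend_shift[of 0] Y(4)[of "rend G s 0"] by (simp add: algebra_simps)
  then show "(\<Prod>k\<in>{1..int n}. fst (snd (expand w)) k) = loop_weight G (s + 1) w"
    using prod_telescope_int[of 0 "int n" "\<lambda>i. Y (rend G s i)"] nz
      loop_weight_eq[OF nz(2) Y(2,4)]
    by (simp add: expand_ratio'[OF nz(2) Y(2)])
qed

lemma loop_weight_T:
  assumes "is_string_weighting G w"
  shows "loop_weight G s (T w) = loop_weight G (s + 1) w"
    and "loop_weight G (s + 1) (T w) = loop_weight G s w"
    and "t \<noteq> s \<Longrightarrow> t \<noteq> s + 1 \<Longrightarrow> loop_weight G t (T w) = loop_weight G t w"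
proof -
  obtain x y z where e: "expand w = (x, y, z)" by (rule prod_cases3)
  obtain x' y' z' where e': "expand (T w) = (x', y', z')" by (rule prod_cases3)
  have "weighting (x, y, z)" "T_e n (x_set G s) (y_set G s) (x, y, z) = (x', y', z')"
    using weighting_expand[OF assms] T_expand[of w] e e' by simp_all
  note prod_T_e[OF this]
  with prod_expand[OF assms] prod_expand[OF is_string_weighting_T[OF assms]] e e'
  show "loop_weight G s (T w) = loop_weight G (s + 1) w"
    "loop_weight G (s + 1) (T w) = loop_weight G s w" by simp_all
qed (simp add: loop_weight_def fst_T)

lemma T_equal_loop_weights:
  assumes "is_string_weighting G w" "loop_weight G s w = loop_weight G (s + 1) w"
  shows "T w = w"
proof (rule string_weights_eqI)
  obtain x y z where e: "expand w = (x, y, z)" by (rule prod_cases3)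
  show "expand (T w) = expand w"
    using T_e_equal_products[of x y z] weighting_expand[OF assms(1)] prod_expand[OF assms(1)] assms(2) e
    by (simp add: T_expand[symmetric])
qed (simp_all add: fst_T snd_T)

end

text \<open>The primitives live on the vertices of the strings and not on expanded indices, so that
  two pairs can share the primitive of their common string.\<close>

definition pair_coordinates ::
  "loop_graph \<Rightarrow> nat \<Rightarrow> string_weights \<Rightarrow> (int \<Rightarrow> real) \<Rightarrow> (int \<Rightarrow> real) \<Rightarrow> (int \<Rightarrow> real) \<Rightarrow>
    real \<Rightarrow> real \<Rightarrow> bool" where
  "pair_coordinates G s w U V S P Q \<longleftrightarrow> P \<noteq> 0 \<and> Q \<noteq> 0 \<and>
     (\<forall>k. U k \<noteq> 0 \<and> fst w s k = U k / U (k - 1) \<and> U (k + int (string_len G s)) = P * U k) \<and>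
     (\<forall>k. V k \<noteq> 0 \<and> fst w (s + 1) k = V k / V (k - 1) \<and> V (k + int (string_len G (s + 1))) = Q * V k) \<and>
     (\<forall>i. S i \<noteq> 0 \<and> snd w s i = (S (i + 1) - S i) * V (rend G s i) / U (lend G s i - 1) \<and>
        S (i + int (edge_count G s)) = P / Q * S i)"

context adjacent_strings
begin

text \<open>Counterpart of \<open>swapped\<close> on the unexpanded strings, where \<open>p\<close>
  and \<open>q\<close> become \<open>x_index\<close> and \<open>y_index\<close>.\<close>

lemma pair_coordinates_T:
  fixes X Y :: "int \<Rightarrow> real"
  assumes "pair_coordinates G s w X Y S P Q" "P \<noteq> Q"
  shows "pair_coordinates G s (T w) (\<lambda>k. X k / S (x_index G s k)) (\<lambda>k. Y k * S (y_index G s (k + 1)))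
    (\<lambda>i. - 1 / S i) Q P"
proof -
  let ?p = "\<lambda>i. x_index G s (lend G s i - 1)" and ?q = "\<lambda>i. y_index G s (rend G s (i - 1) + 1)"
  have PQ: "P \<noteq> 0" "Q \<noteq> 0" using assms(1) by (auto simp: pair_coordinates_def)
  have X: "X k \<noteq> 0" "fst w s k = X k / X (k - 1)" "X (k + int (string_len G s)) = P * X k"
    and Y: "Y k \<noteq> 0" "fst w (s + 1) k = Y k / Y (k - 1)" "Y (k + int (string_len G (s + 1))) = Q * Y k"
    and S: "S i \<noteq> 0" "snd w s i = (S (i + 1) - S i) * Y (rend G s i) / X (lend G s i - 1)"
      "S (i + int n) = P / Q * S i" for k i
    using assms(1) by (auto simp: pair_coordinates_def)
  obtain x y z where e: "expand w = (x, y, z)" by (rule prod_cases3)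
  have Xl: "X (lend G s (i + int n) - 1) = P * X (lend G s i - 1)" for i
    using X(3)[of "lend G s i - 1"] by (simp add: lend_shift algebra_simps)
  have sh: "i + int n + 1 = i + 1 + int n" for i by simp
  have c: "coordinates n x y z (\<lambda>i. X (lend G s i - 1)) (\<lambda>i. Y (rend G s i)) S P Q"
  proof
    show "x i = X (lend G s i - 1) / X (lend G s (i - 1) - 1)" for i
      using expand_ratio[OF X(1,2)] e by simp
    show "y i = Y (rend G s i) / Y (rend G s (i - 1))" for i
      using expand_ratio'[OF Y(1,2)] e by simp
    show "z i = (S (i + 1) - S i) * Y (rend G s i) / X (lend G s i - 1)" for i
      using S(2)[of i] e by (simp add: expand_weights_def)
    show "S (i + int n + 1) - S (i + int n) = P / Q * (S (i + 1) - S i)" for i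
      unfolding sh S(3) by (simp add: right_diff_distrib)
  qed (use X(1) Y(1) Y(3) PQ n_pos Xl in \<open>simp_all add: rend_shift\<close>)
  interpret c: swapping_coordinates n x y z "\<lambda>i. X (lend G s i - 1)" "\<lambda>i. Y (rend G s i)" S P Q
    "x_set G s" "y_set G s" ?p ?q
  proof (intro swapping_coordinates.intro marked_coordinates.intro swapping_coordinates_axioms.intro
        marked_coordinates_axioms.intro c marking_axioms S(3))
    have "coordinates.D n S i = (P / Q - 1) * S i" for i
      unfolding coordinates.D_def[OF c] S(3) by (simp add: left_diff_distrib)
    then show "coordinates.D n S i \<noteq> 0" for i using S(1)[of i] assms(2) PQ by simp
  qed (use e in \<open>auto simp: expand_weights_def\<close>)
  have T: "expand (T w) = (\<lambda>i. x i * S (?p (i - 1)) / S (?p i), \<lambda>i. y i * S (?q (i + 1)) / S (?q i),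
     \<lambda>i. z i * S (?p i) * S (?q (i + 1)) / (S i * S (i + 1)))"
    using c.T_e_S e T_expand[of w] by simp
  have "fst (T w) s k = X k / S (x_index G s k) / (X (k - 1) / S (x_index G s (k - 1)))" for k
    using expand_x_index[of w k] e X(2)[of k] by (simp add: fst_T T x_index)
  moreover have "fst (T w) (s + 1) k =
      Y k * S (y_index G s (k + 1)) / (Y (k - 1) * S (y_index G s k))" for k
    using expand_y_index[of w k] e Y(2)[of k] by (simp add: fst_T T y_index)
  moreover have "snd (T w) s i = (- 1 / S (i + 1) - - 1 / S i) *
     (Y (rend G s i) * S (y_index G s (rend G s i + 1))) /
     (X (lend G s i - 1) / S (x_index G s (lend G s i - 1)))" for i
  proof -
    have "z i = (S (i + 1) - S i) * Y (rend G s i) / X (lend G s i - 1)" by (rule c.z_eq)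
    then show ?thesis using S(1)[of i] S(1)[of "i + 1"] by (simp add: snd_T T field_simps)
  qed
  moreover have "Y (k + int (string_len G (Suc s))) * S (y_index G s (k + int (string_len G (Suc s)) + 1)) =
      P * (Y k * S (y_index G s (k + 1)))" for k
    using Y(3)[of k] y_index_shift[of "k + 1"] S(3)[of "y_index G s (k + 1)"] PQ
    by (simp add: algebra_simps)
  ultimately show ?thesis
    using X Y(1) S PQ by (simp add: pair_coordinates_def x_index_shift)
qed

end

text \<open>When the neighbouring pair is acted on, the primitive of the common string changes by a
  factor \<open>c\<close> while the weights between the strings of this pair stay. The increments of
  \<open>S\<close> have to absorb \<open>c\<close>.\<close>

lemma pair_coordinates_left:
  fixes X Y :: "int \<Rightarrow> real"
  assumes "pair_coordinates G s w X Y S P Q"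
    and "\<And>k. fst w' s k = X' k / X' (k - 1)" "\<And>k. X' (k + int (string_len G s)) = P' * X' k" "P' \<noteq> 0"
    and "fst w' (s + 1) = fst w (s + 1)" "snd w' s = snd w s"
    and "\<And>k. X' k = X k * c k" "\<And>k. c k \<noteq> 0"
    and "\<And>i. A (i + 1) - A i = (S (i + 1) - S i) * c (lend G s i - 1)"
    and "\<And>i. A i \<noteq> 0" "\<And>i. A (i + int (edge_count G s)) = P' / Q * A i"
  shows "pair_coordinates G s w' X' Y A P' Q"
  using assms unfolding pair_coordinates_def by simp

lemma pair_coordinates_right:
  fixes X Y :: "int \<Rightarrow> real"
  assumes "pair_coordinates G s w X Y S P Q"
    and "\<And>k. fst w' (s + 1) k = Y' k / Y' (k - 1)" "\<And>k. Y' (k + int (string_len G (s + 1))) = Q' * Y' k" "Q' \<noteq> 0"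
    and "fst w' s = fst w s" "snd w' s = snd w s"
    and "\<And>k. Y' k = Y k / c k" "\<And>k. c k \<noteq> 0"
    and "\<And>i. B (i + 1) - B i = (S (i + 1) - S i) * c (rend G s i)"
    and "\<And>i. B i \<noteq> 0" "\<And>i. B (i + int (edge_count G s)) = P / Q' * B i"
  shows "pair_coordinates G s w' X Y' B P Q'"
  using assms unfolding pair_coordinates_def by simp

section \<open>The braid relation\<close>

text \<open>Here \<open>b / s = t - a / s\<close> with \<open>a\<close> and \<open>t\<close> fixed.
  This and the next lemma turn summation by parts into the increments that the braid relation
  needs.\<close>

lemma diff_of_quotients:
  fixes a :: real
  assumes "a + b = s * t" "a + b' = s' * t" "s \<noteq> 0" "s' \<noteq> 0"
  shows "b' / s' - b / s = (- 1 / s' - - 1 / s) * a"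
proof -
  have b: "b = s * t - a" "b' = s' * t - a" using assms by simp_all
  show ?thesis unfolding b using assms(3,4) by (simp add: field_simps)
qed

lemma diff_of_quotients':
  fixes a :: real
  assumes "a + b = s * t" "a' + b = s * t'" "s \<noteq> 0" "a \<noteq> 0" "a' \<noteq> 0"
  shows "- t' / a' - - t / a = (- 1 / a' - - 1 / a) * (b / s)"
proof -
  have "t = (a + b) / s" "t' = (a' + b) / s" using assms by simp_all
  then show ?thesis using assms(3-5) by (simp add: field_simps)
qed

locale three_strings =
  fixes G :: loop_graph
  assumes wf: "well_formed G" and three: "strings G = 3"
begin

sublocale l: adjacent_strings G 1 by unfold_locales (use wf three in auto)
sublocale r: adjacent_strings G 2 by unfold_locales (use wf three in auto)

text \<open>
  A cut separates the edges ending on the middle string, to its left (\<open>i\<close>) and to its right (\<open>j\<close>),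
  into those below and those above some point of the string.
\<close>

definition cut :: "int \<Rightarrow> int \<Rightarrow> bool" where
  "cut i j \<longleftrightarrow> rend G 1 (i - 1) < lend G 2 j \<and> lend G 2 (j - 1) \<le> rend G 1 i"

declare One_nat_def [simp del]

text \<open>Two cuts with the same \<open>j\<close> and consecutive \<open>i\<close>: increments in
  \<open>i\<close> can be computed with the value at \<open>j\<close> held fixed.\<close>

lemma cut_x_index: "cut i (x_index G 2 (rend G 1 i))" "cut (i + 1) (x_index G 2 (rend G 1 i))"
  using r.x_index[of "rend G 1 i"] monoD[OF l.rend(1), of "i - 1" i] monoD[OF l.rend(1), of i "i + 1"]
  by (simp_all add: cut_def)

lemma cut_y_index: "cut (y_index G 1 (lend G 2 j)) j" "cut (y_index G 1 (lend G 2 j)) (j + 1)"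
  using l.y_index[of "lend G 2 j"] monoD[OF r.lend(1), of "j - 1" j] monoD[OF r.lend(1), of j "j + 1"]
  by (simp_all add: cut_def)

text \<open>A cut with larger \<open>i\<close> cannot have smaller \<open>j\<close>: the cuts form a
  chain, on which \<open>i + j\<close> is injective.\<close>

lemma cut_unique:
  assumes "cut i j" "cut i' j'" "i + j = i' + j'"
  shows "i' = i \<and> j' = j"
proof -
  have "\<not> i < i'" if "cut i j" "cut i' j'" "i + j = i' + j'" for i j i' j'
  proof
    assume "i < i'"
    then have "rend G 1 i \<le> rend G 1 (i' - 1)" "lend G 2 j' \<le> lend G 2 (j - 1)"
      using that(3) by (intro monoD[OF l.rend(1)] monoD[OF r.lend(1)]; simp)+
    then show False using that(1,2) by (simp add: cut_def)
  qed
  from this[OF assms] this[OF assms(2,1) assms(3)[symmetric]] show ?thesis using assms(3) by simp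
qed

lemma cut_shift: "cut (i + int (edge_count G 1)) (j + int (edge_count G 2)) = cut i j"
  using l.rend_shift[of i] l.rend_shift[of "i - 1"] r.lend_shift[of j] r.lend_shift[of "j - 1"]
  by (simp add: cut_def algebra_simps numeral_2_eq_2)

text \<open>The defect \<open>A j + B i - S1 i * S2 j\<close> is unchanged when the cut passes one
  edge. After a whole period the cut is the translate of the original one, where the defect is
  \<open>r1 * r2\<close> times as large; so it vanishes.\<close>

lemma summation_by_parts:
  fixes A B S1 S2 :: "int \<Rightarrow> real"
  assumes B: "\<And>i. B (i + 1) - B i = (S1 (i + 1) - S1 i) * S2 (x_index G 2 (rend G 1 i))"
    and A: "\<And>j. A (j + 1) - A j = (S2 (j + 1) - S2 j) * S1 (y_index G 1 (lend G 2 j))"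
    and shift: "\<And>i. S1 (i + int (edge_count G 1)) = r1 * S1 i" "\<And>j. S2 (j + int (edge_count G 2)) = r2 * S2 j"
      "\<And>i. B (i + int (edge_count G 1)) = r1 * r2 * B i" "\<And>j. A (j + int (edge_count G 2)) = r1 * r2 * A j"
    and "r1 * r2 \<noteq> 1" "cut i j"
  shows "A j + B i = S1 i * S2 j"
proof -
  define D where "D i j = A j + B i - S1 i * S2 j" for i j
  have step: "cut (i + 1) j \<and> D (i + 1) j = D i j \<or> cut i (j + 1) \<and> D i (j + 1) = D i j"
    if "cut i j" for i j
  \<comment> \<open>Decides whether the next edge above the cut is a left one, so that
    \<open>i\<close> moves, or a right one, so that \<open>j\<close> moves.\<close>
  proof (cases "rend G 1 i < lend G 2 j")
    case True
    then have "x_index G 2 (rend G 1 i) = j"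
      using that by (intro r.x_index_unique) (auto simp: cut_def)
    moreover have "cut (i + 1) j"
      using that True monoD[OF l.rend(1), of i "i + 1"] by (simp add: cut_def)
    ultimately show ?thesis using B[of i] by (simp add: D_def algebra_simps)
  next
    case False
    then have "y_index G 1 (lend G 2 j) = i"
      using that by (intro l.y_index_unique) (auto simp: cut_def)
    moreover have "cut i (j + 1)"
      using that False monoD[OF r.lend(1), of j "j + 1"] by (simp add: cut_def)
    ultimately show ?thesis using A[of j] by (simp add: D_def algebra_simps)
  qed
  have "\<exists>i' j'. cut i' j' \<and> i' + j' = i + j + int m \<and> D i' j' = D i j" for m
  proof (induction m)
    case 0
    then show ?case using assms(8) by auto
  next
    case (Suc m)
    then obtain i' j' where "cut i' j'" "i' + j' = i + j + int m" "D i' j' = D i j" by blast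
    with step[of i' j'] show ?case
      by (metis add.assoc add.commute of_nat_Suc)
  qed
  then obtain i' j' where c: "cut i' j'" "D i' j' = D i j"
    "i' + j' = i + j + int (edge_count G 1 + edge_count G 2)" by blast
  have "cut (i + int (edge_count G 1)) (j + int (edge_count G 2))"
    using assms(8) by (simp add: cut_shift)
  then have "D (i + int (edge_count G 1)) (j + int (edge_count G 2)) = D i j"
    using cut_unique[OF c(1)] c(2,3) by simp
  then have "(r1 * r2 - 1) * D i j = 0"
    unfolding D_def shift by (simp add: algebra_simps)
  then show ?thesis using assms(7) by (simp add: D_def)
qed

definition coordinates3 :: "string_weights \<Rightarrow> (int \<Rightarrow> real) \<Rightarrow> (int \<Rightarrow> real) \<Rightarrow> (int \<Rightarrow> real) \<Rightarrow>
    (int \<Rightarrow> real) \<Rightarrow> (int \<Rightarrow> real) \<Rightarrow> real \<Rightarrow> real \<Rightarrow> real \<Rightarrow> bool" where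
  "coordinates3 w X1 X2 X3 S1 S2 P1 P2 P3 \<longleftrightarrow>
     pair_coordinates G 1 w X1 X2 S1 P1 P2 \<and> pair_coordinates G 2 w X2 X3 S2 P2 P3"

text \<open>The action on the left pair multiplies the primitive of the middle string by values of
  \<open>S1\<close>, so on the right pair \<open>S2\<close> gives way to the discrete integral
  \<open>A\<close> of \<open>S1 dS2\<close>.\<close>

lemma coordinates3_T1:
  assumes c: "coordinates3 w X1 X2 X3 S1 S2 P1 P2 P3" and "P1 \<noteq> P2"
    and A: "\<And>j. A (j + 1) - A j = (S2 (j + 1) - S2 j) * S1 (y_index G 1 (lend G 2 j))"
      "\<And>j. A j \<noteq> 0" "\<And>j. A (j + int (edge_count G 2)) = P1 / P3 * A j"
  shows "coordinates3 (T_strings G 1 w) (\<lambda>k. X1 k / S1 (x_index G 1 k))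
    (\<lambda>k. X2 k * S1 (y_index G 1 (k + 1))) X3 (\<lambda>i. - 1 / S1 i) A P2 P1 P3"
proof -
  have 1: "pair_coordinates G 1 w X1 X2 S1 P1 P2" and 2: "pair_coordinates G 2 w X2 X3 S2 P2 P3"
    using c by (simp_all add: coordinates3_def)
  note T = l.pair_coordinates_T[OF 1 assms(2)]
  have "pair_coordinates G 2 (T_strings G 1 w) (\<lambda>k. X2 k * S1 (y_index G 1 (k + 1))) X3 A P1 P3"
  proof (rule pair_coordinates_left[OF 2, where c = "\<lambda>k. S1 (y_index G 1 (k + 1))"])
    show "fst (T_strings G 1 w) 2 k = X2 k * S1 (y_index G 1 (k + 1)) /
        (X2 (k - 1) * S1 (y_index G 1 (k - 1 + 1)))"
      "X2 (k + int (string_len G 2)) * S1 (y_index G 1 (k + int (string_len G 2) + 1)) =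
        P1 * (X2 k * S1 (y_index G 1 (k + 1)))" for k
      using T by (simp_all add: pair_coordinates_def numeral_2_eq_2)
  qed (use 1 A in \<open>simp_all add: pair_coordinates_def l.fst_T l.snd_T\<close>)
  with T show ?thesis by (simp add: coordinates3_def)
qed

lemma coordinates3_T2:
  assumes c: "coordinates3 w X1 X2 X3 S1 S2 P1 P2 P3" and "P2 \<noteq> P3"
    and B: "\<And>i. B (i + 1) - B i = (S1 (i + 1) - S1 i) * S2 (x_index G 2 (rend G 1 i))"
      "\<And>i. B i \<noteq> 0" "\<And>i. B (i + int (edge_count G 1)) = P1 / P3 * B i"
  shows "coordinates3 (T_strings G 2 w) X1 (\<lambda>k. X2 k / S2 (x_index G 2 k))
    (\<lambda>k. X3 k * S2 (y_index G 2 (k + 1))) B (\<lambda>i. - 1 / S2 i) P1 P3 P2"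
proof -
  have 1: "pair_coordinates G 1 w X1 X2 S1 P1 P2" and 2: "pair_coordinates G 2 w X2 X3 S2 P2 P3"
    using c by (simp_all add: coordinates3_def)
  note T = r.pair_coordinates_T[OF 2 assms(2)]
  have "pair_coordinates G 1 (T_strings G 2 w) X1 (\<lambda>k. X2 k / S2 (x_index G 2 k)) B P1 P3"
  proof (rule pair_coordinates_right[OF 1, where c = "\<lambda>k. S2 (x_index G 2 k)"])
    show "fst (T_strings G 2 w) (1 + 1) k = X2 k / S2 (x_index G 2 k) / (X2 (k - 1) / S2 (x_index G 2 (k - 1)))"
      "X2 (k + int (string_len G (1 + 1))) / S2 (x_index G 2 (k + int (string_len G (1 + 1)))) =
        P3 * (X2 k / S2 (x_index G 2 k))" for k
      using T by (simp_all add: pair_coordinates_def numeral_2_eq_2)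
  qed (use 2 B in \<open>simp_all add: pair_coordinates_def r.fst_T r.snd_T\<close>)
  with T show ?thesis by (simp add: coordinates3_def)
qed

lemma coordinates3_eqI:
  assumes "coordinates3 v X1 X2 X3 S1 S2 P1 P2 P3" "coordinates3 w X1 X2 X3 S1 S2 P1 P2 P3"
    and "\<And>t. t \<notin> {1, 2, 3} \<Longrightarrow> fst v t = fst w t" "\<And>t. t \<notin> {1, 2} \<Longrightarrow> snd v t = snd w t"
  shows "v = w"
proof (rule prod_eqI; rule ext; rule ext)
  fix t k
  show "fst v t k = fst w t k"
    using assms by (cases "t \<in> {1, 2, 3}") (auto simp: coordinates3_def pair_coordinates_def numeral_3_eq_3 numeral_2_eq_2)
  show "snd v t k = snd w t k"
    using assms by (cases "t \<in> {1, 2}") (auto simp: coordinates3_def pair_coordinates_def)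
qed

text \<open>Starting with string pair 1, \<open>(S1, S2)\<close> becomes
  \<open>(- 1 / S1, A)\<close>, \<open>(B / S1, - 1 / A)\<close>,
  \<open>(- S1 / B, - S2 / A)\<close>; starting with pair 2 it becomes \<open>(B, - 1 / S2)\<close>,
  \<open>(- 1 / B, A / S2)\<close>, \<open>(- S1 / B, - S2 / A)\<close>. The increments are checked
  by \<open>parts\<close>.\<close>

lemma braid_coordinates:
  assumes c: "coordinates3 w X1 X2 X3 S1 S2 P1 P2 P3" and P: "P1 \<noteq> P2" "P2 \<noteq> P3" "P1 \<noteq> P3"
    and B: "\<And>i. B (i + 1) - B i = (S1 (i + 1) - S1 i) * S2 (x_index G 2 (rend G 1 i))"
      "\<And>i. B i \<noteq> 0" "\<And>i. B (i + int (edge_count G 1)) = P1 / P3 * B i"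
    and A: "\<And>j. A (j + 1) - A j = (S2 (j + 1) - S2 j) * S1 (y_index G 1 (lend G 2 j))"
      "\<And>j. A j \<noteq> 0" "\<And>j. A (j + int (edge_count G 2)) = P1 / P3 * A j"
  shows "T_strings G 1 (T_strings G 2 (T_strings G 1 w)) = T_strings G 2 (T_strings G 1 (T_strings G 2 w))"
proof -
  have Pnz: "P1 \<noteq> 0" "P2 \<noteq> 0" "P3 \<noteq> 0"
    and S1: "\<And>i. S1 i \<noteq> 0" "\<And>i. S1 (i + int (edge_count G 1)) = P1 / P2 * S1 i"
    and S2: "\<And>j. S2 j \<noteq> 0" "\<And>j. S2 (j + int (edge_count G 2)) = P2 / P3 * S2 j"
    using c by (auto simp: coordinates3_def pair_coordinates_def)
  have parts: "A j + B i = S1 i * S2 j" if "cut i j" for i j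
    using summation_by_parts[OF B(1) A(1) S1(2) S2(2)] B(3) A(3) P(3) Pnz that by simp
  note px = parts[OF cut_x_index(1)] parts[OF cut_x_index(2)]
  note py = parts[OF cut_y_index(1)] parts[OF cut_y_index(2)]
  have c1: "coordinates3 (T_strings G 1 w) (\<lambda>k. X1 k / S1 (x_index G 1 k))
    (\<lambda>k. X2 k * S1 (y_index G 1 (k + 1))) X3 (\<lambda>i. - 1 / S1 i) A P2 P1 P3"
    by (rule coordinates3_T1[OF c P(1) A])
  have c2: "coordinates3 (T_strings G 2 (T_strings G 1 w)) (\<lambda>k. X1 k / S1 (x_index G 1 k))
    (\<lambda>k. X2 k * S1 (y_index G 1 (k + 1)) / A (x_index G 2 k)) (\<lambda>k. X3 k * A (y_index G 2 (k + 1)))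
    (\<lambda>i. B i / S1 i) (\<lambda>i. - 1 / A i) P2 P3 P1"
  proof (rule coordinates3_T2[OF c1 P(3)])
    fix i
    show "B (i + 1) / S1 (i + 1) - B i / S1 i =
        (- 1 / S1 (i + 1) - - 1 / S1 i) * A (x_index G 2 (rend G 1 i))"
      by (rule diff_of_quotients[OF px S1(1) S1(1)])
  qed (use B S1 Pnz in \<open>simp_all\<close>)
  have c3: "coordinates3 (T_strings G 1 (T_strings G 2 (T_strings G 1 w)))
    (\<lambda>k. X1 k / S1 (x_index G 1 k) / (B (x_index G 1 k) / S1 (x_index G 1 k)))
    (\<lambda>k. X2 k * S1 (y_index G 1 (k + 1)) / A (x_index G 2 k) *
      (B (y_index G 1 (k + 1)) / S1 (y_index G 1 (k + 1))))
    (\<lambda>k. X3 k * A (y_index G 2 (k + 1))) (\<lambda>i. - 1 / (B i / S1 i)) (\<lambda>i. - S2 i / A i) P3 P2 P1"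
  proof (rule coordinates3_T1[OF c2 P(2)])
    fix j
    show "- S2 (j + 1) / A (j + 1) - - S2 j / A j = (- 1 / A (j + 1) - - 1 / A j) *
        (B (y_index G 1 (lend G 2 j)) / S1 (y_index G 1 (lend G 2 j)))"
      by (rule diff_of_quotients'[OF py S1(1) A(2) A(2)])
  qed (use A S2 Pnz in \<open>simp_all\<close>)
  have d1: "coordinates3 (T_strings G 2 w) X1 (\<lambda>k. X2 k / S2 (x_index G 2 k))
    (\<lambda>k. X3 k * S2 (y_index G 2 (k + 1))) B (\<lambda>i. - 1 / S2 i) P1 P3 P2"
    by (rule coordinates3_T2[OF c P(2) B])
  have d2: "coordinates3 (T_strings G 1 (T_strings G 2 w)) (\<lambda>k. X1 k / B (x_index G 1 k))
    (\<lambda>k. X2 k / S2 (x_index G 2 k) * B (y_index G 1 (k + 1)))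
    (\<lambda>k. X3 k * S2 (y_index G 2 (k + 1))) (\<lambda>i. - 1 / B i) (\<lambda>j. A j / S2 j) P3 P1 P2"
  proof (rule coordinates3_T1[OF d1 P(3)])
    fix j
    show "A (j + 1) / S2 (j + 1) - A j / S2 j =
        (- 1 / S2 (j + 1) - - 1 / S2 j) * B (y_index G 1 (lend G 2 j))"
      by (rule diff_of_quotients[OF _ _ S2(1) S2(1), where t = "S1 (y_index G 1 (lend G 2 j))"])
        (use py[of j] in \<open>simp_all add: ac_simps\<close>)
  qed (use A S2 Pnz in \<open>simp_all\<close>)
  have d3: "coordinates3 (T_strings G 2 (T_strings G 1 (T_strings G 2 w))) (\<lambda>k. X1 k / B (x_index G 1 k))
    (\<lambda>k. X2 k / S2 (x_index G 2 k) * B (y_index G 1 (k + 1)) / (A (x_index G 2 k) / S2 (x_index G 2 k)))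
    (\<lambda>k. X3 k * S2 (y_index G 2 (k + 1)) * (A (y_index G 2 (k + 1)) / S2 (y_index G 2 (k + 1))))
    (\<lambda>i. - S1 i / B i) (\<lambda>j. - 1 / (A j / S2 j)) P3 P2 P1"
  proof (rule coordinates3_T2[OF d2 P(1)])
    fix i
    show "- S1 (i + 1) / B (i + 1) - - S1 i / B i = (- 1 / B (i + 1) - - 1 / B i) *
        (A (x_index G 2 (rend G 1 i)) / S2 (x_index G 2 (rend G 1 i)))"
      by (rule diff_of_quotients'[OF _ _ S2(1) B(2) B(2)])
        (use px[of i] in \<open>simp_all add: ac_simps\<close>)
  qed (use B S1 Pnz in \<open>simp_all\<close>)
  \<comment> \<open>After cancellation the string primitives of the two sides agree as well.\<close>
  have "coordinates3 (T_strings G 1 (T_strings G 2 (T_strings G 1 w))) (\<lambda>k. X1 k / B (x_index G 1 k))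
    (\<lambda>k. X2 k / S2 (x_index G 2 k) * B (y_index G 1 (k + 1)) / (A (x_index G 2 k) / S2 (x_index G 2 k)))
    (\<lambda>k. X3 k * S2 (y_index G 2 (k + 1)) * (A (y_index G 2 (k + 1)) / S2 (y_index G 2 (k + 1))))
    (\<lambda>i. - S1 i / B i) (\<lambda>j. - 1 / (A j / S2 j)) P3 P2 P1"
    using c3 A(2) B(2) S1(1) S2(1) by simp
  from this d3 show ?thesis
    by (rule coordinates3_eqI) (auto simp: l.fst_T r.fst_T l.snd_T r.snd_T)
qed

lemma generic_coordinates:
  assumes "is_string_weighting G w"
    and P: "loop_weight G 1 w \<noteq> loop_weight G 2 w" "loop_weight G 2 w \<noteq> loop_weight G 3 w"
  obtains X1 X2 X3 S1 S2
  where "coordinates3 w X1 X2 X3 S1 S2 (loop_weight G 1 w) (loop_weight G 2 w) (loop_weight G 3 w)"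
    and "const_sign S1" "const_sign S2" "const_sign (\<lambda>i. S1 (i + 1) - S1 i)" "const_sign (\<lambda>i. S2 (i + 1) - S2 i)"
proof -
  note w = assms(1)[unfolded is_string_weighting_def three, THEN conjunct1, rule_format]
  note z = assms(1)[unfolded is_string_weighting_def three, THEN conjunct2, rule_format]
  have X: "\<exists>X. \<forall>k. 0 < X k \<and> fst w s k = X k / X (k - 1) \<and>
      X (k + int (string_len G s)) = loop_weight G s w * X k \<and> 0 < loop_weight G s w"
    if "s \<in> {1..3}" for s
  proof -
    have pos: "0 < fst w s k" "fst w s (k + int (string_len G s)) = fst w s k" for k
      using w[OF that] by simp_all
    obtain X P where X: "\<And>i. 0 < X i" "\<And>i. fst w s i = X i / X (i - 1)" "0 < P"
      "\<And>i. X (i + int (string_len G s)) = P * X i"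
      using multiplicative_primitive[of "fst w s", OF pos] by metis
    moreover have "X i \<noteq> 0" for i using X(1)[of i] by simp
    ultimately show ?thesis using loop_weight_eq[of X w s G P] by (intro exI[of _ X]) auto
  qed
  define p where "p s = loop_weight G s w" for s
  \<comment> \<open>One primitive is fixed per string, so that both pairs use the same one on string
    2.\<close>
  have "\<exists>X. \<forall>s\<in>{1..3}. \<forall>k. 0 < X s k \<and> fst w s k = X s k / X s (k - 1) \<and>
      X s (k + int (string_len G s)) = p s * X s k \<and> 0 < p s"
    unfolding p_def using X by (intro bchoice) blast
  then obtain X where X: "\<And>s k. s \<in> {1..3} \<Longrightarrow> 0 < X s k \<and> fst w s k = X s k / X s (k - 1) \<and>
      X s (k + int (string_len G s)) = p s * X s k \<and> 0 < p s" by blast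
  have S: "\<exists>S. const_sign S \<and> const_sign (\<lambda>i. S (i + 1) - S i) \<and>
      pair_coordinates G s w (X s) (X (s + 1)) S (p s) (p (s + 1))"
    if a: "adjacent_strings G s" and st: "s < 3" "p s \<noteq> p (s + 1)" for s
  proof -
    interpret adjacent_strings G s by fact
    have s13: "s \<in> {1..3}" "s + 1 \<in> {1..3}" "s \<in> {1..<3}" using adjacent_strings.s(1)[OF a] st by auto
    note Xs = X[OF s13(1)] and Ys = X[OF s13(2)]
    have nz: "X s k \<noteq> 0" "X (s + 1) k \<noteq> 0" "p s \<noteq> 0" "p (s + 1) \<noteq> 0" for k
      using Xs[of k] Ys[of k] by auto
    define f where "f i = X s (lend G s i - 1) * snd w s i / X (s + 1) (rend G s i)" for i
    have f: "0 < f i" for i using Xs Ys z[OF s13(3)] by (simp add: f_def)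
    have fs: "f (i + int n) = p s / p (s + 1) * f i" for i
    proof -
      have "X s (lend G s (i + int n) - 1) = p s * X s (lend G s i - 1)"
        using Xs[of "lend G s i - 1"] lend_shift[of i] by (simp add: algebra_simps)
      moreover have "X (s + 1) (rend G s (i + int n)) = p (s + 1) * X (s + 1) (rend G s i)"
        using Ys[of "rend G s i"] rend_shift[of i] by (simp add: Suc_eq_plus1)
      ultimately show ?thesis using z[OF s13(3)] by (simp add: f_def)
    qed
    have r: "p s / p (s + 1) \<noteq> 1" using st(2) nz by simp
    obtain S where S: "\<And>i. S (i + 1) - S i = f i" "\<And>i. S (i + int n) = p s / p (s + 1) * S i" "const_sign S"
      using quasi_periodic_primitive[of n f, OF n_pos _ fs r] f unfolding const_sign_def by metis
    have "snd w s i = (S (i + 1) - S i) * X (s + 1) (rend G s i) / X s (lend G s i - 1)" for i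
      unfolding S f_def using nz by simp
    then have "pair_coordinates G s w (X s) (X (s + 1)) S (p s) (p (s + 1))"
      using Xs Ys nz S(2) const_sign_nonzero[OF S(3)] by (simp add: pair_coordinates_def)
    moreover have "const_sign (\<lambda>i. S (i + 1) - S i)" unfolding S using f by (simp add: const_sign_def)
    ultimately show ?thesis using S(3) by blast
  qed
  have "1 + 1 = (2::nat)" "2 + 1 = (3::nat)" by simp_all
  then obtain S1 S2 where "const_sign S1" "const_sign (\<lambda>i. S1 (i + 1) - S1 i)"
      "pair_coordinates G 1 w (X 1) (X 2) S1 (p 1) (p 2)"
      "const_sign S2" "const_sign (\<lambda>i. S2 (i + 1) - S2 i)"
      "pair_coordinates G 2 w (X 2) (X 3) S2 (p 2) (p 3)"
    using S[OF l.adjacent_strings_axioms] S[OF r.adjacent_strings_axioms] P unfolding p_def by auto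
  then show ?thesis using that by (simp add: coordinates3_def p_def)
qed

theorem braid:
  assumes w: "is_string_weighting G w"
  shows "T_strings G 1 (T_strings G 2 (T_strings G 1 w)) = T_strings G 2 (T_strings G 1 (T_strings G 2 w))"
proof -
  let ?T = "T_strings G 1" and ?U = "T_strings G 2" and ?p = "loop_weight G"
  have two: "1 + 1 = (2::nat)" "2 + 1 = (3::nat)" by simp_all
  have Tw: "is_string_weighting G (?T v)" "?T (?T v) = v" "?p 1 (?T v) = ?p 2 v" "?p 2 (?T v) = ?p 1 v"
      "?p 3 (?T v) = ?p 3 v" "?p 1 v = ?p 2 v \<Longrightarrow> ?T v = v"
    and Uw: "is_string_weighting G (?U v)" "?U (?U v) = v" "?p 1 (?U v) = ?p 1 v" "?p 2 (?U v) = ?p 3 v"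
      "?p 3 (?U v) = ?p 2 v" "?p 2 v = ?p 3 v \<Longrightarrow> ?U v = v"
    if "is_string_weighting G v" for v
    using l.is_string_weighting_T[OF that] l.T_involution[OF l.weighting_expand[OF that]]
      l.loop_weight_T[OF that] l.T_equal_loop_weights[OF that] r.is_string_weighting_T[OF that]
      r.T_involution[OF r.weighting_expand[OF that]] r.loop_weight_T[OF that] r.T_equal_loop_weights[OF that]
    unfolding two by simp_all
  \<comment> \<open>The actions permute the loop weights and are trivial on a pair with equal ones.
    If two of the three agree, this and involutivity bring both sides to the same
    expression.\<close>
  consider "?p 1 w = ?p 2 w" | "?p 2 w = ?p 3 w" | "?p 1 w = ?p 3 w"
    | "?p 1 w \<noteq> ?p 2 w" "?p 2 w \<noteq> ?p 3 w" "?p 1 w \<noteq> ?p 3 w" by blast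
  then show ?thesis
  proof cases
    case 1
    then show ?thesis using w Tw Uw by simp
  next
    case 2
    then show ?thesis using w Tw Uw by simp
  next
    case 3
    then show ?thesis using w Tw Uw by simp
  next
    case 4
    obtain X1 X2 X3 S1 S2
      where c: "coordinates3 w X1 X2 X3 S1 S2 (?p 1 w) (?p 2 w) (?p 3 w)"
        and sign: "const_sign S1" "const_sign S2" "const_sign (\<lambda>i. S1 (i + 1) - S1 i)"
          "const_sign (\<lambda>i. S2 (i + 1) - S2 i)"
      using generic_coordinates[OF w 4(1,2)] by blast
    have P: "?p 1 w \<noteq> 0" "?p 2 w \<noteq> 0" "?p 3 w \<noteq> 0"
      and S1: "\<And>i. S1 (i + int (edge_count G 1)) = ?p 1 w / ?p 2 w * S1 i"
      and S2: "\<And>j. S2 (j + int (edge_count G 2)) = ?p 2 w / ?p 3 w * S2 j"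
      using c by (auto simp: coordinates3_def pair_coordinates_def)
    have r: "?p 1 w / ?p 3 w \<noteq> 1" using 4(3) P by simp
    have sh: "i + int m + 1 = i + 1 + int m" for i m by simp
    let ?f = "\<lambda>i. (S1 (i + 1) - S1 i) * S2 (x_index G 2 (rend G 1 i))"
    have f: "?f (i + int (edge_count G 1)) = ?p 1 w / ?p 3 w * ?f i" for i
    proof -
      have "x_index G 2 (rend G 1 (i + int (edge_count G 1))) = x_index G 2 (rend G 1 i) + int (edge_count G 2)"
        using r.x_index_shift[of "rend G 1 i"] l.rend_shift[of i] by (simp add: numeral_2_eq_2 One_nat_def)
      then have "S2 (x_index G 2 (rend G 1 (i + int (edge_count G 1)))) =
          ?p 2 w / ?p 3 w * S2 (x_index G 2 (rend G 1 i))" by (simp only: S2)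
      then show ?thesis unfolding sh S1 right_diff_distrib[symmetric] using P by simp

    qed
    \<comment> \<open>The ratio over a period differs from 1, so the integrals \<open>B\<close> and
      \<open>A\<close> exist; constant signs make them nowhere zero.\<close>
    obtain B where B: "\<And>i. B (i + 1) - B i = ?f i"
      "\<And>i. B (i + int (edge_count G 1)) = ?p 1 w / ?p 3 w * B i" "const_sign B"
      using quasi_periodic_primitive[OF l.n_pos
          const_sign_mult[where u = "\<lambda>i. x_index G 2 (rend G 1 i)", OF sign(3,2)] f r] by metis
    let ?g = "\<lambda>j. (S2 (j + 1) - S2 j) * S1 (y_index G 1 (lend G 2 j))"
    have g: "?g (j + int (edge_count G 2)) = ?p 1 w / ?p 3 w * ?g j" for j
    proof -
      have "y_index G 1 (lend G 2 (j + int (edge_count G 2))) = y_index G 1 (lend G 2 j) + int (edge_count G 1)"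
        using l.y_index_shift[of "lend G 2 j"] r.lend_shift[of j] by (simp add: numeral_2_eq_2 One_nat_def)
      then have "S1 (y_index G 1 (lend G 2 (j + int (edge_count G 2)))) =
          ?p 1 w / ?p 2 w * S1 (y_index G 1 (lend G 2 j))" by (simp only: S1)
      then show ?thesis unfolding sh S2 right_diff_distrib[symmetric] using P by simp

    qed
    obtain A where A: "\<And>j. A (j + 1) - A j = ?g j"
      "\<And>j. A (j + int (edge_count G 2)) = ?p 1 w / ?p 3 w * A j" "const_sign A"
      using quasi_periodic_primitive[OF r.n_pos
          const_sign_mult[where u = "\<lambda>j. y_index G 1 (lend G 2 j)", OF sign(4,1)] g r] by metis
    show ?thesis
      by (rule braid_coordinates[OF c 4 B(1) const_sign_nonzero[OF B(3)] B(2)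
            A(1) const_sign_nonzero[OF A(3)] A(2)])
  qed
qed

end

section \<open>Turning numbers\<close>

lemma sum_cyclic_differences:
  fixes \<theta> :: "nat \<Rightarrow> real"
  shows "(\<Sum>k<n. \<theta> (Suc k mod n) - \<theta> k) = 0"
proof (cases n)
  case (Suc m)
  have "(\<Sum>k<Suc m. \<theta> (Suc k mod Suc m)) = (\<Sum>k<m. \<theta> (Suc k)) + \<theta> 0"
    by (simp add: sum.lessThan_Suc)
  also have "\<dots> = (\<Sum>k<Suc m. \<theta> k)" by (simp add: sum.lessThan_Suc_shift del: sum.lessThan_Suc)
  finally show ?thesis using Suc by (simp add: sum_subtractf del: sum.lessThan_Suc)
qed simp

lemma Arg_quotient:
  assumes "d = rcis r a" "d' = rcis r' a'" "0 < r" "0 < r'" "- pi < a' - a" "a' - a \<le> pi"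
  shows "Arg (d' / d) = a' - a"
  using assms by (intro Arg_unique'[of "r' / r"]) (auto simp: rcis_divide)

text \<open>
  Lifting the argument of the leftward step to \<open>- pi\<close>, all turning angles become differences of
  arguments, so they cancel around the polygon and only the rotation of the annulus remains.
\<close>

lemma tangent_turns_polygon:
  assumes L: "L \<noteq> []" "\<And>d. d \<in> set L \<Longrightarrow> 0 < Re d \<or> Re d = 0 \<and> 0 < Im d"
    and ends: "0 < Re (hd L)" "0 < Re (last L)" and "0 < a" "0 < b" "0 < c"
  shows "tangent_turns (L @ [- \<i> * of_real a, of_real (- c), - \<i> * of_real b]) =
    a + b - (\<Sum>d\<leftarrow>L. Im d)"
proof -
  let ?ds = "L @ [- \<i> * of_real a, of_real (- c), - \<i> * of_real b]"
  let ?m = "length L"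
  define \<theta> where "\<theta> k = (if k < ?m then Arg (L ! k) else if k = Suc ?m then - pi else - (pi / 2))" for k
  have polar: "\<exists>r>0. ?ds ! k = rcis r (\<theta> k)" if "k < ?m + 3" for k
  proof -
    have "k < ?m \<or> k = ?m \<or> k = Suc ?m \<or> k = Suc (Suc ?m)" using that by linarith
    then consider "k < ?m" | "k = ?m" | "k = Suc ?m" | "k = Suc (Suc ?m)" by blast
    then show ?thesis
    proof cases
      case 1
      then have "0 < Re (L ! k) \<or> Re (L ! k) = 0 \<and> 0 < Im (L ! k)" using L(2) nth_mem by blast
      then have "L ! k \<noteq> 0" by auto
      then show ?thesis using 1 by (intro exI[of _ "cmod (L ! k)"]) (simp add: \<theta>_def nth_append rcis_cmod_Arg)
    next
      case 2
      then show ?thesis using assms by (intro exI[of _ a]) (simp add: \<theta>_def nth_append rcis_def complex_eq_iff)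
    next
      case 3
      then show ?thesis using assms by (intro exI[of _ c]) (simp add: \<theta>_def nth_append rcis_def complex_eq_iff)
    next
      case 4
      then show ?thesis using assms by (intro exI[of _ b]) (simp add: \<theta>_def nth_append rcis_def complex_eq_iff)
    qed
  qed
  have right: "\<bar>Arg d\<bar> < pi / 2" if "0 < Re d" for d using that Arg_Re_pos[of d] by simp
  have up: "- (pi / 2) < Arg d \<and> Arg d \<le> pi / 2" if "d \<in> set L" for d
  proof (cases "0 < Re d")
    case True then show ?thesis using right[of d] by linarith
  next
    case False
    then have "d = rcis (Im d) (pi / 2)" "0 < Im d"
      using L(2)[OF that] by (auto simp: rcis_def complex_eq_iff)
    then have "Arg d = pi / 2" using Arg_unique'[of "Im d" "pi / 2" d] by simp
    then show ?thesis using pi_gt_zero by linarith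
  qed
  have turn: "Arg (?ds ! (Suc k mod length ?ds) / ?ds ! k) = \<theta> (Suc k mod length ?ds) - \<theta> k"
    if k: "k < length ?ds" for k
  proof -
    let ?k' = "Suc k mod length ?ds"
    have "?k' < length L + 3" using mod_less_divisor[of "length ?ds" "Suc k"] by simp
    then obtain r r' where r: "0 < r" "?ds ! k = rcis r (\<theta> k)" "0 < r'" "?ds ! ?k' = rcis r' (\<theta> ?k')"
      using polar[of k] polar[of ?k'] k by (metis length_append list.size(3,4) numeral_3_eq_3 One_nat_def add_Suc_right add_0_right)
    \<comment> \<open>The last step of \<open>L\<close> must not be vertical: from
      \<open>pi / 2\<close> to \<open>- (pi / 2)\<close> the difference is \<open>- pi\<close>,
      which is not a principal value.\<close>
    have 0: "\<bar>\<theta> 0\<bar> < pi / 2" and m: "\<bar>\<theta> (?m - 1)\<bar> < pi / 2"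
      using L(1) ends right by (simp_all add: \<theta>_def hd_conv_nth last_conv_nth)
    have "- pi < \<theta> ?k' - \<theta> k \<and> \<theta> ?k' - \<theta> k \<le> pi"
    proof -
      have "Suc k < ?m \<or> Suc k = ?m \<or> k = ?m \<or> k = Suc ?m \<or> k = Suc (Suc ?m)"
        using k unfolding length_append by (simp del: One_nat_def) linarith
      then consider "Suc k < ?m" | "Suc k = ?m" | "k = ?m" | "k = Suc ?m" | "k = Suc (Suc ?m)" by blast
      then show ?thesis
      proof cases
        case 1
        then show ?thesis using up[of "L ! k"] up[of "L ! Suc k"] by (simp add: \<theta>_def)
      next
        case 2
        then have "\<theta> ?k' = - (pi / 2)" "k = ?m - 1" by (simp_all add: \<theta>_def)
        then show ?thesis using m unfolding abs_less_iff by simp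
      next
        case 3
        then have "\<theta> ?k' = - pi" "\<theta> k = - (pi / 2)" by (simp_all add: \<theta>_def)
        then show ?thesis using pi_gt_zero by linarith
      next
        case 4
        then have "\<theta> ?k' = - (pi / 2)" "\<theta> k = - pi" by (simp_all add: \<theta>_def)
        then show ?thesis using pi_gt_zero by linarith
      next
        case 5
        then have "?k' = 0" by simp
        moreover have "\<theta> k = - (pi / 2)" using 5 by (simp add: \<theta>_def)
        ultimately show ?thesis using 0 unfolding abs_less_iff by simp
      qed
    qed
    then show ?thesis by (intro Arg_quotient[OF r(2,4,1,3)]) blast+
  qed
  have "(\<Sum>k<length ?ds. Arg (?ds ! (Suc k mod length ?ds) / ?ds ! k)) = 0"
    using turn sum_cyclic_differences[of \<theta> "length ?ds"] by (simp del: length_append sum.lessThan_Suc)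
  moreover have "(\<Sum>d\<leftarrow>?ds. 2 * pi * Im d) = 2 * pi * ((\<Sum>d\<leftarrow>L. Im d) - a - b)"
    by (simp add: sum_list_const_mult[symmetric] algebra_simps)
  ultimately show ?thesis
    unfolding tangent_turns_def by simp
qed

section \<open>Rational generating functions\<close>

lemma fls_polynomial:
  fixes f :: "real fls"
  assumes "\<And>m. m < 0 \<Longrightarrow> fls_nth f m = 0" "\<And>m. m \<ge> int K \<Longrightarrow> fls_nth f m = 0"
  shows "\<exists>p. f = fps_to_fls (fps_of_poly p)"
proof
  let ?p = "\<Sum>k<K. monom (fls_nth f (int k)) k"
  have c: "coeff ?p m = (if m < K then fls_nth f (int m) else 0)" for m
    by (simp add: coeff_sum)
  show "f = fps_to_fls (fps_of_poly ?p)"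
  proof (rule fls_eqI)
    fix m
    show "fls_nth f m = fls_nth (fps_to_fls (fps_of_poly ?p)) m"
      using assms[of m] by (cases "m < 0") (auto simp: c nat_less_iff)
  qed
qed

text \<open>Multiplication by \<open>[:1, s, t:]\<close> annihilates the high coefficients, and
  \<open>monom 1 N\<close> moves the negative powers up, which leaves a polynomial.\<close>

lemma recurrent_fls_rational:
  fixes f :: "real fls"
  assumes "\<And>m. m \<ge> m0 \<Longrightarrow> fls_nth f (m + 2) + s * fls_nth f (m + 1) + t * fls_nth f m = 0"
  shows "\<exists>p q. q \<noteq> 0 \<and> fps_to_fls (fps_of_poly q) * f = fps_to_fls (fps_of_poly p)"
proof -
  define N where "N = nat (- fls_subdegree f)"
  let ?q = "monom 1 N * [:1, s, t:]"
  let ?g = "fps_to_fls (fps_of_poly ?q) * f"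
  have q: "fps_to_fls (fps_of_poly [:1, s, t:]) * f = f + fls_const s * (fls_X * f) + fls_const t * (fls_X * (fls_X * f))"
    by (simp add: fps_of_poly_pCons fls_times_fps_to_fls algebra_simps)
  have "?g = fls_X ^ N * (f + fls_const s * (fls_X * f) + fls_const t * (fls_X * (fls_X * f)))"
    unfolding fps_of_poly_mult fls_times_fps_to_fls mult.assoc q
    by (simp add: fps_of_poly_monom fls_times_fps_to_fls fps_to_fls_power)
  then have g: "fls_nth ?g m = fls_nth f (m - int N) + s * fls_nth f (m - int N - 1) + t * fls_nth f (m - int N - 2)" for m
    by (simp add: fls_X_power_times_conv_shift fls_X_times_conv_shift algebra_simps)
  have low: "fls_nth f m = 0" if "m < - int N" for m
    using that by (intro fls_eq0_below_subdegree) (simp add: N_def split: if_splits)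
  have "\<exists>p. ?g = fps_to_fls (fps_of_poly p)"
  proof (rule fls_polynomial[where K = "nat (m0 + int N + 2)"])
    show "fls_nth ?g m = 0" if "m < 0" for m using that unfolding g by (simp add: low)
    show "fls_nth ?g m = 0" if "int (nat (m0 + int N + 2)) \<le> m" for m
      using that assms[of "m - int N - 2"] unfolding g by (simp split: if_splits)
  qed
  moreover have "?q \<noteq> 0" by (intro no_zero_divisors) simp_all
  ultimately show ?thesis by blast
qed

text \<open>Multiplying the series by both denominators gives \<open>p' * q = p * q'\<close> for any
  second representation, so the fraction is unique.\<close>

lemma boundary_measurement_eqI:
  assumes "q \<noteq> 0" "fps_to_fls (fps_of_poly q) * measurement_series N u v = fps_to_fls (fps_of_poly p)"
  shows "boundary_measurement N u v = Fract p q"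
  unfolding boundary_measurement_def
proof (rule the_equality)
  show "\<exists>p' q'. q' \<noteq> 0 \<and> Fract p q = Fract p' q' \<and>
      fps_to_fls (fps_of_poly q') * measurement_series N u v = fps_to_fls (fps_of_poly p')"
    using assms by blast
next
  fix r assume "\<exists>p q. q \<noteq> 0 \<and> r = Fract p q \<and>
      fps_to_fls (fps_of_poly q) * measurement_series N u v = fps_to_fls (fps_of_poly p)"
  then obtain p' q' where r: "q' \<noteq> 0" "r = Fract p' q'"
    "fps_to_fls (fps_of_poly q') * measurement_series N u v = fps_to_fls (fps_of_poly p')" by blast
  have "fps_to_fls (fps_of_poly (p' * q)) = fps_to_fls (fps_of_poly (p * q'))"
    unfolding fps_of_poly_mult fls_times_fps_to_fls assms(2)[symmetric] r(3)[symmetric]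
    by (simp add: ac_simps)
  then have "p' * q = p * q'" by (simp add: fps_of_poly_eq_iff)
  then show "r = Fract p q" using assms(1) r(1,2) by (simp add: eq_fract)
qed

text \<open>A rational function has one Laurent expansion: the two series agree after multiplication
  by the nonzero \<open>q * q'\<close>, which can be cancelled.\<close>

lemma measurement_series_eqI:
  assumes "boundary_measurement N u v = boundary_measurement N' u v"
    and "q \<noteq> 0" "fps_to_fls (fps_of_poly q) * measurement_series N u v = fps_to_fls (fps_of_poly p)"
    and "q' \<noteq> 0" "fps_to_fls (fps_of_poly q') * measurement_series N' u v = fps_to_fls (fps_of_poly p')"
  shows "measurement_series N u v = measurement_series N' u v"
proof -
  have "p * q' = p' * q"
    using boundary_measurement_eqI[OF assms(2,3)] boundary_measurement_eqI[OF assms(4,5)] assms(1,2,4)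
    by (simp add: eq_fract)
  then have "fps_to_fls (fps_of_poly p) * fps_to_fls (fps_of_poly q') =
      fps_to_fls (fps_of_poly p') * fps_to_fls (fps_of_poly q)"
    by (simp flip: fls_times_fps_to_fls fps_of_poly_mult)
  then have "fps_to_fls (fps_of_poly q) * fps_to_fls (fps_of_poly q') * measurement_series N u v =
      fps_to_fls (fps_of_poly q) * fps_to_fls (fps_of_poly q') * measurement_series N' u v"
    unfolding assms(3)[symmetric] assms(5)[symmetric] by (simp add: ac_simps)
  moreover have "fps_to_fls (fps_of_poly q) * fps_to_fls (fps_of_poly q') \<noteq> 0"
    using assms(2,4) by (simp add: fps_of_poly_eq_iff[of _ 0, simplified])
  ultimately show ?thesis by simp
qed

section \<open>Paths\<close>

lemma is_path_Cons:
  "is_path N u (e # P) v \<longleftrightarrow>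
     e \<in> arcs N \<and> src N e = u \<and> (if P = [] then tgt N e = v else is_path N (tgt N e) P v)"
  by (auto simp: is_path_def successively_Cons)

lemma is_path_append:
  assumes "is_path N u P v" "is_path N v Q w"
  shows "is_path N u (P @ Q) w"
  using assms by (auto simp: is_path_def successively_append_iff)

text \<open>Applied to the integral and the fractional part of the height, this yields
  \<open>path_int\<close> and the vertical extent of a path.\<close>

lemma path_telescope:
  fixes \<phi> :: "'v \<Rightarrow> 'a :: ab_group_add"
  assumes "is_path N u P v"
  shows "(\<Sum>e\<leftarrow>P. \<phi> (tgt N e) - \<phi> (src N e)) = \<phi> v - \<phi> u"
  using assms
proof (induction P arbitrary: u)
  case (Cons e P)
  then show ?case by (cases "P = []") (auto simp: is_path_Cons)
qed (simp add: is_path_def)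

section \<open>Paths on the universal cover\<close>

declare One_nat_def [simp del]

lemma not_is_path_Nil [simp]: "\<not> is_path N u [] v"
  by (simp add: is_path_def)

primrec left_part :: "int \<Rightarrow> nat \<Rightarrow> edge list" where
  "left_part a 0 = [LUp a]"
| "left_part a (Suc k) = LUp a # X (a + 1) # left_part (a + 1) k"

primrec right_part :: "int \<Rightarrow> nat \<Rightarrow> edge list" where
  "right_part j 0 = [RUp j]"
| "right_part j (Suc l) = RUp j # Y (j + 1) # right_part (j + 1) l"

lemma length_left_part: "length (left_part a k) = 2 * k + 1"
  by (induction k arbitrary: a) auto

lemma Z_notin_left_part: "Z i \<notin> set (left_part a k)"
  by (induction k arbitrary: a) auto

primrec reduce :: "loop_graph \<Rightarrow> edge \<Rightarrow> edge" where
  "reduce G (In t) = In (t mod int (edge_count G 0))"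
| "reduce G (X i) = X (i mod int (edge_count G 1))"
| "reduce G (LUp i) = LUp (i mod int (edge_count G 1))"
| "reduce G (Z i) = Z (i mod int (edge_count G 1))"
| "reduce G (Y i) = Y (i mod int (edge_count G 1))"
| "reduce G (RUp i) = RUp (i mod int (edge_count G 1))"
| "reduce G (Out t) = Out (t mod int (edge_count G 2))"

text \<open>Casting the universal cover as a network makes \<open>is_path\<close> and its lemmas
  available for lifted paths.\<close>

definition cover :: "loop_graph \<Rightarrow> (vertex, edge) cyl_network" where
  "cover G = \<lparr> arcs = UNIV, src = start G, tgt = finish G, loc = (\<lambda>_. 0), crossings = (\<lambda>_. 0),
     wgt = (\<lambda>_. 1), sources = {}, sinks = {} \<rparr>"

lemma cover_simps [simp]: "arcs (cover G) = UNIV" "src (cover G) = start G" "tgt (cover G) = finish G"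
  by (simp_all add: cover_def)

lemma left_part_path: "is_path (cover G) (LB a) (left_part a k) (LW (a + int k + 1))"
proof (induction k arbitrary: a)
  case (Suc k)
  then show ?case using Suc[of "a + 1"] by (auto simp: is_path_Cons algebra_simps)
qed (simp add: is_path_Cons)

lemma right_part_path: "is_path (cover G) (RB j) (right_part j l) (RW (j + int l + 1))"
proof (induction l arbitrary: j)
  case (Suc l)
  then show ?case using Suc[of "j + 1"] by (auto simp: is_path_Cons algebra_simps)
qed (simp add: is_path_Cons)

lemma linear_if_periodic:
  fixes f :: "int \<Rightarrow> int"
  assumes "\<And>t. f (t + c) = f t + d"
  shows "f (t + c * m) = f t + d * m"
proof -
  have "f (t + c * m) - d * m = f (t + c * 0) - d * 0"
  proof (rule int_const_if_step[where f = "\<lambda>m. of_int (f (t + c * m) - d * m)", THEN of_int_eq_iff[THEN iffD1]])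
    show "real_of_int (f (t + c * (m + 1)) - d * (m + 1)) = real_of_int (f (t + c * m) - d * m)" for m
      using assms[of "t + c * m"] by (simp add: algebra_simps)
  qed
  then show ?thesis by simp
qed

lemma mod_shift: "(i :: int) mod int c = i + int c * (- (i div int c))"
  by (simp add: minus_mult_div_eq_mod)

section \<open>Lifting the paths of a two-string network to the universal cover\<close>

locale two_strings =
  fixes G :: loop_graph
  assumes wf: "well_formed G" and two: "strings G = 2"
begin

sublocale adjacent_strings G 1 by unfold_locales (use wf two in auto)

abbreviation "n0 \<equiv> edge_count G 0"
abbreviation "n2 \<equiv> edge_count G 2"

definition "entry t = x_index G 1 (rend G 0 t)"
definition "exit t = y_index G 1 (lend G 2 t)"

lemma boundary: "0 < n0" "0 < n2" "surj (rend G 0)" "surj (lend G 2)"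
    "rend G 0 (t + int n0) = rend G 0 t + int (string_len G 1)"
    "lend G 2 (t + int n2) = lend G 2 t + int (string_len G 2)"
  using wf two by (auto simp: well_formed_def One_nat_def)

lemma entry_shift: "entry (t + int n0 * m) = entry t + int n * m"
  by (rule linear_if_periodic) (simp add: entry_def boundary(5) x_index_shift)

lemma exit_shift: "exit (t + int n2 * m) = exit t + int n * m"
proof (rule linear_if_periodic)
  show "exit (t + int n2) = exit t + int n" for t
    using y_index_shift[of "lend G 2 t"] boundary(6)[of t]
    by (simp add: exit_def numeral_2_eq_2 One_nat_def)
qed

lemma entry_unmarked: "\<not> x_set G 1 (entry t)" and exit_unmarked: "\<not> y_set G 1 (exit t)"
  by (simp_all only: entry_def exit_def x_set_x_index y_set_y_index not_False_eq_True)

text \<open>Each black vertex of the left string has a boundary edge, since \<open>rend G 0\<close>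
  is surjective. So every unmarked index is visible from the boundary.\<close>

lemma entry_surj: "\<not> x_set G 1 a \<Longrightarrow> \<exists>t. entry t = a"
  using x_index_lend boundary(3) by (metis entry_def surjD)

lemma exit_surj: "\<not> y_set G 1 b \<Longrightarrow> \<exists>t. exit t = b"
  using y_index_rend boundary(4) by (metis exit_def surjD)

text \<open>Reduction moves an edge and both its ends by one deck transformation;
  \<open>entry_shift\<close> and \<open>exit_shift\<close> match the periods of a boundary column
  with those of the strings.\<close>

lemma reduce_shift:
  "\<exists>m. start G (reduce G e) = shift G m (start G e) \<and> finish G (reduce G e) = shift G m (finish G e)"
proof (cases e)
  case (In t)
  show ?thesis
    using entry_shift[of t "- (t div int n0)"] unfolding In
    by (intro exI[of _ "- (t div int n0)"]) (simp add: mod_shift[of t n0] entry_def)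
next
  case (Out t)
  show ?thesis
    using exit_shift[of t "- (t div int n2)"] unfolding Out
    by (intro exI[of _ "- (t div int n2)"]) (simp add: mod_shift[of t n2] exit_def)
next
  case (X i)
  show ?thesis unfolding X by (intro exI[of _ "- (i div int n)"]) (simp add: mod_shift[of i n])
next
  case (LUp i)
  show ?thesis unfolding LUp by (intro exI[of _ "- (i div int n)"]) (simp add: mod_shift[of i n])
next
  case (Z i)
  show ?thesis unfolding Z by (intro exI[of _ "- (i div int n)"]) (simp add: mod_shift[of i n])
next
  case (Y i)
  show ?thesis unfolding Y by (intro exI[of _ "- (i div int n)"]) (simp add: mod_shift[of i n])
next
  case (RUp i)
  show ?thesis unfolding RUp by (intro exI[of _ "- (i div int n)"]) (simp add: mod_shift[of i n])
qed

lemma representative_shift: "representative G (shift G m v) = representative G v"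
  by (cases v) simp_all

lemma representative_reduce:
  "representative G (start G (reduce G e)) = representative G (start G e)"
  "representative G (finish G (reduce G e)) = representative G (finish G e)"
  using reduce_shift[of e] by (auto simp: representative_shift)

lemma representative_eq_shift: "\<exists>m. representative G v = shift G m v"
  by (cases v) (simp_all, (metis mod_shift)+)

definition cover_path :: "int \<Rightarrow> nat \<Rightarrow> nat \<Rightarrow> int \<Rightarrow> edge list" where
  "cover_path t k l t' = In t # left_part (entry t) k @ Z (entry t + int k) #
     right_part (entry t + int k) l @ [Out t']"

lemma cover_path_path:
  assumes "exit t' = entry t + int k + int l + 1"
  shows "is_path (cover G) (LBd t) (cover_path t k l t') (RBd t')"
proof -
  have "is_path (cover G) (RW (entry t + int k + int l + 1)) [Out t'] (RBd t')"
    using assms by (simp add: is_path_Cons exit_def)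
  from is_path_append[OF right_part_path this]
  have "is_path (cover G) (LW (entry t + int k + 1))
      (Z (entry t + int k) # right_part (entry t + int k) l @ [Out t']) (RBd t')"
    by (subst is_path_Cons) simp
  from is_path_append[OF left_part_path this] show ?thesis
    unfolding cover_path_def by (subst is_path_Cons) (simp add: entry_def)
qed

end

locale drawn_two_strings = two_strings +
  fixes h :: "vertex \<Rightarrow> real" and w :: weights
  assumes drawing: "is_drawing G h" and w: "is_weighting G w"
begin

abbreviation "N \<equiv> expanded_network G h w"

lemma h_shift: "h (shift G m v) = h v + of_int m"
proof -
  have "shift G (m + 1) v = shift G 1 (shift G m v)" for m by (cases v) (simp_all add: algebra_simps)
  then have "h (shift G (m + 1) v) - of_int (m + 1) = h (shift G m v) - of_int m" for m
    using drawing by (simp add: is_drawing_def)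
  then have "h (shift G m v) - of_int m = h (shift G 0 v) - of_int 0"
    by (rule int_const_if_step[where f = "\<lambda>m. h (shift G m v) - of_int m"])
  moreover have "shift G 0 v = v" by (cases v) simp_all
  ultimately show ?thesis by simp
qed

lemma N_simps [simp]: "src N e = representative G (start G e)" "tgt N e = representative G (finish G e)"
  "loc N v = Complex (column v) (frac (h v))" "crossings N e = \<lfloor>h (finish G e)\<rfloor> - \<lfloor>h (start G e)\<rfloor>"
  "wgt N = edge_weight w" "sources N = LBd ` {0..<int n0}" "sinks N = RBd ` {0..<int n2}"
  by (simp_all add: expanded_network_def)

lemma arcs_N: "arcs N = range (reduce G)"
proof
  have *: "e = reduce G e" if "e \<in> arcs N" for e
    using that by (auto simp: expanded_network_def)
  show "arcs N \<subseteq> range (reduce G)" using * by blast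
  have "reduce G e \<in> arcs N" for e
    using n_pos boundary by (cases e) (auto simp: expanded_network_def)
  then show "range (reduce G) \<subseteq> arcs N" by blast
qed

lemma crossings_reduce: "crossings N (reduce G e) = crossings N e"
  using reduce_shift[of e] by (auto simp: h_shift)

lemma is_path_reduce:
  assumes "is_path (cover G) u P v"
  shows "is_path N (representative G u) (map (reduce G) P) (representative G v)"
  using assms
proof (induction P arbitrary: u)
  case (Cons e P)
  then show ?case
    by (cases "P = []") (auto simp: is_path_Cons arcs_N representative_reduce)
qed (simp add: is_path_def)

lemma from_LBd: "e \<in> arcs N \<Longrightarrow> src N e = LBd t \<Longrightarrow> e = In t"
  and from_RBd: "e \<in> arcs N \<Longrightarrow> src N e \<noteq> RBd t"
  and from_LB: "e \<in> arcs N \<Longrightarrow> src N e = LB (a mod int n) \<Longrightarrow> e = LUp (a mod int n)"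
  and from_RB: "e \<in> arcs N \<Longrightarrow> src N e = RB (a mod int n) \<Longrightarrow> e = RUp (a mod int n)"
  by (auto simp: expanded_network_def)

lemma from_LW:
  assumes "e \<in> arcs N" "src N e = LW ((a + 1) mod int n)"
  shows "e = X ((a + 1) mod int n) \<or> e = Z (a mod int n)"
proof -
  have "a mod int n = i" if "(i + 1) mod int n = (a + 1) mod int n" "0 \<le> i" "i < int n" for i
    using that by (metis add_diff_cancel_right' mod_diff_left_eq mod_pos_pos_trivial)
  then show ?thesis using assms by (auto simp: expanded_network_def)
qed

lemma from_RW:
  assumes "e \<in> arcs N" "src N e = RW (b mod int n)"
  shows "e = Y (b mod int n) \<or> (\<exists>t. e = reduce G (Out t) \<and> exit t = b)"
proof -
  \<comment> \<open>Among the lifts of an outgoing edge, the one leaving from \<open>RW b\<close>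
    itself is selected.\<close>
  have "\<exists>t'. t = t' mod int n2 \<and> exit t' = b" if "exit t mod int n = b mod int n" "0 \<le> t" "t < int n2" for t
  proof -
    have "int n dvd b - exit t" using that(1) by (metis mod_eq_dvd_iff)
    then obtain m where "b - exit t = int n * m" by blast
    then show ?thesis using that exit_shift[of t m] by (intro exI[of _ "t + int n2 * m"]) auto
  qed
  moreover have "e = Y (b mod int n) \<or> (\<exists>t. e = Out t \<and> 0 \<le> t \<and> t < int n2 \<and> exit t mod int n = b mod int n)"
    using assms by (auto simp: expanded_network_def exit_def)
  ultimately show ?thesis by auto
qed

text \<open>Path lifting: after each black-to-white edge a path either climbs on, where the
  induction applies at \<open>j + 1\<close>, or leaves for the boundary and ends.\<close>

lemma right_paths:
  assumes "is_path N (RB (j mod int n)) P (RBd t')"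
  shows "\<exists>l t. t mod int n2 = t' \<and> exit t = j + int l + 1 \<and> P = map (reduce G) (right_part j l @ [Out t])"
  using assms
proof (induction "length P" arbitrary: P j rule: less_induct)
  case less
  then obtain e Q where P: "P = e # Q" by (cases P) (auto simp: is_path_def)
  with less.prems have e: "e = RUp (j mod int n)" by (intro from_RB) (auto simp: is_path_Cons)
  have "Q \<noteq> []" "is_path N (RW ((j + 1) mod int n)) Q (RBd t')"
    using less.prems unfolding P e by (auto simp: is_path_Cons mod_simps split: if_splits)
  then obtain f R where Q: "Q = f # R" "f \<in> arcs N" "src N f = RW ((j + 1) mod int n)"
    "if R = [] then tgt N f = RBd t' else is_path N (tgt N f) R (RBd t')"
    by (cases Q) (auto simp: is_path_Cons)
  from from_RW[OF Q(2,3)] show ?case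
  proof
    assume f: "f = Y ((j + 1) mod int n)"
    then have "is_path N (RB ((j + 1) mod int n)) R (RBd t')" using Q(4) by (auto split: if_splits)
    moreover have "length R < length P" by (simp add: P Q(1))
    ultimately obtain l t where "t mod int n2 = t'" "exit t = j + 1 + int l + 1"
      "R = map (reduce G) (right_part (j + 1) l @ [Out t])" using less.hyps by blast
    then show ?thesis
      by (intro exI[of _ "Suc l"] exI[of _ t]) (simp add: P Q(1) e f)
  next
    assume "\<exists>t. f = reduce G (Out t) \<and> exit t = j + 1"
    then obtain t where t: "f = reduce G (Out t)" "exit t = j + 1" by blast
    have "R = []"
    proof (rule ccontr)
      assume "R \<noteq> []"
      then obtain g where "g \<in> arcs N" "src N g = RBd (t mod int n2)"
        using Q(4) unfolding t(1) by (cases R) (auto simp: is_path_Cons)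
      then show False using from_RBd by blast
    qed
    then have "t mod int n2 = t'" using Q(4) unfolding t(1) by simp
    then show ?thesis
      using t \<open>R = []\<close> by (intro exI[of _ 0] exI[of _ t]) (simp add: P Q(1) e)
  qed
qed

lemma left_paths:
  assumes "is_path N (LB (a mod int n)) P (RBd t')"
  shows "\<exists>k l t. t mod int n2 = t' \<and> exit t = a + int k + int l + 1 \<and>
    P = map (reduce G) (left_part a k @ Z (a + int k) # right_part (a + int k) l @ [Out t])"
  using assms
proof (induction "length P" arbitrary: P a rule: less_induct)
  case less
  then obtain e Q where P: "P = e # Q" by (cases P) (auto simp: is_path_def)
  with less.prems have e: "e = LUp (a mod int n)" by (intro from_LB) (auto simp: is_path_Cons)
  have "Q \<noteq> []" "is_path N (LW ((a + 1) mod int n)) Q (RBd t')"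
    using less.prems unfolding P e by (auto simp: is_path_Cons mod_simps split: if_splits)
  then obtain f R where Q: "Q = f # R" "f \<in> arcs N" "src N f = LW ((a + 1) mod int n)"
    "if R = [] then tgt N f = RBd t' else is_path N (tgt N f) R (RBd t')"
    by (cases Q) (auto simp: is_path_Cons)
  from from_LW[OF Q(2,3)] show ?case
  proof
    assume f: "f = X ((a + 1) mod int n)"
    then have "is_path N (LB ((a + 1) mod int n)) R (RBd t')" using Q(4) by (auto split: if_splits)
    moreover have "length R < length P" by (simp add: P Q(1))
    ultimately obtain k l t where "t mod int n2 = t'" "exit t = a + 1 + int k + int l + 1"
      "R = map (reduce G) (left_part (a + 1) k @ Z (a + 1 + int k) # right_part (a + 1 + int k) l @ [Out t])"
      using less.hyps by blast
    then show ?thesis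
      by (intro exI[of _ "Suc k"] exI[of _ l] exI[of _ t]) (simp add: P Q(1) e f algebra_simps)
  next
    assume f: "f = Z (a mod int n)"
    then have "is_path N (RB (a mod int n)) R (RBd t')" using Q(4) by (auto split: if_splits)
    then obtain l t where "t mod int n2 = t'" "exit t = a + int l + 1"
      "R = map (reduce G) (right_part a l @ [Out t])" using right_paths by blast
    then show ?thesis
      by (intro exI[of _ 0] exI[of _ l] exI[of _ t]) (simp add: P Q(1) e f)
  qed
qed

lemma paths:
  assumes "t \<in> {0..<int n0}"
  shows "is_path N (LBd t) P (RBd t') \<longleftrightarrow>
    (\<exists>k l u. u mod int n2 = t' \<and> exit u = entry t + int k + int l + 1 \<and>
       P = map (reduce G) (cover_path t k l u))"
proof
  assume path: "is_path N (LBd t) P (RBd t')"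
  then obtain e Q where P: "P = e # Q" by (cases P) (auto simp: is_path_def)
  with path have e: "e = In t" by (intro from_LBd) (auto simp: is_path_Cons)
  have "is_path N (LB (entry t mod int n)) Q (RBd t')"
    using path unfolding P e by (auto simp: is_path_Cons entry_def split: if_splits)
  from left_paths[OF this] obtain k l u where "u mod int n2 = t'" "exit u = entry t + int k + int l + 1"
    "Q = map (reduce G) (left_part (entry t) k @ Z (entry t + int k) # right_part (entry t + int k) l @ [Out u])"
    by blast
  then show "\<exists>k l u. u mod int n2 = t' \<and> exit u = entry t + int k + int l + 1 \<and>
       P = map (reduce G) (cover_path t k l u)"
    using assms by (intro exI[of _ k] exI[of _ l] exI[of _ u]) (simp add: P e cover_path_def)
next
  assume "\<exists>k l u. u mod int n2 = t' \<and> exit u = entry t + int k + int l + 1 \<and>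
       P = map (reduce G) (cover_path t k l u)"
  then show "is_path N (LBd t) P (RBd t')"
    using is_path_reduce[OF cover_path_path] assms by fastforce
qed

lemma path_int_cover:
  assumes "is_path (cover G) u P v"
  shows "path_int N (map (reduce G) P) = \<lfloor>h v\<rfloor> - \<lfloor>h u\<rfloor>"
  using path_telescope[OF assms, of "\<lambda>v. \<lfloor>h v\<rfloor>"]
  by (simp add: path_int_def o_def crossings_reduce[simplified])

lemma edge_weight_reduce: "edge_weight w (reduce G e) = edge_weight w e"
proof -
  have per: "f (i mod int n) = f i" if "\<And>i. f (i + int n) = f i" for f :: "int \<Rightarrow> real" and i
  proof -
    have *: "f (i + int n * m) = f (i + int n * 0)" for m
    proof (rule int_const_if_step[where f = "\<lambda>m. f (i + int n * m)"])
      show "f (i + int n * (m + 1)) = f (i + int n * m)" for m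
        using that[of "i + int n * m"] by (simp add: algebra_simps)
    qed
    show ?thesis using *[of "- (i div int n)"] unfolding mod_shift[of i n] by simp
  qed
  obtain x y z where "w = (x, y, z)" by (rule prod_cases3)
  with w per[of x] per[of y] per[of z] show ?thesis
    by (cases e) (auto simp: is_weighting_def)
qed

lemma path_weight_cover_path:
  "path_weight N (map (reduce G) (cover_path t k l u)) =
    (\<Prod>i\<in>{entry t + 1..entry t + int k}. fst w i) * snd (snd w) (entry t + int k) *
    (\<Prod>i\<in>{entry t + int k + 1..entry t + int k + int l}. fst (snd w) i)"
proof -
  have left: "prod_list (map (edge_weight w) (left_part a k)) = (\<Prod>i\<in>{a + 1..a + int k}. fst w i)" for a
  proof (induction k arbitrary: a)
    case (Suc k)
    have "{a + 1..a + int (Suc k)} = insert (a + 1) {a + 1 + 1..a + 1 + int k}" by auto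
    then show ?case using Suc[of "a + 1"] by simp
  qed simp
  have right: "prod_list (map (edge_weight w) (right_part j l)) = (\<Prod>i\<in>{j + 1..j + int l}. fst (snd w) i)" for j
  proof (induction l arbitrary: j)
    case (Suc l)
    have "{j + 1..j + int (Suc l)} = insert (j + 1) {j + 1 + 1..j + 1 + int l}" by auto
    then show ?case using Suc[of "j + 1"] by simp
  qed simp
  have "path_weight N (map (reduce G) P) = prod_list (map (edge_weight w) P)" for P
    by (simp add: path_weight_def o_def edge_weight_reduce)
  then show ?thesis
    by (simp add: cover_path_def left right mult.assoc del: list.map)
       (simp add: left right mult.assoc)
qed

lemma arc_step_reduce:
  "arc_step N (reduce G e) = Complex (column (finish G e) - column (start G e)) (h (finish G e) - h (start G e))"
proof -
  have c: "column (shift G m v) = column v" for m v by (cases v) simp_all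
  have f: "frac (h (representative G v)) = frac (h v)" "column (representative G v) = column v" for v
    using representative_eq_shift[of v] by (auto simp: h_shift c frac_def)
  show ?thesis
    by (simp add: arc_step_def representative_reduce f crossings_reduce[simplified] complex_eq_iff) (simp add: frac_def)
qed

text \<open>All steps go right or straight up, and the first and last go strictly right. In the
  polygon formula the fractional heights of the ends cancel against the return steps, which leaves
  \<open>1 - path_int N P\<close>.\<close>

lemma wind_eq:
  assumes "t \<in> {0..<int n0}" "is_path N (LBd t) P (RBd t')"
  shows "wind N P = 1 - path_int N P"
proof -
  obtain k l u where u: "u mod int n2 = t'" "exit u = entry t + int k + int l + 1"
    "P = map (reduce G) (cover_path t k l u)"
    using assms paths by blast
  let ?L = "map (arc_step N) P"
  have ord: "h (LW i) < h (LB i)" "h (LB i) < h (LW (i + 1))" "h (RW i) < h (RB i)" "h (RB i) < h (RW (i + 1))" for i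
    using drawing by (auto simp: is_drawing_def)
  have "0 < Re (arc_step N (reduce G e)) \<or> Re (arc_step N (reduce G e)) = 0 \<and> 0 < Im (arc_step N (reduce G e))" for e
    unfolding arc_step_reduce using ord by (cases e) simp_all
  then have steps: "0 < Re d \<or> Re d = 0 \<and> 0 < Im d" if "d \<in> set ?L" for d
    using that by (auto simp: u(3))
  have ends: "0 < Re (hd ?L)" "0 < Re (last ?L)" "?L \<noteq> []"
    by (simp_all add: u(3) cover_path_def last_map arc_step_reduce del: reduce.simps)
  have path: "src N (hd P) = LBd t" "tgt N (last P) = RBd t'" using assms(2) by (simp_all add: is_path_def)
  have nonint: "h v \<notin> \<int>" for v using drawing by (simp add: is_drawing_def)
  have closed: "closed_steps N P = ?L @ [- \<i> * of_real (frac (h (RBd t'))), of_real (- 1), - \<i> * of_real (1 - frac (h (LBd t)))]"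
    unfolding closed_steps_def path by (simp add: return_steps_def Let_def)
  have "(\<Sum>e\<leftarrow>P. frac (h (tgt N e)) - frac (h (src N e))) = frac (h (RBd t')) - frac (h (LBd t))"
    by (rule path_telescope[OF assms(2)])
  moreover have "(\<Sum>d\<leftarrow>?L. Im d) = (\<Sum>e\<leftarrow>P. frac (h (tgt N e)) - frac (h (src N e))) + of_int (path_int N P)"
    unfolding path_int_def by (induction P) (simp_all add: arc_step_def)
  ultimately have "tangent_turns (closed_steps N P) = of_int (1 - path_int N P)"
    unfolding closed
    by (subst tangent_turns_polygon)
       (use ends steps nonint in \<open>auto simp: frac_gt_0_iff frac_lt_1\<close>)
  then show ?thesis unfolding wind_def by (intro the_equality) auto
qed

text \<open>
  Sheet \<open>m\<close> of the universal cover is reached by the paths with \<open>int = m\<close>, from \<open>LBd t\<close> to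
  the lift \<open>RBd (lift t t' m)\<close> of \<open>RBd t'\<close>.
\<close>

definition lift :: "int \<Rightarrow> int \<Rightarrow> int \<Rightarrow> int" where
  "lift t t' m = t' + int n2 * (m + \<lfloor>h (LBd t)\<rfloor> - \<lfloor>h (RBd t')\<rfloor>)"

lemma lift_iff:
  assumes "t' \<in> {0..<int n2}"
  shows "u = lift t t' m \<longleftrightarrow> u mod int n2 = t' \<and> \<lfloor>h (RBd u)\<rfloor> - \<lfloor>h (LBd t)\<rfloor> = m"
proof -
  have h: "\<lfloor>h (RBd (t' + int n2 * i))\<rfloor> = \<lfloor>h (RBd t')\<rfloor> + i" for i
    using h_shift[of i "RBd t'"] by simp
  show ?thesis
  proof
    assume "u = lift t t' m"
    then show "u mod int n2 = t' \<and> \<lfloor>h (RBd u)\<rfloor> - \<lfloor>h (LBd t)\<rfloor> = m"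
      using assms by (simp add: lift_def h)
  next
    assume *: "u mod int n2 = t' \<and> \<lfloor>h (RBd u)\<rfloor> - \<lfloor>h (LBd t)\<rfloor> = m"
    then have u: "u = t' + int n2 * (u div int n2)" by (metis mod_mult_div_eq)
    have "u div int n2 = m + \<lfloor>h (LBd t)\<rfloor> - \<lfloor>h (RBd t')\<rfloor>" using * h[of "u div int n2"] u by simp
    then show "u = lift t t' m" using u by (simp add: lift_def)
  qed
qed

text \<open>The paths with \<open>int = m\<close> correspond to the index \<open>j\<close> of their
  edge between the strings, so the sum is finite; \<open>wind_eq\<close> gives all of them the same
  sign.\<close>

lemma coefficient:
  assumes t: "t \<in> {0..<int n0}" and t': "t' \<in> {0..<int n2}"
  shows "(\<Sum>\<^sub>\<infinity> P \<in> {P. is_path N (LBd t) P (RBd t') \<and> path_int N P = m}.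
      (- 1) powi (wind N P - 1) * path_weight N P) =
    (- 1) powi (- m) * kernel (fst w) (fst (snd w)) (snd (snd w)) (entry t) (exit (lift t t' m))"
proof -
  define a where "a = entry t"
  define b where "b = exit (lift t t' m)"
  define path where "path j = map (reduce G) (cover_path t (nat (j - a)) (nat (b - 1 - j)) (lift t t' m))" for j
  have set: "{P. is_path N (LBd t) P (RBd t') \<and> path_int N P = m} = path ` {a..b - 1}"
  proof (intro set_eqI iffI)
    fix P assume "P \<in> {P. is_path N (LBd t) P (RBd t') \<and> path_int N P = m}"
    then obtain k l u where u: "u mod int n2 = t'" "exit u = entry t + int k + int l + 1"
      "P = map (reduce G) (cover_path t k l u)" "path_int N P = m"
      using paths[OF t] by auto
    then have "u = lift t t' m"
      using path_int_cover[OF cover_path_path[OF u(2)]] by (simp add: lift_iff[OF t'])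
    then show "P \<in> path ` {a..b - 1}"
      using u by (intro image_eqI[of _ _ "a + int k"]) (auto simp: path_def a_def b_def)
  next
    fix P assume "P \<in> path ` {a..b - 1}"
    then obtain j where j: "P = path j" "a \<le> j" "j \<le> b - 1" by auto
    then have ex: "exit (lift t t' m) = entry t + int (nat (j - a)) + int (nat (b - 1 - j)) + 1"
      by (simp add: a_def b_def)
    have "lift t t' m mod int n2 = t'" "\<lfloor>h (RBd (lift t t' m))\<rfloor> - \<lfloor>h (LBd t)\<rfloor> = m"
      using lift_iff[OF t'] by blast+
    moreover from this have "is_path N (LBd t) P (RBd t')"
      unfolding paths[OF t] j(1) path_def using ex by blast
    ultimately show "P \<in> {P. is_path N (LBd t) P (RBd t') \<and> path_int N P = m}"
      using path_int_cover[OF cover_path_path[OF ex]] j(1) unfolding path_def by simp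
  qed
  have inj: "inj_on path {a..b - 1}"
  proof (rule inj_onI)
    fix i j assume ij: "i \<in> {a..b - 1}" "j \<in> {a..b - 1}" "path i = path j"
    \<comment> \<open>The number of edges before the first \<open>Z\<close> edge recovers the
      index.\<close>
    have "length (takeWhile (\<lambda>e. \<forall>i. e \<noteq> Z i) (path i)) = 2 * nat (i - a) + 2" for i
    proof -
      have "reduce G e \<noteq> Z i'" if "\<forall>i. e \<noteq> Z i" for e i' using that by (cases e) auto
      then have left: "\<forall>i'. e \<noteq> Z i'" if "e \<in> set (map (reduce G) (left_part a (nat (i - a))))" for e
        using that Z_notin_left_part by (metis (no_types, lifting) image_iff list.set_map)
      have "takeWhile (\<lambda>e. \<forall>i. e \<noteq> Z i) (map (reduce G) (left_part a (nat (i - a))) @ Q) =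
          map (reduce G) (left_part a (nat (i - a))) @ takeWhile (\<lambda>e. \<forall>i. e \<noteq> Z i) Q" for Q
        by (rule takeWhile_append2) (rule left)
      then show ?thesis
        by (simp add: path_def cover_path_def length_left_part a_def[symmetric])
    qed
    then have "2 * nat (i - a) + 2 = 2 * nat (j - a) + 2" using ij(3) by metis
    then show "i = j" using ij(1,2) by auto
  qed
  have sign: "wind N (path j) - 1 = - m" if "j \<in> {a..b - 1}" for j
  proof -
    have "path j \<in> {P. is_path N (LBd t) P (RBd t') \<and> path_int N P = m}" using that set by blast
    then show ?thesis using wind_eq[OF t, of "path j" t'] by simp
  qed
  have weight: "path_weight N (path j) =
      (\<Prod>k\<in>{a + 1..j}. fst w k) * snd (snd w) j * (\<Prod>k\<in>{j + 1..b - 1}. fst (snd w) k)"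
    if "j \<in> {a..b - 1}" for j
    using that unfolding path_def path_weight_cover_path a_def[symmetric] by simp
  have "(\<Sum>\<^sub>\<infinity> P \<in> {P. is_path N (LBd t) P (RBd t') \<and> path_int N P = m}.
      (- 1) powi (wind N P - 1) * path_weight N P) =
    (\<Sum>j\<in>{a..b - 1}. (- 1) powi (wind N (path j) - 1) * path_weight N (path j))"
    unfolding set by (simp add: sum.reindex[OF inj])
  also have "\<dots> = (\<Sum>j\<in>{a..b - 1}. (- 1) powi (- m) *
      ((\<Prod>k\<in>{a + 1..j}. fst w k) * snd (snd w) j * (\<Prod>k\<in>{j + 1..b - 1}. fst (snd w) k)))"
    by (rule sum.cong) (simp_all only: sign weight)
  finally show ?thesis unfolding kernel_def a_def[symmetric] b_def[symmetric] sum_distrib_left .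
qed

end

section \<open>Boundary measurements as generating functions of path sums\<close>

context drawn_two_strings
begin

definition sheet_kernel :: "int \<Rightarrow> int \<Rightarrow> int \<Rightarrow> real" where
  "sheet_kernel t t' m = kernel (fst w) (fst (snd w)) (snd (snd w)) (entry t) (exit (lift t t' m))"

lemma exit_lift: "exit (lift t t' (m + i)) = exit (lift t t' m) + int n * i"
  unfolding lift_def exit_shift by (simp add: algebra_simps)

lemma exit_lift_bound: "\<exists>m0. \<forall>m\<ge>m0. entry t \<le> exit (lift t t' m)"
    "\<exists>m0. \<forall>m<m0. exit (lift t t' m) \<le> entry t"
proof -
  let ?d = "entry t - exit (lift t t' 0)"
  have e: "exit (lift t t' m) = exit (lift t t' 0) + int n * m" for m
    using exit_lift[of t t' 0 m] by simp
  have above: "?d \<le> int n * m" if "\<bar>?d\<bar> \<le> m" for m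
  proof -
    have "1 * m \<le> int n * m" using n_pos that by (intro mult_right_mono) auto
    then show ?thesis using that by linarith
  qed
  have "entry t \<le> exit (lift t t' m)" if "\<bar>?d\<bar> \<le> m" for m
    using above[OF that] e[of m] by linarith
  then show "\<exists>m0. \<forall>m\<ge>m0. entry t \<le> exit (lift t t' m)" by blast
  have below: "int n * m \<le> ?d" if "m < - \<bar>?d\<bar>" for m
  proof -
    have "int n * m \<le> 1 * m" using n_pos that by (intro mult_right_mono_neg) auto
    then show ?thesis using that by linarith
  qed
  have "exit (lift t t' m) \<le> entry t" if "m < - \<bar>?d\<bar>" for m
    using below[OF that] e[of m] by linarith
  then show "\<exists>m0. \<forall>m<m0. exit (lift t t' m) \<le> entry t" by blast
qed

text \<open>On sufficiently low sheets the exit is not above the entry, so the coefficients vanish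
  there and \<open>Abs_fls\<close> yields a genuine Laurent series.\<close>

lemma measurement_series_nth:
  assumes "t \<in> {0..<int n0}" "t' \<in> {0..<int n2}"
  shows "fls_nth (measurement_series N (LBd t) (RBd t')) m = (- 1) powi (- m) * sheet_kernel t t' m"
proof -
  obtain m0 where "\<forall>m<m0. exit (lift t t' m) \<le> entry t" using exit_lift_bound(2) by blast
  then have "\<forall>m<m0. (- 1) powi (- m) * sheet_kernel t t' m = 0"
    by (simp add: sheet_kernel_def kernel_empty)
  then show ?thesis
    unfolding measurement_series_def coefficient[OF assms] sheet_kernel_def[symmetric]
    by (rule nth_Abs_fls_lower_bound)
qed

lemma coordinates_exist:
  obtains X Y S P Q
  where "coordinates n (fst w) (fst (snd w)) (snd (snd w)) X Y S P Q"
proof -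
  have "weighting (fst w, fst (snd w), snd (snd w))"
    using w by (simp add: weighting_def is_weighting_def split_beta)
  then obtain X Y S P Q where "positive_coordinates n (fst w) (fst (snd w)) (snd (snd w)) X Y S P Q
    (x_set G 1) (y_set G 1) (\<lambda>i. x_index G 1 (lend G 1 i - 1)) (\<lambda>i. y_index G 1 (rend G 1 (i - 1) + 1))"
    by (rule positive_coordinates_exist)
  then have "coordinates n (fst w) (fst (snd w)) (snd (snd w)) X Y S P Q"
    by (simp add: positive_coordinates_def marked_coordinates_def)
  then show ?thesis by (rule that)
qed

lemma measurement_series_rational:
  assumes "t \<in> {0..<int n0}" "t' \<in> {0..<int n2}"
  shows "\<exists>p q. q \<noteq> 0 \<and> fps_to_fls (fps_of_poly q) * measurement_series N (LBd t) (RBd t') =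
    fps_to_fls (fps_of_poly p)"
proof -
  obtain X Y S P Q where "coordinates n (fst w) (fst (snd w)) (snd (snd w)) X Y S P Q"
    by (rule coordinates_exist)
  then interpret coordinates n "fst w" "fst (snd w)" "snd (snd w)" X Y S P Q .
  obtain m0 where m0: "\<And>m. m \<ge> m0 \<Longrightarrow> entry t \<le> exit (lift t t' m)" using exit_lift_bound(1) by blast
  show ?thesis
  proof (rule recurrent_fls_rational)
    fix m assume "m0 \<le> m"
    have "exit (lift t t' (m + 1)) = exit (lift t t' m) + int n"
      "exit (lift t t' (m + 2)) = exit (lift t t' m) + int n + int n"
      using exit_lift[of t t' m 1] exit_lift[of t t' m 2] by simp_all
    then have K: "sheet_kernel t t' (m + 2) = (P + Q) * sheet_kernel t t' (m + 1) - P * Q * sheet_kernel t t' m"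
      using kernel_recurrence[OF m0[OF \<open>m0 \<le> m\<close>]] by (simp add: sheet_kernel_def)
    \<comment> \<open>The alternating sign replaces the characteristic roots \<open>P\<close>,
      \<open>Q\<close> by \<open>- P\<close>, \<open>- Q\<close>.\<close>
    have sign: "(- 1 :: real) powi (- (m + 1)) = - ((- 1) powi (- m))"
      "(- 1 :: real) powi (- (m + 2)) = (- 1) powi (- m)"
      by (cases "even m"; simp add: power_int_minus_left)+
    show "fls_nth (measurement_series N (LBd t) (RBd t')) (m + 2)
        + (P + Q) * fls_nth (measurement_series N (LBd t) (RBd t')) (m + 1)
        + (P * Q) * fls_nth (measurement_series N (LBd t) (RBd t')) m = 0"
      unfolding measurement_series_nth[OF assms] sign K by (simp add: algebra_simps)
  qed
qed

end

context two_strings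
begin

lemma same_boundary_measurements_iff:
  assumes h: "is_drawing G h" and w: "is_weighting G w" and w': "is_weighting G w'"
  shows "same_boundary_measurements (expanded_network G h w) (expanded_network G h w') \<longleftrightarrow> same_kernel w w'"
proof -
  interpret a: drawn_two_strings G h w by unfold_locales (rule h w)+
  interpret b: drawn_two_strings G h w' by unfold_locales (rule h w')+
  have series: "measurement_series a.N (LBd t) (RBd t') = measurement_series b.N (LBd t) (RBd t') \<longleftrightarrow>
      (\<forall>m. a.sheet_kernel t t' m = b.sheet_kernel t t' m)"
    if "t \<in> {0..<int n0}" "t' \<in> {0..<int n2}" for t t'
    by (simp add: fls_eq_iff a.measurement_series_nth[OF that] b.measurement_series_nth[OF that])
  have bm: "boundary_measurement a.N (LBd t) (RBd t') = boundary_measurement b.N (LBd t) (RBd t') \<longleftrightarrow>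
      measurement_series a.N (LBd t) (RBd t') = measurement_series b.N (LBd t) (RBd t')"
    if "t \<in> {0..<int n0}" "t' \<in> {0..<int n2}" for t t'
  proof
    assume "boundary_measurement a.N (LBd t) (RBd t') = boundary_measurement b.N (LBd t) (RBd t')"
    then show "measurement_series a.N (LBd t) (RBd t') = measurement_series b.N (LBd t) (RBd t')"
      using a.measurement_series_rational[OF that] b.measurement_series_rational[OF that]
      by (elim exE conjE) (rule measurement_series_eqI)
  qed (simp add: boundary_measurement_def)
  have "same_boundary_measurements a.N b.N \<longleftrightarrow>
      (\<forall>t\<in>{0..<int n0}. \<forall>t'\<in>{0..<int n2}. \<forall>m. a.sheet_kernel t t' m = b.sheet_kernel t t' m)"
    by (auto simp: same_boundary_measurements_def bm series)
  also have "\<dots> \<longleftrightarrow> same_kernel w w'"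
  proof
    assume *: "\<forall>t\<in>{0..<int n0}. \<forall>t'\<in>{0..<int n2}. \<forall>m. a.sheet_kernel t t' m = b.sheet_kernel t t' m"
    show "same_kernel w w'"
      unfolding same_kernel_def
    proof (intro allI impI)
      fix i j assume "\<not> x_set G 1 i" "\<not> y_set G 1 j"
      then obtain u v where uv: "entry u = i" "exit v = j" using entry_surj exit_surj by metis
      define t where "t = u mod int n0"
      define t' where "t' = v mod int n2"
      define k where "k = u div int n0"
      have tt: "t \<in> {0..<int n0}" "t' \<in> {0..<int n2}"
        using boundary by (auto simp: t_def t'_def)
      have "u = t + int n0 * k" by (simp add: t_def k_def)
      then have i: "i = entry t + int n * k" using uv(1) entry_shift by simp
      \<comment> \<open>Both ends are moved by \<open>k\<close> periods to put the start into the
        fundamental domain; \<open>m\<close> is the sheet in which the end then lies.\<close>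
      define m where "m = v div int n2 - k - \<lfloor>h (LBd t)\<rfloor> + \<lfloor>h (RBd t')\<rfloor>"
      have "v = v mod int n2 + int n2 * (v div int n2)" by simp
      then have "v = a.lift t t' m + int n2 * k"
        unfolding a.lift_def m_def t'_def by (simp add: algebra_simps)
      then have j: "j = exit (a.lift t t' m) + int n * k" using uv(2) exit_shift by simp
      obtain X Y S P Q where a: "coordinates n (fst w) (fst (snd w)) (snd (snd w)) X Y S P Q"
        by (rule a.coordinates_exist)
      obtain X' Y' S' P' Q' where b: "coordinates n (fst w') (fst (snd w')) (snd (snd w')) X' Y' S' P' Q'"
        by (rule b.coordinates_exist)
      show "kernel (fst w) (fst (snd w)) (snd (snd w)) i j = kernel (fst w') (fst (snd w')) (snd (snd w')) i j"
        unfolding i j coordinates.kernel_translate[OF a] coordinates.kernel_translate[OF b]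
        using * tt by (simp add: a.sheet_kernel_def b.sheet_kernel_def)
    qed
  next
    assume same: "same_kernel w w'"
    show "\<forall>t\<in>{0..<int n0}. \<forall>t'\<in>{0..<int n2}. \<forall>m. a.sheet_kernel t t' m = b.sheet_kernel t t' m"
      unfolding a.sheet_kernel_def b.sheet_kernel_def
      by (intro ballI allI same[unfolded same_kernel_def, rule_format] entry_unmarked exit_unmarked)
  qed
  finally show ?thesis .
qed

end

text \<open>If the edges \<open>i - 1\<close> and \<open>i\<close> between the strings were
  parallel, the two strands that cross at edge \<open>i\<close> would cross again at edge
  \<open>i - 1\<close> in their next step, in the same order along both.\<close>

lemma no_parallel_edges:
  assumes "k_loop_plabic 2 G"
  shows "\<not> (x_set G 1 i \<and> y_set G 1 i)"
proof
  assume *: "x_set G 1 i \<and> y_set G 1 i"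
  have G: "strings G = 2" and d: "East 1 i \<in> darts G"
    using assms by (auto simp: k_loop_plabic_def darts_def)
  have "strand G 1 (East 1 i) = Some (West 1 (i - 1))"
    using * G by (simp add: strand_def y_set_def One_nat_def)
  moreover have "strand G 1 (reverse (East 1 i)) = Some (reverse (West 1 (i - 1)))"
    using * by (simp add: strand_def x_set_def One_nat_def)
  ultimately show False
    using assms d unfolding k_loop_plabic_def by (metis zero_less_one)
qed

theorem theorem4p13:
  shows "(\<forall>(G :: loop_graph) (h :: vertex \<Rightarrow> real) (w :: weights).
            k_loop_plabic 2 G \<and> is_drawing G h \<and> is_weighting G w \<longrightarrow>
              same_boundary_measurements
                (expanded_network G h (T_graph G w)) (expanded_network G h w) \<and>
              T_graph G (T_graph G w) = w \<and>
              {w'. is_weighting G w' \<and>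
                   same_boundary_measurements (expanded_network G h w') (expanded_network G h w)}
                = {w, T_graph G w}) \<and>
         (\<forall>(G :: loop_graph) (w :: string_weights).
            k_loop_plabic 3 G \<and> is_string_weighting G w \<longrightarrow>
              (T_strings G 1 \<circ> T_strings G 2 \<circ> T_strings G 1) w =
              (T_strings G 2 \<circ> T_strings G 1 \<circ> T_strings G 2) w)"
proof (intro conjI allI impI; (elim conjE)?)
  fix G :: loop_graph and h :: "vertex \<Rightarrow> real" and w :: weights
  assume G: "k_loop_plabic 2 G" and h: "is_drawing G h" and w: "is_weighting G w"
  interpret two_strings G by unfold_locales (use G in \<open>auto simp: k_loop_plabic_def\<close>)
  interpret simple_marking n "x_set G 1" "y_set G 1" "\<lambda>i. x_index G 1 (lend G 1 i - 1)"
    "\<lambda>i. y_index G 1 (rend G 1 (i - 1) + 1)"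
    by unfold_locales (rule no_parallel_edges[OF G])
  have weighting: "weighting = is_weighting G"
    by (intro ext) (simp add: weighting_def is_weighting_def)
  have Tw: "is_weighting G (T_graph G w)"
    using weighting_T_e w by (simp add: weighting T_graph_def)
  obtain x y z where xyz: "w = (x, y, z)" by (rule prod_cases3)
  obtain x' y' z' where xyz': "T_graph G w = (x', y', z')" by (rule prod_cases3)
  have "same_kernel (T_graph G w) w"
    using kernel_T_e[of x y z x' y' z'] w xyz xyz' by (simp add: same_kernel_def weighting T_graph_def)
  then show same: "same_boundary_measurements (expanded_network G h (T_graph G w)) (expanded_network G h w)"
    by (simp add: same_boundary_measurements_iff[OF h Tw w])
  show "T_graph G (T_graph G w) = w"
    using T_e_involution w by (simp add: weighting T_graph_def)
  show "{w'. is_weighting G w' \<and>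
       same_boundary_measurements (expanded_network G h w') (expanded_network G h w)} = {w, T_graph G w}"
  proof (intro set_eqI iffI)
    fix w' assume "w' \<in> {w'. is_weighting G w' \<and>
       same_boundary_measurements (expanded_network G h w') (expanded_network G h w)}"
    then have w': "is_weighting G w'" "same_kernel w' w"
      using same_boundary_measurements_iff[OF h _ w, of w'] by simp_all
    then have "same_kernel w w'" by (simp add: same_kernel_def)
    then show "w' \<in> {w, T_graph G w}"
      using same_kernel_imp[of w w'] w w' by (simp add: weighting T_graph_def)
  next
    fix w' assume "w' \<in> {w, T_graph G w}"
    then show "w' \<in> {w'. is_weighting G w' \<and>
       same_boundary_measurements (expanded_network G h w') (expanded_network G h w)}"
      using same w Tw by (auto simp: same_boundary_measurements_def)
  qed
next
  fix G :: loop_graph and w :: string_weights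
  assume G: "k_loop_plabic 3 G" and w: "is_string_weighting G w"
  interpret three_strings G by unfold_locales (use G in \<open>auto simp: k_loop_plabic_def\<close>)
  show "(T_strings G 1 \<circ> T_strings G 2 \<circ> T_strings G 1) w =
      (T_strings G 2 \<circ> T_strings G 1 \<circ> T_strings G 2) w"
    using braid[OF w] by simp
qed

end
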